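(* Let $(M^m,\mathcal{E},\langle\,,\,\rangle,D,\varphi)$ be a (co-oriented) coherent tangent bundle over an oriented $m$-manifold $M^m$, let $p\in\Sigma_\varphi$ be a $\varphi$-singular point, and assume that $p$ is non-degenerate but is not an $A_2$-point of $\varphi$. Take a regular curve $\gamma\colon[0,1]\ni t\mapsto\gamma(t)\in\Sigma_\varphi$ such that $\gamma(0)=p$ and $\gamma((0,1])$ consists only of $A_2$-points of $\varphi$. Then one of the $\varphi$-singular principal curvatures along $\gamma(t)$ diverges to $-\infty$ as $t\to+0$.
   Context: All objects are $C^\infty$. A coherent tangent bundle over an oriented $m$-manifold $M^m$ is a tuple $(M^m,\mathcal{E},\langle\,,\,\rangle,D,\varphi)$ where $\mathcal{E}$ is a rank $m$ real vector bundle over $M^m$ with a (positive definite) inner product $\langle\,,\,\rangle$, $D$ is a metric connection on $(\mathcal{E},\langle\,,\,\rangle)$, and $\varphi\colon TM^m\to\mathcal{E}$ is a bundle homomorphism with $D_X\varphi(Y)-D_Y\varphi(X)-\varphi([X,Y])=0$ for all vector fields $X,Y$. Standing assumption: $\mathcal{E}$ is orientable and a co-orientation is fixed, i.e. a section $\mu$ of $\det(\mathcal{E}^* )$ with $\mu=\pm1$ on orthonormal frames; a frame is positive if $\mu>0$ on it. The $\varphi$-metric is $ds^2_\varphi=\varphi^*\langle\,,\,\rangle$. On a positively oriented coordinate neighbourhood $(U;u_1,\dots,u_m)$ the $\varphi$-Jacobian function is $\lambda_\varphi=\mu(\varphi(\partial/\partial u_1),\dots,\varphi(\partial/\partial u_m))$.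 The $\varphi$-singular set $\Sigma_\varphi$ is the set of points where $\varphi_p\colon T_pM^m\to\mathcal{E}_p$ is not bijective, so $\Sigma_\varphi\cap U=\{\lambda_\varphi=0\}$. A point $p\in\Sigma_\varphi$ is non-degenerate if $d\lambda_\varphi\neq0$ at $p$; near such a point $\Sigma_\varphi$ is an embedded $(m-1)$-submanifold, $\operatorname{rank}\varphi=m-1$ on it, and the kernel of $\varphi$ is called the null direction. A null vector field $\eta$ is a non-vanishing smooth vector field along $\Sigma_\varphi$ spanning $\operatorname{Ker}\varphi$. A non-degenerate $p\in\Sigma_\varphi$ is an $A_2$-point of $\varphi$ if $\eta(p)$ is transversal to $\Sigma_\varphi$ at $p$. Near an $A_2$-point, $ds^2_\varphi$ is positive definite on $T\Sigma_\varphi$. Take a local orthonormal frame $e_1,\dots,e_{m-1}$ of $(T\Sigma_\varphi,ds^2_\varphi)$, the section $\boldsymbol{n}$ of $\mathcal{E}$ along $\Sigma_\varphi$ such that $(\varphi(e_1),\dots,\varphi(e_{m-1}),\boldsymbol{n})$ is a positive orthonormal frame of $\mathcal{E}$, and a null vector field $\eta$ such that $(e_1,\dots,e_{m-1},\eta)$ is positively oriented on $M^m$. The singular shape operator at an $A_2$-point $q$ is $S_\varphi(X)=-\operatorname{sgn}(d\lambda_\varphi(\eta(q)))\,\varphi^{-1}(D_X\boldsymbol{n})$ for $X\in T_q\Sigma_\varphi$, where $\varphi^{-1}$ is the inverse of the injective map $\varphi|_{T_q\Sigma_\varphi}$ (note $D_X\boldsymbol{n}\in\varphi(T_q\Sigma_\varphi)$).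 It is an endomorphism of $T_q\Sigma_\varphi$, independent of the choices, and symmetric with respect to $ds^2_\varphi$. Its eigenvalues are the $\varphi$-singular principal curvatures at $q$. *)

theory Defs
  imports "HOL-Analysis.Analysis"
begin

section \<open>Smooth maps on open subsets of normed spaces\<close>

text \<open>To be used for open \<open>U\<close> in a finite-dimensional space, where continuity of all directional
  derivatives of a differentiable map is continuity of the derivative.\<close>

primrec Ck_on :: "nat \<Rightarrow> 'a::real_normed_vector set \<Rightarrow> ('a \<Rightarrow> 'b::real_normed_vector) \<Rightarrow> bool" where
  "Ck_on 0 U f \<longleftrightarrow> continuous_on U f"
| "Ck_on (Suc k) U f \<longleftrightarrow>
     f differentiable_on U \<and> (\<forall>v. Ck_on k U (\<lambda>x. frechet_derivative f (at x) v))"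

definition smooth_on :: "'a::real_normed_vector set \<Rightarrow> ('a \<Rightarrow> 'b::real_normed_vector) \<Rightarrow> bool" where
  "smooth_on U f \<longleftrightarrow> (\<forall>k. Ck_on k U f)"

section \<open>Oriented manifolds\<close>

text \<open>The manifold is a whole type \<open>'a\<close>; its dimension is \<open>CARD('m)\<close>.  A chart is a pair
  \<open>(U, \<psi>)\<close> of an open set and a map whose values outside \<open>U\<close> are irrelevant.  The linear order of
  the index type \<open>'m\<close> is that of the coordinates \<open>u\<^sub>1, \<dots>, u\<^sub>m\<close>.\<close>

type_synonym ('a, 'm) chart = "'a set \<times> ('a \<Rightarrow> real ^ 'm)"

definition chart_inv :: "('a, 'm::finite) chart \<Rightarrow> real ^ 'm \<Rightarrow> 'a" where
  "chart_inv c = inv_into (fst c) (snd c)"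

definition oriented_atlas :: "('a::topological_space, 'm::finite) chart set \<Rightarrow> bool" where
  "oriented_atlas A \<longleftrightarrow>
     (\<Union>c\<in>A. fst c) = UNIV \<and>
     (\<forall>c\<in>A. open (fst c) \<and> open (snd c ` fst c) \<and>
            homeomorphism (fst c) (snd c ` fst c) (snd c) (chart_inv c)) \<and>
     (\<forall>c\<in>A. \<forall>c'\<in>A. smooth_on (snd c ` (fst c \<inter> fst c')) (snd c' \<circ> chart_inv c)) \<and>
     (\<forall>c\<in>A. \<forall>c'\<in>A. \<forall>x\<in>fst c \<inter> fst c'.
        0 < det (matrix (frechet_derivative (snd c' \<circ> chart_inv c) (at (snd c x)))))"

text \<open>A tangent vector is the family of its coordinate vectors in all charts of the atlas around its
  base point, related by the Jacobians of the coordinate changes (and 0 at irrelevant indices).\<close>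

type_synonym ('a, 'm) tvec = "('a, 'm) chart \<Rightarrow> real ^ 'm"

definition tangent_space :: "('a, 'm::finite) chart set \<Rightarrow> 'a \<Rightarrow> ('a, 'm) tvec set" where
  "tangent_space A x = {v.
     (\<forall>c\<in>A. \<forall>c'\<in>A. x \<in> fst c \<inter> fst c' \<longrightarrow>
        v c' = frechet_derivative (snd c' \<circ> chart_inv c) (at (snd c x)) (v c)) \<and>
     (\<forall>c. \<not> (c \<in> A \<and> x \<in> fst c) \<longrightarrow> v c = 0)}"

definition coord_vec :: "('a, 'm::finite) chart set \<Rightarrow> ('a, 'm) chart \<Rightarrow> 'm \<Rightarrow> 'a \<Rightarrow> ('a, 'm) tvec" where
  "coord_vec A c i x = (\<lambda>c'. if c' \<in> A \<and> x \<in> fst c'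
     then frechet_derivative (snd c' \<circ> chart_inv c) (at (snd c x)) (axis i 1) else 0)"

text \<open>\<open>df(v)\<close> at \<open>x\<close>, computed in the chart \<open>c\<close> around \<open>x\<close>.\<close>

definition dfun :: "('a, 'm::finite) chart \<Rightarrow> ('a \<Rightarrow> real) \<Rightarrow> 'a \<Rightarrow> ('a, 'm) tvec \<Rightarrow> real" where
  "dfun c f x v = frechet_derivative (f \<circ> chart_inv c) (at (snd c x)) (v c)"

definition smooth_fun :: "('a, 'm::finite) chart set \<Rightarrow> 'a set \<Rightarrow> ('a \<Rightarrow> real) \<Rightarrow> bool" where
  "smooth_fun A V f \<longleftrightarrow> (\<forall>c\<in>A. smooth_on (snd c ` (V \<inter> fst c)) (f \<circ> chart_inv c))"

definition smooth_vf ::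
  "('a, 'm::finite) chart set \<Rightarrow> 'a set \<Rightarrow> ('a \<Rightarrow> ('a, 'm) tvec) \<Rightarrow> bool" where
  "smooth_vf A V X \<longleftrightarrow> (\<forall>x\<in>V. X x \<in> tangent_space A x) \<and>
     (\<forall>c\<in>A. smooth_on (snd c ` (V \<inter> fst c)) (\<lambda>y. X (chart_inv c y) c))"

text \<open>The Lie bracket \<open>[X,Y]\<^sup>i = \<Sum>\<^sub>j X\<^sup>j \<partial>\<^sub>jY\<^sup>i - Y\<^sup>j \<partial>\<^sub>jX\<^sup>i\<close>.\<close>

definition lie_bracket ::
  "('a, 'm::finite) chart set \<Rightarrow> ('a \<Rightarrow> ('a, 'm) tvec) \<Rightarrow> ('a \<Rightarrow> ('a, 'm) tvec) \<Rightarrow> 'a \<Rightarrow> ('a, 'm) tvec"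
  where
  "lie_bracket A X Y x = (\<lambda>c. if c \<in> A \<and> x \<in> fst c then
       frechet_derivative (\<lambda>y. Y (chart_inv c y) c) (at (snd c x)) (X x c)
     - frechet_derivative (\<lambda>y. X (chart_inv c y) c) (at (snd c x)) (Y x c) else 0)"

definition pos_oriented :: "('a, 'm::finite) chart set \<Rightarrow> 'a \<Rightarrow> ('m \<Rightarrow> ('a, 'm) tvec) \<Rightarrow> bool" where
  "pos_oriented A x f \<longleftrightarrow> (\<forall>i. f i \<in> tangent_space A x) \<and>
     (\<forall>c\<in>A. x \<in> fst c \<longrightarrow> 0 < det (\<chi> i. f i c))"

text \<open>Smoothness of a curve on a not necessarily open \<open>J\<close> means that it has local smooth extensions in
  charts.\<close>

definition smooth_curve ::
  "('a::topological_space, 'm::finite) chart set \<Rightarrow> real set \<Rightarrow> (real \<Rightarrow> 'a) \<Rightarrow> bool" where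
  "smooth_curve A J \<gamma> \<longleftrightarrow> (\<forall>t\<in>J. \<forall>c\<in>A. \<gamma> t \<in> fst c \<longrightarrow>
     (\<exists>N h. open N \<and> t \<in> N \<and> smooth_on N h \<and>
            (\<forall>s\<in>N \<inter> J. \<gamma> s \<in> fst c \<and> snd c (\<gamma> s) = h s)))"

definition velocity ::
  "('a, 'm::finite) chart set \<Rightarrow> real set \<Rightarrow> (real \<Rightarrow> 'a) \<Rightarrow> real \<Rightarrow> ('a, 'm) tvec" where
  "velocity A J \<gamma> t = (\<lambda>c. if c \<in> A \<and> \<gamma> t \<in> fst c
     then vector_derivative (\<lambda>s. snd c (\<gamma> s)) (at t within J) else 0)"

definition regular_curve ::
  "('a::topological_space, 'm::finite) chart set \<Rightarrow> real set \<Rightarrow> (real \<Rightarrow> 'a) \<Rightarrow> bool" where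
  "regular_curve A J \<gamma> \<longleftrightarrow> smooth_curve A J \<gamma> \<and> (\<forall>t\<in>J. velocity A J \<gamma> t \<noteq> (\<lambda>_. 0))"

section \<open>Coherent tangent bundles\<close>

text \<open>The fibres of \<open>\<E>\<close> are subspaces of one real vector space \<open>'e\<close>, which carries no topology; the
  smooth structure of \<open>\<E>\<close> is given by a set of local frames \<open>(W, f)\<close> with smooth transition functions.
  \<open>ctb_conn B x v s\<close> is \<open>D\<^sub>v s\<close> for \<open>v\<close> tangent at \<open>x\<close> and a section \<open>s\<close> that is smooth near \<open>x\<close>;
  \<open>ctb_coor B x\<close> is the alternating form \<open>\<mu>\<close> on the fibre at \<open>x\<close>.\<close>

record ('a, 'm, 'e) ctb =
  ctb_atlas :: "('a, 'm) chart set"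
  ctb_fibre :: "'a \<Rightarrow> 'e set"
  ctb_frames :: "('a set \<times> ('m \<Rightarrow> 'a \<Rightarrow> 'e)) set"
  ctb_inner :: "'a \<Rightarrow> 'e \<Rightarrow> 'e \<Rightarrow> real"
  ctb_conn :: "'a \<Rightarrow> ('a, 'm) tvec \<Rightarrow> ('a \<Rightarrow> 'e) \<Rightarrow> 'e"
  ctb_phi :: "'a \<Rightarrow> ('a, 'm) tvec \<Rightarrow> 'e"
  ctb_coor :: "'a \<Rightarrow> ('m \<Rightarrow> 'e) \<Rightarrow> real"

abbreviation TM :: "('a, 'm::finite, 'e) ctb \<Rightarrow> 'a \<Rightarrow> ('a, 'm) tvec set" where
  "TM B \<equiv> tangent_space (ctb_atlas B)"

definition smooth_section :: "('a, 'm::finite, 'e::real_vector) ctb \<Rightarrow> 'a set \<Rightarrow> ('a \<Rightarrow> 'e) \<Rightarrow> bool" where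
  "smooth_section B V s \<longleftrightarrow> (\<forall>x\<in>V. s x \<in> ctb_fibre B x) \<and>
     (\<forall>(W, f)\<in>ctb_frames B. \<exists>a. (\<forall>i. smooth_fun (ctb_atlas B) (V \<inter> W) (a i)) \<and>
        (\<forall>x\<in>V \<inter> W. s x = (\<Sum>i\<in>UNIV. a i x *\<^sub>R f i x)))"

definition vector_bundle :: "('a::topological_space, 'm::finite, 'e::real_vector) ctb \<Rightarrow> bool" where
  "vector_bundle B \<longleftrightarrow>
     (\<Union>(W, f)\<in>ctb_frames B. W) = UNIV \<and>
     (\<forall>(W, f)\<in>ctb_frames B. open W \<and>
        (\<forall>x\<in>W. inj (\<lambda>i. f i x) \<and> independent (range (\<lambda>i. f i x)) \<and>
               span (range (\<lambda>i. f i x)) = ctb_fibre B x) \<and>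
        (\<forall>i. smooth_section B W (f i)))"

definition bundle_metric :: "('a::topological_space, 'm::finite, 'e::real_vector) ctb \<Rightarrow> bool" where
  "bundle_metric B \<longleftrightarrow>
     (\<forall>x. \<forall>u\<in>ctb_fibre B x. \<forall>v\<in>ctb_fibre B x. ctb_inner B x u v = ctb_inner B x v u) \<and>
     (\<forall>x. \<forall>u\<in>ctb_fibre B x. \<forall>v\<in>ctb_fibre B x. \<forall>w\<in>ctb_fibre B x. \<forall>a b.
        ctb_inner B x (a *\<^sub>R u + b *\<^sub>R v) w = a * ctb_inner B x u w + b * ctb_inner B x v w) \<and>
     (\<forall>x. \<forall>u\<in>ctb_fibre B x. u \<noteq> 0 \<longrightarrow> 0 < ctb_inner B x u u) \<and>
     (\<forall>V s t. open V \<longrightarrow> smooth_section B V s \<longrightarrow> smooth_section B V t \<longrightarrow>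
        smooth_fun (ctb_atlas B) V (\<lambda>x. ctb_inner B x (s x) (t x)))"

text \<open>A connection acts on local sections; being an operator on germs is the third clause.\<close>

definition connection :: "('a::topological_space, 'm::finite, 'e::real_vector) ctb \<Rightarrow> bool" where
  "connection B \<longleftrightarrow>
     (\<forall>V s x. open V \<longrightarrow> x \<in> V \<longrightarrow> smooth_section B V s \<longrightarrow>
        (\<forall>v\<in>TM B x. ctb_conn B x v s \<in> ctb_fibre B x)) \<and>
     (\<forall>V s x a b. open V \<longrightarrow> x \<in> V \<longrightarrow> smooth_section B V s \<longrightarrow>
        (\<forall>v\<in>TM B x. \<forall>w\<in>TM B x. ctb_conn B x (\<lambda>c. a *\<^sub>R v c + b *\<^sub>R w c) s
           = a *\<^sub>R ctb_conn B x v s + b *\<^sub>R ctb_conn B x w s)) \<and>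
     (\<forall>V s t x. open V \<longrightarrow> x \<in> V \<longrightarrow> smooth_section B V s \<longrightarrow> smooth_section B V t \<longrightarrow>
        (\<forall>y\<in>V. s y = t y) \<longrightarrow> (\<forall>v\<in>TM B x. ctb_conn B x v s = ctb_conn B x v t)) \<and>
     (\<forall>V s t x. open V \<longrightarrow> x \<in> V \<longrightarrow> smooth_section B V s \<longrightarrow> smooth_section B V t \<longrightarrow>
        (\<forall>v\<in>TM B x. ctb_conn B x v (\<lambda>y. s y + t y) = ctb_conn B x v s + ctb_conn B x v t)) \<and>
     (\<forall>V f s x. open V \<longrightarrow> x \<in> V \<longrightarrow> smooth_fun (ctb_atlas B) V f \<longrightarrow> smooth_section B V s \<longrightarrow>
        (\<forall>v\<in>TM B x. \<forall>c\<in>ctb_atlas B. x \<in> fst c \<longrightarrow>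
           ctb_conn B x v (\<lambda>y. f y *\<^sub>R s y) = dfun c f x v *\<^sub>R s x + f x *\<^sub>R ctb_conn B x v s)) \<and>
     (\<forall>V X s. open V \<longrightarrow> smooth_vf (ctb_atlas B) V X \<longrightarrow> smooth_section B V s \<longrightarrow>
        smooth_section B V (\<lambda>x. ctb_conn B x (X x) s))"

definition metric_connection :: "('a::topological_space, 'm::finite, 'e::real_vector) ctb \<Rightarrow> bool" where
  "metric_connection B \<longleftrightarrow> connection B \<and>
     (\<forall>V s t x. open V \<longrightarrow> x \<in> V \<longrightarrow> smooth_section B V s \<longrightarrow> smooth_section B V t \<longrightarrow>
        (\<forall>v\<in>TM B x. \<forall>c\<in>ctb_atlas B. x \<in> fst c \<longrightarrow>
           dfun c (\<lambda>y. ctb_inner B y (s y) (t y)) x v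
             = ctb_inner B x (ctb_conn B x v s) (t x) + ctb_inner B x (s x) (ctb_conn B x v t)))"

definition bundle_hom :: "('a::topological_space, 'm::finite, 'e::real_vector) ctb \<Rightarrow> bool" where
  "bundle_hom B \<longleftrightarrow>
     (\<forall>x. \<forall>v\<in>TM B x. ctb_phi B x v \<in> ctb_fibre B x) \<and>
     (\<forall>x. \<forall>v\<in>TM B x. \<forall>w\<in>TM B x. \<forall>a b.
        ctb_phi B x (\<lambda>c. a *\<^sub>R v c + b *\<^sub>R w c) = a *\<^sub>R ctb_phi B x v + b *\<^sub>R ctb_phi B x w) \<and>
     (\<forall>V X. open V \<longrightarrow> smooth_vf (ctb_atlas B) V X \<longrightarrow> smooth_section B V (\<lambda>x. ctb_phi B x (X x)))"

definition torsion_free :: "('a::topological_space, 'm::finite, 'e::real_vector) ctb \<Rightarrow> bool" where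
  "torsion_free B \<longleftrightarrow>
     (\<forall>V X Y. open V \<longrightarrow> smooth_vf (ctb_atlas B) V X \<longrightarrow> smooth_vf (ctb_atlas B) V Y \<longrightarrow>
        (\<forall>x\<in>V. ctb_conn B x (X x) (\<lambda>y. ctb_phi B y (Y y))
              - ctb_conn B x (Y x) (\<lambda>y. ctb_phi B y (X y))
              - ctb_phi B x (lie_bracket (ctb_atlas B) X Y x) = 0))"

definition orthonormal_frame ::
  "('a, 'm::finite, 'e::real_vector) ctb \<Rightarrow> 'a \<Rightarrow> ('m \<Rightarrow> 'e) \<Rightarrow> bool" where
  "orthonormal_frame B x f \<longleftrightarrow> (\<forall>i. f i \<in> ctb_fibre B x) \<and>
     (\<forall>i j. ctb_inner B x (f i) (f j) = (if i = j then 1 else 0))"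

definition co_orientation :: "('a::topological_space, 'm::finite, 'e::real_vector) ctb \<Rightarrow> bool" where
  "co_orientation B \<longleftrightarrow>
     (\<forall>x f i a b. \<forall>u\<in>ctb_fibre B x. \<forall>v\<in>ctb_fibre B x. (\<forall>j. f j \<in> ctb_fibre B x) \<longrightarrow>
        ctb_coor B x (f(i := a *\<^sub>R u + b *\<^sub>R v))
          = a * ctb_coor B x (f(i := u)) + b * ctb_coor B x (f(i := v))) \<and>
     (\<forall>x f i j. (\<forall>k. f k \<in> ctb_fibre B x) \<longrightarrow> i \<noteq> j \<longrightarrow> f i = f j \<longrightarrow> ctb_coor B x f = 0) \<and>
     (\<forall>V s. open V \<longrightarrow> (\<forall>i. smooth_section B V (s i)) \<longrightarrow>
        smooth_fun (ctb_atlas B) V (\<lambda>x. ctb_coor B x (\<lambda>i. s i x))) \<and>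
     (\<forall>x f. orthonormal_frame B x f \<longrightarrow> ctb_coor B x f = 1 \<or> ctb_coor B x f = -1)"

definition coherent_tangent_bundle ::
  "('a::topological_space, 'm::finite, 'e::real_vector) ctb \<Rightarrow> bool" where
  "coherent_tangent_bundle B \<longleftrightarrow>
     oriented_atlas (ctb_atlas B) \<and> vector_bundle B \<and> bundle_metric B \<and> metric_connection B \<and>
     bundle_hom B \<and> torsion_free B \<and> co_orientation B"

section \<open>Singular points\<close>

definition phi_metric ::
  "('a, 'm::finite, 'e) ctb \<Rightarrow> 'a \<Rightarrow> ('a, 'm) tvec \<Rightarrow> ('a, 'm) tvec \<Rightarrow> real" where
  "phi_metric B x v w = ctb_inner B x (ctb_phi B x v) (ctb_phi B x w)"

definition phi_jacobian :: "('a, 'm::finite, 'e) ctb \<Rightarrow> ('a, 'm) chart \<Rightarrow> 'a \<Rightarrow> real" where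
  "phi_jacobian B c x = ctb_coor B x (\<lambda>i. ctb_phi B x (coord_vec (ctb_atlas B) c i x))"

definition singular_set :: "('a, 'm::finite, 'e) ctb \<Rightarrow> 'a set" where
  "singular_set B = {x. \<not> bij_betw (ctb_phi B x) (TM B x) (ctb_fibre B x)}"

definition nondegenerate :: "('a, 'm::finite, 'e) ctb \<Rightarrow> 'a \<Rightarrow> bool" where
  "nondegenerate B x \<longleftrightarrow> x \<in> singular_set B \<and>
     (\<exists>c\<in>ctb_atlas B. x \<in> fst c \<and> (\<exists>v\<in>TM B x. dfun c (phi_jacobian B c) x v \<noteq> 0))"

text \<open>The tangent space of the singular set at \<open>x\<close>: velocities at \<open>x\<close> of smooth curves lying in it.\<close>

definition singular_tangent_space ::
  "('a::topological_space, 'm::finite, 'e) ctb \<Rightarrow> 'a \<Rightarrow> ('a, 'm) tvec set" where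
  "singular_tangent_space B x = {velocity (ctb_atlas B) {-1<..<1} \<alpha> 0 | \<alpha>.
     smooth_curve (ctb_atlas B) {-1<..<1} \<alpha> \<and> \<alpha> ` {-1<..<1} \<subseteq> singular_set B \<and> \<alpha> 0 = x}"

text \<open>Smoothness along a subset \<open>P\<close> (below a relatively open subset of the singular set) is local
  smooth extendability.\<close>

definition smooth_vf_along ::
  "('a::topological_space, 'm::finite) chart set \<Rightarrow> 'a set \<Rightarrow> ('a \<Rightarrow> ('a, 'm) tvec) \<Rightarrow> bool" where
  "smooth_vf_along A P X \<longleftrightarrow>
     (\<forall>x\<in>P. \<exists>V Y. open V \<and> x \<in> V \<and> smooth_vf A V Y \<and> (\<forall>y\<in>V \<inter> P. Y y = X y))"

definition smooth_section_along ::
  "('a::topological_space, 'm::finite, 'e::real_vector) ctb \<Rightarrow> 'a set \<Rightarrow> ('a \<Rightarrow> 'e) \<Rightarrow> bool" where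
  "smooth_section_along B P s \<longleftrightarrow>
     (\<forall>x\<in>P. \<exists>V t. open V \<and> x \<in> V \<and> smooth_section B V t \<and> (\<forall>y\<in>V \<inter> P. t y = s y))"

definition null_vector_field ::
  "('a::topological_space, 'm::finite, 'e::real_vector) ctb \<Rightarrow> 'a set \<Rightarrow> ('a \<Rightarrow> ('a, 'm) tvec) \<Rightarrow> bool"
  where
  "null_vector_field B P \<eta> \<longleftrightarrow> smooth_vf_along (ctb_atlas B) P \<eta> \<and>
     (\<forall>x\<in>P. \<eta> x \<noteq> (\<lambda>_. 0) \<and> {v \<in> TM B x. ctb_phi B x v = 0} = range (\<lambda>a c. a *\<^sub>R \<eta> x c))"

definition A2_point :: "('a::topological_space, 'm::finite, 'e::real_vector) ctb \<Rightarrow> 'a \<Rightarrow> bool" where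
  "A2_point B x \<longleftrightarrow> nondegenerate B x \<and>
     (\<exists>W \<eta>. open W \<and> x \<in> W \<and> null_vector_field B (W \<inter> singular_set B) \<eta> \<and>
        (\<forall>v\<in>TM B x. \<exists>w\<in>singular_tangent_space B x. \<exists>a. v = (\<lambda>c. w c + a *\<^sub>R \<eta> x c)))"

section \<open>The singular shape operator\<close>

text \<open>The last of the indices \<open>1, \<dots>, m\<close>; the frame \<open>e\<^sub>1, \<dots>, e\<^sub>m\<^sub>-\<^sub>1\<close> of the tangent spaces of the
  singular set is indexed by the others.\<close>

definition last_index :: "'m::{finite,linorder}" where
  "last_index = Max UNIV"

definition adapted_frame ::
  "('a::topological_space, 'm::{finite,linorder}, 'e::real_vector) ctb \<Rightarrow> 'a set \<Rightarrow>
     ('m \<Rightarrow> 'a \<Rightarrow> ('a, 'm) tvec) \<Rightarrow> ('a \<Rightarrow> ('a, 'm) tvec) \<Rightarrow> ('a \<Rightarrow> 'e) \<Rightarrow> bool" where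
  "adapted_frame B P e \<eta> n \<longleftrightarrow>
     (\<forall>i. i \<noteq> last_index \<longrightarrow> smooth_vf_along (ctb_atlas B) P (e i)) \<and>
     null_vector_field B P \<eta> \<and>
     smooth_section_along B P n \<and>
     (\<forall>x\<in>P.
        (\<forall>i. i \<noteq> last_index \<longrightarrow> e i x \<in> singular_tangent_space B x) \<and>
        (\<forall>i j. i \<noteq> last_index \<longrightarrow> j \<noteq> last_index \<longrightarrow>
           phi_metric B x (e i x) (e j x) = (if i = j then 1 else 0)) \<and>
        (\<forall>v\<in>singular_tangent_space B x. \<exists>a. v = (\<lambda>c. \<Sum>i\<in>UNIV - {last_index}. a i *\<^sub>R e i x c)) \<and>
        orthonormal_frame B x (\<lambda>i. if i = last_index then n x else ctb_phi B x (e i x)) \<and>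
        0 < ctb_coor B x (\<lambda>i. if i = last_index then n x else ctb_phi B x (e i x)) \<and>
        pos_oriented (ctb_atlas B) x (\<lambda>i. if i = last_index then \<eta> x else e i x))"

text \<open>\<open>S\<close> is the singular shape operator at \<open>q\<close>; it is determined on the tangent space of the singular
  set, independently of all choices, and its values elsewhere are irrelevant.  \<open>n\<close> lives along the
  singular set only, so \<open>D\<^sub>X n\<close> is computed with a smooth extension \<open>n'\<close> of \<open>n\<close> near \<open>q\<close>.  The values
  of \<open>S\<close> are characterized by applying \<open>\<phi>\<close>, which is injective on this tangent space.\<close>

definition singular_shape_operator ::
  "('a::topological_space, 'm::{finite,linorder}, 'e::real_vector) ctb \<Rightarrow> 'a \<Rightarrow>
     (('a, 'm) tvec \<Rightarrow> ('a, 'm) tvec) \<Rightarrow> bool" where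
  "singular_shape_operator B q S \<longleftrightarrow> A2_point B q \<and>
     (\<exists>W e \<eta> n n' c. open W \<and> q \<in> W \<and> adapted_frame B (W \<inter> singular_set B) e \<eta> n \<and>
        smooth_section B W n' \<and> (\<forall>x\<in>W \<inter> singular_set B. n' x = n x) \<and>
        c \<in> ctb_atlas B \<and> q \<in> fst c \<and>
        (\<forall>X\<in>singular_tangent_space B q. S X \<in> singular_tangent_space B q \<and>
           ctb_phi B q (S X)
             = (- sgn (dfun c (phi_jacobian B c) q (\<eta> q))) *\<^sub>R ctb_conn B q X n'))"

definition singular_principal_curvature ::
  "('a::topological_space, 'm::{finite,linorder}, 'e::real_vector) ctb \<Rightarrow> 'a \<Rightarrow> real \<Rightarrow> bool" where
  "singular_principal_curvature B q \<kappa> \<longleftrightarrow>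
     (\<exists>S X. singular_shape_operator B q S \<and> X \<in> singular_tangent_space B q \<and> X \<noteq> (\<lambda>_. 0) \<and>
        S X = (\<lambda>c. \<kappa> *\<^sub>R X c))"

end

theory Submission
  imports Defs
begin

text \<open>
  Let \<open>n\<close> be the unit normal of the image of \<open>\<phi>\<close> along the singular set, extended near a
  non-degenerate point by a normalized row of the adjugate of the matrix of \<open>\<phi>\<close>.  Applying the adjugate
  to \<open>n\<close> gives a vector field \<open>\<eta>\<close> with \<open>\<phi>(\<eta>) = \<lambda> n\<close>, so \<open>\<eta>\<close> is null on the
  singular set and has the orientation that corresponds to \<open>n\<close>.
  With \<open>b(X,Y) = \<langle>n, D\<^sub>X \<phi>(Y)\<rangle>\<close>, which is symmetric since \<open>\<phi>\<close> is torsion free,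
  the singular shape operator satisfies \<open>\<langle>\<phi>(S X), \<phi>(Y)\<rangle> = sgn(d\<lambda>(\<eta>)) b(X,Y)\<close>, and
  differentiating \<open>\<phi>(\<eta>) = \<lambda> n\<close> yields \<open>b(X,\<eta>) = d\<lambda>(X)\<close>.
  For a transversal direction \<open>v\<close> put \<open>a = d\<lambda>(\<eta>)/d\<lambda>(v)\<close>.  Then \<open>X = \<eta> - a v\<close> is tangent to
  the singular set and has the Rayleigh quotient
  \<open>(-\<bar>d\<lambda>(\<eta>)\<bar> \<plusminus> a\<^sup>2 b(v,v)) / (a\<^sup>2 \<langle>\<phi>(v), \<phi>(v)\<rangle>)\<close>, which tends to
  \<open>-\<infinity>\<close> at a point where \<open>d\<lambda>(\<eta>) = 0\<close>, that is, at a point that is not an \<open>A\<^sub>2\<close>-point.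
  The smallest singular principal curvature is at most this quotient.
\<close>

section \<open>Calculus of smooth maps\<close>

text \<open>Only the smallest eigenvalue is estimated, so one tangent test vector suffices and no
  eigenvector has to be followed along the curve. The direction \<open>v\<close> is a fixed
  coordinate direction \<open>axis k 1\<close> with d\<lambda>(v) nonzero near \<open>p\<close>. The
  estimate stays multiplied out: it asks that |d\<lambda>(\<eta>)| (|b(v,v)| - C
  <\<phi>(v),\<phi>(v)>) be less than d\<lambda>(v)^2. This is an open condition on the point, and
  for every \<open>C\<close> it holds at \<open>p\<close>, where d\<lambda>(\<eta>) = 0; no lower
  bound for <\<phi>(v),\<phi>(v)> enters. The obstacle is that all notions live on the singular set,
  exactly where \<phi> cannot be inverted. Non-degeneracy removes it: where d\<lambda> is nonzero, a
  smooth f with \<lambda> f = 0 vanishes on the singular set as well. All objects are therefore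
  built on open sets of the manifold, and determinant identities pass from invertible to singular
  points by cancelling \<lambda>. An eigenvector needs dimension at least two. In dimension one
  every non-degenerate point is an A2-point, so the assumption on \<open>p\<close> provides the
  second index.\<close>

lemma frechet_derivative_cong_open:
  assumes "open U" "x \<in> U" "\<And>y. y \<in> U \<Longrightarrow> f y = g y"
  shows "frechet_derivative f (at x) = frechet_derivative g (at x)"
proof -
  have "(f has_derivative D) (at x) \<longleftrightarrow> (g has_derivative D) (at x)" for D
    using assms by (metis has_derivative_transform_within_open)
  then show ?thesis
    by (simp add: frechet_derivative_def)
qed

lemma Ck_on_cong:
  assumes "open U" "\<forall>x\<in>U. f x = g x" "Ck_on k U f"
  shows "Ck_on k U g"
  using assms(2,3)
proof (induction k arbitrary: f g)
  case 0
  then show ?case by (simp cong: continuous_on_cong)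
next
  case (Suc k)
  have eq: "frechet_derivative f (at x) = frechet_derivative g (at x)" if "x \<in> U" for x
    using frechet_derivative_cong_open[OF assms(1) that] Suc.prems(1) by blast
  have "(g has_derivative frechet_derivative f (at x)) (at x)" if "x \<in> U" for x
  proof (rule has_derivative_transform_within_open[OF _ assms(1) that])
    show "(f has_derivative frechet_derivative f (at x)) (at x)"
      using Suc.prems(2) assms(1) that differentiable_on_eq_differentiable_at
        frechet_derivative_works by fastforce
  qed (use Suc.prems in auto)
  then have "g differentiable_on U"
    using differentiableI differentiable_at_imp_differentiable_on by blast
  moreover have "Ck_on k U (\<lambda>x. frechet_derivative g (at x) v)" for v
    by (rule Suc.IH[of "\<lambda>x. frechet_derivative f (at x) v"]) (use eq Suc.prems(2) in auto)
  ultimately show ?case by simp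
qed

text \<open>The recursion asks about \<open>frechet_derivative\<close>; on an open set any explicit
  formula for the derivative may stand in for it. The closure properties under linear, bilinear and
  composed maps run through this rule, since it gives the induction hypothesis a concrete
  expression.\<close>

lemma Ck_on_intro:
  assumes "open U" "\<And>x. x \<in> U \<Longrightarrow> (f has_derivative f' x) (at x)"
    and "\<And>v. Ck_on k U (\<lambda>x. f' x v)"
  shows "Ck_on (Suc k) U f"
proof -
  have "f differentiable_on U"
    using assms(2) differentiableI differentiable_at_imp_differentiable_on by blast
  moreover have "Ck_on k U (\<lambda>x. frechet_derivative f (at x) v)" for v
    by (rule Ck_on_cong[OF assms(1) _ assms(3)[of v]]) (use assms(2) frechet_derivative_at in metis)
  ultimately show ?thesis by simp
qed

lemma Ck_on_Suc_has_derivative: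
  assumes "open U" "Ck_on (Suc k) U f" "x \<in> U"
  shows "(f has_derivative frechet_derivative f (at x)) (at x)"
  using assms differentiable_on_eq_differentiable_at frechet_derivative_works by fastforce

lemma Ck_on_subset: "Ck_on k U f \<Longrightarrow> V \<subseteq> U \<Longrightarrow> Ck_on k V f"
proof (induction k arbitrary: f)
  case (Suc k)
  then show ?case using differentiable_on_subset by force
qed (auto intro: continuous_on_subset)

lemma Ck_on_SucD: "open U \<Longrightarrow> Ck_on (Suc k) U f \<Longrightarrow> Ck_on k U f"
proof (induction k arbitrary: f)
  case 0
  then show ?case by (simp add: differentiable_imp_continuous_on)
qed auto

lemma Ck_on_const: "Ck_on k U (\<lambda>_. a)"
proof (induction k arbitrary: a)
  case (Suc k)
  then show ?case by simp
qed simp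

lemma Ck_on_bounded_linear:
  assumes "bounded_linear L" "open U" "Ck_on k U f"
  shows "Ck_on k U (\<lambda>x. L (f x))"
  using assms(3)
proof (induction k arbitrary: f)
  case 0
  then show ?case using assms by (simp add: bounded_linear.continuous_on)
next
  case (Suc k)
  show ?case
  proof (rule Ck_on_intro[OF assms(2)])
    show "((\<lambda>x. L (f x)) has_derivative (\<lambda>v. L (frechet_derivative f (at x) v))) (at x)"
      if "x \<in> U" for x
      using Ck_on_Suc_has_derivative[OF assms(2) Suc.prems that]
        bounded_linear.has_derivative[OF assms(1)] by blast
    show "Ck_on k U (\<lambda>x. L (frechet_derivative f (at x) v))" for v
      using Suc by simp
  qed
qed

lemma Ck_on_add:
  assumes "open U" "Ck_on k U f" "Ck_on k U g"
  shows "Ck_on k U (\<lambda>x. f x + g x)"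
  using assms(2,3)
proof (induction k arbitrary: f g)
  case 0
  then show ?case by (simp add: continuous_on_add)
next
  case (Suc k)
  show ?case
  proof (rule Ck_on_intro[OF assms(1)])
    show "((\<lambda>x. f x + g x) has_derivative
        (\<lambda>v. frechet_derivative f (at x) v + frechet_derivative g (at x) v)) (at x)" if "x \<in> U" for x
      using Suc.prems Ck_on_Suc_has_derivative[OF assms(1)] that by (metis has_derivative_add)
    show "Ck_on k U (\<lambda>x. frechet_derivative f (at x) v + frechet_derivative g (at x) v)" for v
      using Suc by simp
  qed
qed

text \<open>In each term of the product rule one factor stays undifferentiated; it is lowered from
  C^(k+1) to C^k so that the induction hypothesis applies to both factors.\<close>

lemma Ck_on_bounded_bilinear:
  assumes "bounded_bilinear pr" "open U" "Ck_on k U f" "Ck_on k U g"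
  shows "Ck_on k U (\<lambda>x. pr (f x) (g x))"
  using assms(3,4)
proof (induction k arbitrary: f g)
  case 0
  then show ?case using assms by (simp add: bounded_bilinear.continuous_on)
next
  case (Suc k)
  show ?case
  proof (rule Ck_on_intro[OF assms(2)])
    show "((\<lambda>x. pr (f x) (g x)) has_derivative
        (\<lambda>v. pr (f x) (frechet_derivative g (at x) v) + pr (frechet_derivative f (at x) v) (g x))) (at x)"
      if "x \<in> U" for x
      by (rule bounded_bilinear.FDERIV[OF assms(1)]; rule Ck_on_Suc_has_derivative[OF assms(2) _ that])
        (rule Suc.prems)+
    show "Ck_on k U (\<lambda>x. pr (f x) (frechet_derivative g (at x) v)
        + pr (frechet_derivative f (at x) v) (g x))" for v
      using Suc.prems Ck_on_SucD[OF assms(2) Suc.prems(1)] Ck_on_SucD[OF assms(2) Suc.prems(2)]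
      by (intro Ck_on_add assms Suc.IH) simp_all
  qed
qed

lemma Ck_on_sum:
  assumes "open U" "\<And>i. i \<in> I \<Longrightarrow> Ck_on k U (f i)"
  shows "Ck_on k U (\<lambda>x. \<Sum>i\<in>I. f i x)"
  using assms(2)
  by (induction I rule: infinite_finite_induct) (auto simp: Ck_on_const intro!: Ck_on_add assms(1))

text \<open>The chain rule g'(f x)(f'(x) v) feeds a direction depending on x into g', whereas
  \<open>Ck_on\<close> speaks of fixed directions only. Expanding f'(x) v in \<open>Basis\<close>
  separates the two dependences, which is why the middle space is Euclidean.\<close>

lemma Ck_on_compose:
  fixes f :: "'a::real_normed_vector \<Rightarrow> 'b::euclidean_space"
  assumes "open U" "open V" "f ` U \<subseteq> V" "Ck_on k U f" "Ck_on k V g"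
  shows "Ck_on k U (\<lambda>x. g (f x))"
  using assms(4,5)
proof (induction k arbitrary: g)
  case 0
  then show ?case using continuous_on_compose2[of V g U f] assms by simp
next
  case (Suc k)
  let ?f' = "\<lambda>x. frechet_derivative f (at x)" and ?g' = "\<lambda>y. frechet_derivative g (at y)"
  show ?case
  proof (rule Ck_on_intro[OF assms(1)])
    fix x assume x: "x \<in> U"
    have 1: "(f has_derivative ?f' x) (at x)"
      using Ck_on_Suc_has_derivative[OF assms(1) Suc.prems(1) x] .
    have 2: "(g has_derivative ?g' (f x)) (at (f x))"
      using Ck_on_Suc_has_derivative[OF assms(2) Suc.prems(2)] x assms(3) by blast
    have lin: "linear (?g' (f x))"
      using 2 has_derivative_linear by blast
    have "?g' (f x) w = (\<Sum>b\<in>Basis. (w \<bullet> b) *\<^sub>R ?g' (f x) b)" for w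
      using linear_sum[OF lin, of "\<lambda>b. (w \<bullet> b) *\<^sub>R b" Basis] linear_cmul[OF lin]
      by (simp add: euclidean_representation)
    then have eq: "?g' (f x) \<circ> ?f' x = (\<lambda>v. \<Sum>b\<in>Basis. (?f' x v \<bullet> b) *\<^sub>R ?g' (f x) b)"
      unfolding o_def by (intro ext)
    show "((\<lambda>x. g (f x)) has_derivative (\<lambda>v. \<Sum>b\<in>Basis. (?f' x v \<bullet> b) *\<^sub>R ?g' (f x) b)) (at x)"
      using diff_chain_at[OF 1 2] unfolding eq by (simp add: o_def)
  next
    fix v
    show "Ck_on k U (\<lambda>x. \<Sum>b\<in>Basis. (?f' x v \<bullet> b) *\<^sub>R ?g' (f x) b)"
    proof (intro Ck_on_sum Ck_on_bounded_bilinear[OF bounded_bilinear_scaleR] assms(1))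
      fix b :: 'b
      show "Ck_on k U (\<lambda>x. ?f' x v \<bullet> b)"
        using Suc.prems by (intro Ck_on_bounded_linear[OF bounded_linear_inner_left assms(1)]) simp
      show "Ck_on k U (\<lambda>x. ?g' (f x) b)"
        using Suc.IH[of "\<lambda>y. ?g' y b"] Suc.prems(2) Ck_on_SucD[OF assms(1) Suc.prems(1)] by simp
    qed
  qed
qed

text \<open>The derivative is a product of copies of \<open>inverse\<close> and a constant, so the
  class at level k reproduces itself at level k+1.\<close>

lemma Ck_on_inverse: "Ck_on k (-{0}) (inverse :: real \<Rightarrow> real)"
proof (induction k)
  case 0
  show ?case by (simp add: continuous_on_inverse)
next
  case (Suc k)
  have o: "open (- {0::real})" by auto
  show ?case
  proof (rule Ck_on_intro[OF o])
    show "(inverse has_derivative (\<lambda>v. - (inverse x * v * inverse x))) (at x)" if "x \<in> - {0}" for x :: real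
      using has_derivative_inverse'[of x UNIV] that by simp
    show "Ck_on k (-{0}) (\<lambda>x::real. - (inverse x * v * inverse x))" for v
      using Suc by (intro Ck_on_bounded_linear[OF bounded_linear_minus[OF bounded_linear_ident]]
          Ck_on_bounded_bilinear[OF bounded_bilinear_mult] Ck_on_const o) auto
  qed
qed

text \<open>The derivative is \<open>inverse\<close> after \<open>sqrt\<close>, up to a constant
  factor, so the induction closes with the composition rule.\<close>

lemma Ck_on_sqrt: "Ck_on k {0<..} sqrt"
proof (induction k)
  case 0
  show ?case by (simp add: continuous_on_real_sqrt)
next
  case (Suc k)
  have o: "open {0::real<..}" by auto
  show ?case
  proof (rule Ck_on_intro[OF o])
    show "(sqrt has_derivative (\<lambda>v. inverse (sqrt x) * (v / 2))) (at x)" if "x \<in> {0<..}" for x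
      using DERIV_real_sqrt[of x] that
      by (auto simp: has_field_derivative_def elim!: has_derivative_eq_rhs)
    have "Ck_on k {0<..} (\<lambda>x. inverse (sqrt x))"
      by (rule Ck_on_compose[OF o _ _ Suc Ck_on_inverse]) auto
    then show "Ck_on k {0<..} (\<lambda>x. inverse (sqrt x) * (v / 2))" for v
      by (rule Ck_on_bounded_bilinear[OF bounded_bilinear_mult o _ Ck_on_const])
  qed
qed

section \<open>Smoothness of infinite order, obtained from each finite order\<close>

lemma smooth_on_cong: "open U \<Longrightarrow> (\<And>x. x \<in> U \<Longrightarrow> f x = g x) \<Longrightarrow> smooth_on U f \<Longrightarrow> smooth_on U g"
  unfolding smooth_on_def using Ck_on_cong[of U f g] by blast

lemma smooth_on_subset: "smooth_on U f \<Longrightarrow> V \<subseteq> U \<Longrightarrow> smooth_on V f"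
  unfolding smooth_on_def using Ck_on_subset[of _ U f V] by blast

lemma smooth_on_const: "smooth_on U (\<lambda>_. a)"
  unfolding smooth_on_def by (intro allI Ck_on_const)

lemma smooth_on_bounded_linear:
  "bounded_linear L \<Longrightarrow> open U \<Longrightarrow> smooth_on U f \<Longrightarrow> smooth_on U (\<lambda>x. L (f x))"
  unfolding smooth_on_def using Ck_on_bounded_linear[of L U _ f] by blast

lemma smooth_on_add:
  "open U \<Longrightarrow> smooth_on U f \<Longrightarrow> smooth_on U g \<Longrightarrow> smooth_on U (\<lambda>x. f x + g x)"
  unfolding smooth_on_def by (intro allI Ck_on_add) auto

lemma smooth_on_sum:
  "open U \<Longrightarrow> (\<And>i. i \<in> I \<Longrightarrow> smooth_on U (f i)) \<Longrightarrow> smooth_on U (\<lambda>x. \<Sum>i\<in>I. f i x)"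
  unfolding smooth_on_def by (intro allI Ck_on_sum) auto

lemma smooth_on_mult:
  fixes f g :: "'a::real_normed_vector \<Rightarrow> real"
  shows "open U \<Longrightarrow> smooth_on U f \<Longrightarrow> smooth_on U g \<Longrightarrow> smooth_on U (\<lambda>x. f x * g x)"
  unfolding smooth_on_def by (intro allI Ck_on_bounded_bilinear[OF bounded_bilinear_mult]) auto

lemma smooth_on_scaleR:
  "open U \<Longrightarrow> smooth_on U f \<Longrightarrow> smooth_on U g \<Longrightarrow> smooth_on U (\<lambda>x. f x *\<^sub>R g x)"
  unfolding smooth_on_def by (intro allI Ck_on_bounded_bilinear[OF bounded_bilinear_scaleR]) auto

lemma smooth_on_compose:
  fixes f :: "'a::real_normed_vector \<Rightarrow> 'b::euclidean_space"
  shows "open U \<Longrightarrow> open V \<Longrightarrow> f ` U \<subseteq> V \<Longrightarrow> smooth_on U f \<Longrightarrow> smooth_on V g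
    \<Longrightarrow> smooth_on U (\<lambda>x. g (f x))"
  unfolding smooth_on_def using Ck_on_compose[of U V f _ g] by blast

lemma smooth_on_inverse:
  fixes f :: "'a::real_normed_vector \<Rightarrow> real"
  shows "open U \<Longrightarrow> smooth_on U f \<Longrightarrow> (\<And>x. x \<in> U \<Longrightarrow> f x \<noteq> 0) \<Longrightarrow> smooth_on U (\<lambda>x. inverse (f x))"
  by (rule smooth_on_compose[of U "-{0}"]) (auto simp: smooth_on_def Ck_on_inverse)

lemma smooth_on_sqrt:
  fixes f :: "'a::real_normed_vector \<Rightarrow> real"
  shows "open U \<Longrightarrow> smooth_on U f \<Longrightarrow> (\<And>x. x \<in> U \<Longrightarrow> f x > 0) \<Longrightarrow> smooth_on U (\<lambda>x. sqrt (f x))"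
  by (rule smooth_on_compose[of U "{0<..}"]) (auto simp: smooth_on_def Ck_on_sqrt)

lemma smooth_on_has_derivative:
  "open U \<Longrightarrow> smooth_on U f \<Longrightarrow> x \<in> U \<Longrightarrow> (f has_derivative frechet_derivative f (at x)) (at x)"
  by (rule Ck_on_Suc_has_derivative[of U 0]) (simp_all add: smooth_on_def del: Ck_on.simps)

lemma smooth_on_differentiable: "open U \<Longrightarrow> smooth_on U f \<Longrightarrow> x \<in> U \<Longrightarrow> f differentiable (at x)"
  using smooth_on_has_derivative differentiableI by blast

lemma smooth_on_frechet_derivative:
  "smooth_on U f \<Longrightarrow> smooth_on U (\<lambda>x. frechet_derivative f (at x) v)"
  unfolding smooth_on_def using Ck_on.simps(2) by blast

lemma smooth_on_continuous: "smooth_on U f \<Longrightarrow> continuous_on U f"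
  unfolding smooth_on_def using Ck_on.simps(1) by blast

lemma smooth_on_ident: "open U \<Longrightarrow> smooth_on U (\<lambda>x. x)"
proof -
  assume "open U"
  then have "Ck_on k U (\<lambda>x. x)" for k
    by (cases k) (auto intro!: Ck_on_intro[where f' = "\<lambda>x v. v"] Ck_on_const has_derivative_ident)
  then show ?thesis by (simp add: smooth_on_def)
qed

text \<open>Two applications of the mean value theorem to the second difference
  \<open>f (x + s u + t v) - f (x + s u) - f (x + t v) + f x\<close>.\<close>

lemma second_derivative_mean_value:
  fixes f :: "'a::real_normed_vector \<Rightarrow> real"
  assumes "open U" "Ck_on 2 U f" "r > 0"
    and U: "\<And>a b. 0 \<le> a \<Longrightarrow> a \<le> r \<Longrightarrow> 0 \<le> b \<Longrightarrow> b \<le> r \<Longrightarrow> x + a *\<^sub>R u + b *\<^sub>R v \<in> U"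
  obtains a b where "0 < a" "a < r" "0 < b" "b < r"
    "f (x + r *\<^sub>R u + r *\<^sub>R v) - f (x + r *\<^sub>R u) - f (x + r *\<^sub>R v) + f x
       = r * r * frechet_derivative (\<lambda>y. frechet_derivative f (at y) u) (at (x + a *\<^sub>R u + b *\<^sub>R v)) v"
proof -
  let ?f' = "\<lambda>y. frechet_derivative f (at y)"
  have d1: "(f has_derivative ?f' y) (at y)" if "y \<in> U" for y
    using Ck_on_Suc_has_derivative[OF assms(1) _ that, of 1] assms(2) by (simp add: numeral_2_eq_2)
  have d2: "((\<lambda>y. ?f' y u) has_derivative frechet_derivative (\<lambda>y. ?f' y u) (at y)) (at y)" if "y \<in> U" for y
    using Ck_on_Suc_has_derivative[OF assms(1) _ that, of 0 "\<lambda>y. ?f' y u"] assms(2)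
    by (simp add: numeral_2_eq_2)
  define F where "F s = f (x + s *\<^sub>R u + r *\<^sub>R v) - f (x + s *\<^sub>R u)" for s
  have "\<exists>a. 0 < a \<and> a < r \<and> F r - F 0 = (r - 0) * (?f' (x + a *\<^sub>R u + r *\<^sub>R v) u - ?f' (x + a *\<^sub>R u) u)"
  proof (intro MVT2 assms(3))
    fix s assume s: "0 \<le> s" "s \<le> r"
    have "((\<lambda>s. f (x + s *\<^sub>R u + r *\<^sub>R v)) has_derivative (\<lambda>h. ?f' (x + s *\<^sub>R u + r *\<^sub>R v) (h *\<^sub>R u))) (at s)"
      using s assms(3) by (intro has_derivative_compose[OF _ d1]) (auto intro!: derivative_eq_intros U)
    moreover have "((\<lambda>s. f (x + s *\<^sub>R u)) has_derivative (\<lambda>h. ?f' (x + s *\<^sub>R u) (h *\<^sub>R u))) (at s)"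
      using s assms(3) U[of s 0] by (intro has_derivative_compose[OF _ d1]) (auto intro!: derivative_eq_intros)
    ultimately have *: "(F has_derivative
        (\<lambda>h. ?f' (x + s *\<^sub>R u + r *\<^sub>R v) (h *\<^sub>R u) - ?f' (x + s *\<^sub>R u) (h *\<^sub>R u))) (at s)"
      unfolding F_def by (rule has_derivative_diff)
    have "linear (?f' (x + s *\<^sub>R u + r *\<^sub>R v))" "linear (?f' (x + s *\<^sub>R u))"
      using d1 U[of s r] U[of s 0] s assms(3) has_derivative_linear by fastforce+
    then show "(F has_real_derivative ?f' (x + s *\<^sub>R u + r *\<^sub>R v) u - ?f' (x + s *\<^sub>R u) u) (at s)"
      unfolding has_field_derivative_def
      by (intro has_derivative_eq_rhs[OF *] ext) (simp add: linear_cmul algebra_simps)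
  qed
  then obtain a where a: "0 < a" "a < r"
    "F r - F 0 = r * (?f' (x + a *\<^sub>R u + r *\<^sub>R v) u - ?f' (x + a *\<^sub>R u) u)" by auto
  define G where "G t = ?f' (x + a *\<^sub>R u + t *\<^sub>R v) u" for t
  have "\<exists>b. 0 < b \<and> b < r \<and> G r - G 0 = (r - 0) *
      frechet_derivative (\<lambda>y. ?f' y u) (at (x + a *\<^sub>R u + b *\<^sub>R v)) v"
  proof (intro MVT2 assms(3))
    fix t assume t: "0 \<le> t" "t \<le> r"
    have *: "(G has_derivative
       (\<lambda>h. frechet_derivative (\<lambda>y. ?f' y u) (at (x + a *\<^sub>R u + t *\<^sub>R v)) (h *\<^sub>R v))) (at t)"
      unfolding G_def using t a by (intro has_derivative_compose[OF _ d2]) (auto intro!: derivative_eq_intros U)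
    have "linear (frechet_derivative (\<lambda>y. ?f' y u) (at (x + a *\<^sub>R u + t *\<^sub>R v)))"
      using d2[OF U[of a t]] t a has_derivative_linear by fastforce
    then show "(G has_real_derivative frechet_derivative (\<lambda>y. ?f' y u) (at (x + a *\<^sub>R u + t *\<^sub>R v)) v) (at t)"
      unfolding has_field_derivative_def
      by (intro has_derivative_eq_rhs[OF *] ext) (simp add: linear_cmul algebra_simps)
  qed
  then obtain b where "0 < b" "b < r" "G r - G 0 = r *
      frechet_derivative (\<lambda>y. ?f' y u) (at (x + a *\<^sub>R u + b *\<^sub>R v)) v" by auto
  with a that[of a b] show ?thesis by (auto simp: F_def G_def algebra_simps)
qed

text \<open>The second difference over the parallelogram spanned by r u and r v is symmetric in u
  and v. The mean value form equates the two mixed derivatives at two points near x, and continuity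
  carries near-equality back to x.\<close>

lemma second_derivative_symmetric_real:
  fixes f :: "'a::real_normed_vector \<Rightarrow> real"
  assumes "open U" "Ck_on 2 U f" "x \<in> U"
  shows "frechet_derivative (\<lambda>y. frechet_derivative f (at y) u) (at x) v
       = frechet_derivative (\<lambda>y. frechet_derivative f (at y) v) (at x) u" (is "?A u v x = ?A v u x")
proof (rule ccontr)
  assume ne: "?A u v x \<noteq> ?A v u x"
  define e where "e = \<bar>?A u v x - ?A v u x\<bar> / 2"
  have "e > 0" using ne by (simp add: e_def)
  have cont: "continuous_on U (?A w z)" for w z
    using assms(2) by (simp add: numeral_2_eq_2)
  have tend: "(?A w z \<longlongrightarrow> ?A w z x) (nhds x)" for w z
    using cont[of w z] assms(1,3) continuous_on_eq_continuous_at isCont_def tendsto_at_iff_tendsto_nhds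
    by blast
  have "\<forall>\<^sub>F y in nhds x. y \<in> U \<and> dist (?A u v y) (?A u v x) < e \<and> dist (?A v u y) (?A v u x) < e"
    using assms \<open>e > 0\<close> tendstoD[OF tend] by (intro eventually_conj eventually_nhds_in_open)
  then obtain d where "d > 0" and d: "\<And>y. dist y x < d \<Longrightarrow> y \<in> U \<and>
      dist (?A u v y) (?A u v x) < e \<and> dist (?A v u y) (?A v u x) < e"
    unfolding eventually_nhds_metric by blast
  \<comment> \<open>The summand 1 keeps \<open>N\<close> positive when u = v = 0. With r = d / (2 N)
    the whole parallelogram lies within distance d of x.\<close>
  define N where "N = norm u + norm v + 1"
  define r where "r = d / (2 * N)"
  have "N > 0" unfolding N_def by (smt (verit) norm_ge_zero)
  then have "r > 0" "r * N = d / 2" using \<open>d > 0\<close> by (auto simp: r_def)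
  then have rd: "r * (norm u + norm v) < d"
    using \<open>d > 0\<close> unfolding N_def by (simp add: algebra_simps)
  have near: "dist (x + a *\<^sub>R w + b *\<^sub>R z) x < d"
    if "0 \<le> a" "a \<le> r" "0 \<le> b" "b \<le> r" "w = u \<and> z = v \<or> w = v \<and> z = u" for a b w z
  proof -
    have "norm (a *\<^sub>R w + b *\<^sub>R z) \<le> norm (a *\<^sub>R w) + norm (b *\<^sub>R z)" by (rule norm_triangle_ineq)
    also have "\<dots> \<le> r * norm w + r * norm z"
      using that by (intro add_mono) (auto intro: mult_right_mono)
    also have "\<dots> < d" using rd that(5) by (auto simp: algebra_simps)
    finally show ?thesis by (simp add: dist_norm add.assoc)
  qed
  obtain a b where 1: "0 < a" "a < r" "0 < b" "b < r"
    "f (x + r *\<^sub>R u + r *\<^sub>R v) - f (x + r *\<^sub>R u) - f (x + r *\<^sub>R v) + f x = r * r * ?A u v (x + a *\<^sub>R u + b *\<^sub>R v)"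
    by (rule second_derivative_mean_value[OF assms(1,2) \<open>r > 0\<close>, of x u v]) ((use d[OF near[of _ _ u v]] d[OF near[of _ _ v u]] in blast)+)
  obtain a' b' where 2: "0 < a'" "a' < r" "0 < b'" "b' < r"
    "f (x + r *\<^sub>R v + r *\<^sub>R u) - f (x + r *\<^sub>R v) - f (x + r *\<^sub>R u) + f x = r * r * ?A v u (x + a' *\<^sub>R v + b' *\<^sub>R u)"
    by (rule second_derivative_mean_value[OF assms(1,2) \<open>r > 0\<close>, of x v u]) ((use d[OF near[of _ _ u v]] d[OF near[of _ _ v u]] in blast)+)
  have "r * r * ?A u v (x + a *\<^sub>R u + b *\<^sub>R v) = r * r * ?A v u (x + a' *\<^sub>R v + b' *\<^sub>R u)"
    using 1(5) 2(5) by (simp add: algebra_simps)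
  then have eq: "?A u v (x + a *\<^sub>R u + b *\<^sub>R v) = ?A v u (x + a' *\<^sub>R v + b' *\<^sub>R u)"
    using \<open>r > 0\<close> by simp
  have "dist (?A u v (x + a *\<^sub>R u + b *\<^sub>R v)) (?A u v x) < e"
    using near[of a b u v] d 1 by simp
  moreover have "dist (?A u v (x + a *\<^sub>R u + b *\<^sub>R v)) (?A v u x) < e"
    using near[of a' b' v u] d 2 unfolding eq by simp
  ultimately have "dist (?A u v x) (?A v u x) < e + e"
    using dist_triangle3[of "?A u v x" "?A v u x" "?A u v (x + a *\<^sub>R u + b *\<^sub>R v)"] by linarith
  then show False unfolding e_def dist_real_def field_sum_of_halves by blast
qed

text \<open>Reduction to real values by pairing with basis vectors. Applied to transition maps, it
  makes coordinate vector fields commute.\<close>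

lemma second_derivative_symmetric:
  fixes f :: "'a::real_normed_vector \<Rightarrow> 'b::euclidean_space"
  assumes "open U" "smooth_on U f" "x \<in> U"
  shows "frechet_derivative (\<lambda>y. frechet_derivative f (at y) u) (at x) v
       = frechet_derivative (\<lambda>y. frechet_derivative f (at y) v) (at x) u"
proof (rule euclidean_eqI)
  fix b :: 'b
  let ?g = "\<lambda>y. f y \<bullet> b"
  have g: "smooth_on U ?g"
    by (rule smooth_on_bounded_linear[OF bounded_linear_inner_left assms(1,2)])
  have 1: "frechet_derivative ?g (at y) w = frechet_derivative f (at y) w \<bullet> b" if "y \<in> U" for y w
    using fun_cong[OF frechet_derivative_at[OF bounded_linear.has_derivative[OF
        bounded_linear_inner_left[of b] smooth_on_has_derivative[OF assms(1,2) that]]], of w] by simp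
  have 2: "frechet_derivative (\<lambda>y. frechet_derivative ?g (at y) w) (at x) z
        = frechet_derivative (\<lambda>y. frechet_derivative f (at y) w) (at x) z \<bullet> b" for w z
  proof -
    have "frechet_derivative (\<lambda>y. frechet_derivative ?g (at y) w) (at x)
      = frechet_derivative (\<lambda>y. frechet_derivative f (at y) w \<bullet> b) (at x)"
      by (rule frechet_derivative_cong_open[OF assms(1,3) 1])
    then show ?thesis
      using fun_cong[OF frechet_derivative_at[OF bounded_linear.has_derivative[OF
        bounded_linear_inner_left[of b] smooth_on_has_derivative[OF assms(1)
          smooth_on_frechet_derivative[OF assms(2), of w] assms(3)]]], of z] by simp
  qed
  have "Ck_on 2 U ?g" using g unfolding smooth_on_def by blast
  from second_derivative_symmetric_real[OF assms(1) this assms(3), of u v] 2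
  show "frechet_derivative (\<lambda>y. frechet_derivative f (at y) u) (at x) v \<bullet> b
     = frechet_derivative (\<lambda>y. frechet_derivative f (at y) v) (at x) u \<bullet> b" by simp
qed

lemma smooth_on_diff:
  fixes f g :: "'a::real_normed_vector \<Rightarrow> 'b::real_normed_vector"
  assumes "open U" "smooth_on U f" "smooth_on U g"
  shows "smooth_on U (\<lambda>x. f x - g x)"
  using smooth_on_add[OF assms(1,2) smooth_on_bounded_linear[OF bounded_linear_minus[OF bounded_linear_ident] assms(1,3)]]
  by simp

section \<open>Curves in regular level sets, by the inverse function theorem\<close>

text \<open>Replacing the k-th coordinate by f is a local diffeomorphism that turns the zero set of
  f into a coordinate hyperplane. The curve is the preimage of a segment in that hyperplane, run
  through by a bounded parameter so that it exists for all s.\<close>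

lemma smooth_level_curve:
  fixes f :: "real^'m::finite \<Rightarrow> real" and z y :: "real^'m"
  assumes U: "open U" "smooth_on U f" "z \<in> U" and "f z = 0"
    and k: "frechet_derivative f (at z) (axis k 1) \<noteq> 0" and y: "frechet_derivative f (at z) y = 0"
  obtains \<beta> :: "real \<Rightarrow> real^'m" where "smooth_on UNIV \<beta>" "\<And>s. \<beta> s \<in> U" "\<And>s. f (\<beta> s) = 0"
    "\<beta> 0 = z" "(\<beta> has_vector_derivative y) (at 0)"
proof -
  let ?D = "\<lambda>x. frechet_derivative f (at x)" and ?e = "axis k 1 :: real^'m"
  define U0 where "U0 = {x\<in>U. ?D x ?e \<noteq> 0}"
  have sD: "smooth_on U (\<lambda>x. ?D x v)" for v
    by (rule smooth_on_frechet_derivative[OF U(2)])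
  have U0: "open U0" "z \<in> U0" "U0 \<subseteq> U"
    using continuous_open_preimage[OF smooth_on_continuous[OF sD] U(1), of "-{0}" ?e] k U(3)
    by (auto simp: U0_def vimage_def Int_def)
  have der: "(f has_derivative ?D x) (at x)" if "x \<in> U" for x
    using smooth_on_has_derivative[OF U(1,2) that] .
  have lin: "linear (?D x)" if "x \<in> U" for x
    using der[OF that] has_derivative_linear by blast
  \<comment> \<open>The k-th component of \<open>\<Psi> x\<close> is \<open>f x\<close> and the
    others are those of x. \<open>P x\<close> is its derivative, and \<open>H _ x\<close> inverts
    \<open>P x\<close> wherever the k-th partial derivative is nonzero.\<close>
  define \<Psi> where "\<Psi> x = x + (f x - x $ k) *\<^sub>R ?e" for x
  define P where "P x v = v + (?D x v - v $ k) *\<^sub>R ?e" for x v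
  define H where "H w x = w + ((w $ k - ?D x w) * inverse (?D x ?e)) *\<^sub>R ?e" for w x
  have der\<Psi>: "(\<Psi> has_derivative P x) (at x)" if "x \<in> U" for x
    unfolding \<Psi>_def P_def
    by (intro has_derivative_add has_derivative_ident has_derivative_scaleR_left has_derivative_diff
        der that bounded_linear.has_derivative[OF bounded_linear_vec_nth] has_derivative_ident)
  have bl: "bounded_linear (P x)" if "x \<in> U" for x
    using der\<Psi>[OF that] has_derivative_bounded_linear by blast
  have HP: "H (P x v) x = v" and PH: "P x (H v x) = v" if "x \<in> U0" for x v
  proof -
    have x: "x \<in> U" "?D x ?e \<noteq> 0" using that by (auto simp: U0_def)
    show "H (P x v) x = v" "P x (H v x) = v"
      using x by (simp_all add: H_def P_def linear_add[OF lin] linear_cmul[OF lin] linear_diff[OF lin]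
          vec_eq_iff axis_def field_simps)
  qed
  define f' where "f' x = Blinfun (P x)" for x
  have f': "blinfun_apply (f' x) = P x" if "x \<in> U" for x
    unfolding f'_def by (rule bounded_linear_Blinfun_apply[OF bl[OF that]])
  have linH: "linear (\<lambda>w. H w z)"
    by (rule linearI) (simp_all add: H_def linear_add[OF lin[OF U(3)]] linear_cmul[OF lin[OF U(3)]]
        vec_eq_iff algebra_simps add_divide_distrib)
  define invf where "invf = Blinfun (\<lambda>w. H w z)"
  have invf: "blinfun_apply invf = (\<lambda>w. H w z)"
    unfolding invf_def using linH linear_conv_bounded_linear by (blast intro: bounded_linear_Blinfun_apply)
  have inv: "invf o\<^sub>L f' z = id_blinfun"
    by (rule blinfun_eqI) (simp add: invf f'[OF U(3)] HP[OF U0(2)])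
  have cont: "continuous_on U0 f'"
  proof (rule continuous_on_blinfun_componentwise)
    fix i :: "real^'m"
    have "continuous_on U0 (\<lambda>x. P x i)"
      unfolding P_def by (intro continuous_intros continuous_on_subset[OF smooth_on_continuous[OF sD] U0(3)])
    then show "continuous_on U0 (\<lambda>x. blinfun_apply (f' x) i)"
      using f' U0(3) by (subst continuous_on_cong[OF refl, of _ _ "\<lambda>x. P x i"]) auto
  qed
  have "(\<Psi> has_derivative blinfun_apply (f' x)) (at x)" if "x \<in> U0" for x
    using der\<Psi>[of x] f'[of x] that U0(3) by auto
  then obtain U' V g g' where g: "open U'" "U' \<subseteq> U0" "z \<in> U'" "open V" "\<Psi> z \<in> V" "homeomorphism U' V \<Psi> g"
    "\<And>y. y \<in> V \<Longrightarrow> (g has_derivative (g' y)) (at y)"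
    "\<And>y. y \<in> V \<Longrightarrow> g' y = inv (blinfun_apply (f'(g y)))"
    "\<And>y. y \<in> V \<Longrightarrow> bij (blinfun_apply (f'(g y)))"
    using inverse_function_theorem[OF U0(1) _ cont U0(2) inv, of \<Psi>] by blast
  have gU: "g y \<in> U'" if "y \<in> V" for y
    using g(6) that unfolding homeomorphism_def by blast
  have gV: "\<Psi> (g y) = y" if "y \<in> V" for y
    using g(6) that unfolding homeomorphism_def by blast
  have gz: "g (\<Psi> z) = z"
    using g(3,6) unfolding homeomorphism_def by blast
  have g': "(g has_derivative (\<lambda>w. H w (g y))) (at y)" if y: "y \<in> V" for y
  proof -
    have gy: "g y \<in> U0" "g y \<in> U" using gU[OF y] g(2) U0(3) by auto
    have "inv (P (g y)) w = H w (g y)" for w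
      using g(9)[OF y] PH[OF gy(1), of w] unfolding f'[OF gy(2)]
      by (metis bij_inv_eq_iff)
    then have "g' y = (\<lambda>w. H w (g y))"
      using g(8)[OF y] f'[OF gy(2)] by auto
    then show ?thesis using g(7)[OF y] by simp
  qed
  have sH: "smooth_on U0 (H w)" for w
    unfolding H_def
    by (intro smooth_on_add smooth_on_scaleR smooth_on_const smooth_on_mult smooth_on_diff
        smooth_on_inverse smooth_on_subset[OF sD U0(3)] U0(1)) (auto simp: U0_def)
  \<comment> \<open>Bootstrapping: the derivative of g in direction w is \<open>H w\<close> after g,
    so regularity of g at level n gives regularity at level n+1.\<close>
  have Ckg: "Ck_on n V g" for n
  proof (induction n)
    case 0
    show ?case using g(6) by (simp add: homeomorphism_def)
  next
    case (Suc n)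
    show ?case
    proof (rule Ck_on_intro[OF g(4) g'])
      show "Ck_on n V (\<lambda>y. H w (g y))" for w
        using sH[of w] gU g(2) by (intro Ck_on_compose[OF g(4) U0(1) _ Suc]) (auto simp: smooth_on_def)
    qed
  qed
  \<comment> \<open>The image of y under the derivative of \<open>\<Psi>\<close>. Its k-th component
    is the derivative of f along y, that is 0, so moving along w keeps f at 0.\<close>
  define w where "w = P z y"
  have w: "w $ k = 0" "H w z = y"
    unfolding w_def by (simp add: P_def y) (rule HP[OF U0(2)])
  obtain r where r: "r > 0" "ball (\<Psi> z) r \<subseteq> V"
    using g(4,5) openE by blast
  define L where "L = (norm w + 1) / r"
  have L: "L > 0" using r by (simp add: L_def add_nonneg_pos)
  \<comment> \<open>A smooth reparametrization of the whole line with derivative 1 at 0 and |\<rho>|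
    at most 1 / (2 L). The choice of \<open>L\<close> keeps \<rho> w inside the ball of radius
    r.\<close>
  define \<rho> where "\<rho> s = s * inverse (1 + L * s * (L * s))" for s :: real
  have pos: "1 + L * s * (L * s) > 0" for s
    by (simp add: add_pos_nonneg)
  have \<rho>: "\<bar>\<rho> s\<bar> * norm w < r" for s
  proof -
    have "2 * (L * \<bar>s\<bar>) \<le> 1 + L * s * (L * s)"
      using zero_le_power2[of "L * \<bar>s\<bar> - 1"] by (simp add: power2_eq_square algebra_simps abs_mult_self_eq)
    then have "\<bar>\<rho> s\<bar> * (2 * L) \<le> 1"
      using pos[of s] L by (simp add: \<rho>_def abs_mult divide_simps split: if_splits) (simp add: algebra_simps)
    moreover have "\<bar>\<rho> s\<bar> * (2 * L) = 2 * (\<bar>\<rho> s\<bar> * (norm w + 1)) / r"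
      by (simp add: L_def)
    ultimately have "2 * (\<bar>\<rho> s\<bar> * (norm w + 1)) \<le> r"
      using r(1) by (simp add: divide_simps)
    moreover have "\<bar>\<rho> s\<bar> * norm w \<le> \<bar>\<rho> s\<bar> * (norm w + 1)"
      by (rule mult_left_mono) auto
    ultimately show ?thesis using r(1) by linarith
  qed
  define \<beta> where "\<beta> s = g (\<Psi> z + \<rho> s *\<^sub>R w)" for s
  have inV: "\<Psi> z + \<rho> s *\<^sub>R w \<in> V" for s
    using r(2) \<rho>[of s] by (auto simp: dist_norm)
  have s\<rho>: "smooth_on UNIV \<rho>"
  proof -
    have L: "smooth_on UNIV (\<lambda>s. L * s)"
      by (rule smooth_on_mult[OF open_UNIV smooth_on_const smooth_on_ident[OF open_UNIV]])
    have "smooth_on UNIV (\<lambda>s. 1 + L * s * (L * s))"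
      by (rule smooth_on_add[OF open_UNIV smooth_on_const smooth_on_mult[OF open_UNIV L L]])
    then have "smooth_on UNIV (\<lambda>s. inverse (1 + L * s * (L * s)))"
      by (rule smooth_on_inverse[OF open_UNIV]) (rule less_imp_neq[OF pos, symmetric])
    then show ?thesis
      unfolding \<rho>_def by (rule smooth_on_mult[OF open_UNIV smooth_on_ident[OF open_UNIV]])
  qed
  show thesis
  proof
    show "smooth_on UNIV \<beta>"
      unfolding \<beta>_def
    proof (rule smooth_on_compose[OF open_UNIV g(4), of "\<lambda>s. \<Psi> z + \<rho> s *\<^sub>R w" g])
      show "smooth_on UNIV (\<lambda>s. \<Psi> z + \<rho> s *\<^sub>R w)"
        by (rule smooth_on_add[OF open_UNIV smooth_on_const smooth_on_scaleR[OF open_UNIV s\<rho> smooth_on_const]])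
    qed (use inV Ckg in \<open>auto simp: smooth_on_def\<close>)
    show "\<beta> s \<in> U" for s
      using gU[OF inV[of s]] g(2) U0(3) by (auto simp: \<beta>_def)
    show "\<beta> 0 = z" by (simp add: \<beta>_def \<rho>_def gz)
    have \<Psi>k: "\<Psi> x $ k = f x" for x by (simp add: \<Psi>_def)
    show "f (\<beta> s) = 0" for s
      using gV[OF inV[of s]] \<Psi>k[of "\<beta> s"] \<Psi>k[of z] w(1) \<open>f z = 0\<close> by (simp add: \<beta>_def)
    have "(\<rho> has_field_derivative 1) (at 0)"
      unfolding \<rho>_def by (rule derivative_eq_intros refl | simp)+
    then have "((\<lambda>s. \<Psi> z + \<rho> s *\<^sub>R w) has_vector_derivative w) (at 0)"
      by (auto intro!: derivative_eq_intros)
    moreover have "(g has_derivative (\<lambda>v. H v z)) (at (\<Psi> z + \<rho> 0 *\<^sub>R w))"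
      using g'[OF g(5)] by (simp add: gz \<rho>_def)
    ultimately have "(\<beta> has_vector_derivative H w z) (at 0)"
      unfolding \<beta>_def using vector_derivative_diff_chain_within[of "\<lambda>s. \<Psi> z + \<rho> s *\<^sub>R w" w 0 UNIV g]
      by (auto simp: o_def intro: has_derivative_at_withinI)
    then show "(\<beta> has_vector_derivative y) (at 0)" by (simp add: w)
  qed
qed

section \<open>Charts, smooth functions and tangent vectors\<close>

text \<open>The inverse of reading off coordinates in the chart \<open>c\<close>. It moves the
  linear algebra of tangent spaces, whose elements are functions on charts without a vector space
  type, to \<open>real ^ 'm\<close>.\<close>

definition tvec_of :: "('a, 'm::finite) chart set \<Rightarrow> ('a, 'm) chart \<Rightarrow> 'a \<Rightarrow> real ^ 'm \<Rightarrow> ('a, 'm) tvec" where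
  "tvec_of A c x y = (\<lambda>c'. if c' \<in> A \<and> x \<in> fst c'
     then frechet_derivative (snd c' \<circ> chart_inv c) (at (snd c x)) y else 0)"

definition chart_deriv :: "('a, 'm::finite) chart \<Rightarrow> ('a \<Rightarrow> real) \<Rightarrow> 'a \<Rightarrow> real ^ 'm \<Rightarrow> real" where
  "chart_deriv c f x = frechet_derivative (f \<circ> chart_inv c) (at (snd c x))"

lemma dfun_chart_deriv: "dfun c f x v = chart_deriv c f x (v c)"
  by (simp add: dfun_def chart_deriv_def)

lemma coord_vec_tvec_of: "coord_vec A c i x = tvec_of A c x (axis i 1)"
  by (simp add: coord_vec_def tvec_of_def)

lemma linear_axis_expansion:
  fixes y :: "real ^ 'm::finite"
  assumes "linear f"
  shows "f y = (\<Sum>i\<in>UNIV. y $ i *\<^sub>R f (axis i 1))"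
proof -
  have "f (\<Sum>i\<in>UNIV. y $ i *s axis i 1) = (\<Sum>i\<in>UNIV. y $ i *\<^sub>R f (axis i 1))"
    by (simp only: scalar_mult_eq_scaleR linear_sum[OF assms] linear_cmul[OF assms])
  then show ?thesis by (simp only: basis_expansion)
qed

locale oriented_manifold =
  fixes A :: "('a::t2_space, 'm::finite) chart set"
  assumes atlas: "oriented_atlas A"
begin

lemma chart_exists: obtains c where "c \<in> A" "x \<in> fst c"
  using atlas unfolding oriented_atlas_def by blast

lemma open_dom: "c \<in> A \<Longrightarrow> open (fst c)"
  using atlas unfolding oriented_atlas_def by blast

lemma chart_homeo: "c \<in> A \<Longrightarrow> homeomorphism (fst c) (snd c ` fst c) (snd c) (chart_inv c)"
  using atlas unfolding oriented_atlas_def by blast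

lemma chart_inv_chart: "c \<in> A \<Longrightarrow> x \<in> fst c \<Longrightarrow> chart_inv c (snd c x) = x"
  using chart_homeo unfolding homeomorphism_def by blast

lemma open_chart_image:
  assumes "c \<in> A" "open V"
  shows "open (snd c ` (V \<inter> fst c))"
proof -
  have "open (snd c ` fst c)" using atlas assms unfolding oriented_atlas_def by blast
  moreover have "openin (top_of_set (snd c ` fst c)) (snd c ` (V \<inter> fst c))"
    using homeomorphism_imp_open_map[OF chart_homeo[OF assms(1)]] assms(2)
    by (metis Int_commute openin_open_Int)
  ultimately show ?thesis using openin_open_trans by blast
qed

lemma open_chart_image_subset: "c \<in> A \<Longrightarrow> open V \<Longrightarrow> V \<subseteq> fst c \<Longrightarrow> open (snd c ` V)"
  using open_chart_image[of c V] by (simp add: Int_absorb2)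

lemma transition_smooth:
  "c \<in> A \<Longrightarrow> c' \<in> A \<Longrightarrow> smooth_on (snd c ` (fst c \<inter> fst c')) (snd c' \<circ> chart_inv c)"
  using atlas unfolding oriented_atlas_def by blast

lemma transition_has_derivative:
  assumes "c \<in> A" "c' \<in> A" "x \<in> fst c" "x \<in> fst c'"
  shows "((snd c' \<circ> chart_inv c) has_derivative
    frechet_derivative (snd c' \<circ> chart_inv c) (at (snd c x))) (at (snd c x))"
proof (rule smooth_on_has_derivative[OF _ transition_smooth])
  show "open (snd c ` (fst c \<inter> fst c'))"
    using open_chart_image[OF assms(1) open_dom[OF assms(2)]] by (simp add: Int_commute)
qed (use assms in auto)

lemma linear_transition:
  assumes "c \<in> A" "c' \<in> A" "x \<in> fst c" "x \<in> fst c'"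
  shows "linear (frechet_derivative (snd c' \<circ> chart_inv c) (at (snd c x)))"
  using transition_has_derivative[OF assms] by (rule has_derivative_linear)

text \<open>Chain rule for coordinate changes; it is what makes \<open>tvec_of\<close> satisfy the
  compatibility condition in \<open>tangent_space\<close>.\<close>

lemma transition_cocycle:
  assumes c: "c \<in> A" "c' \<in> A" "c'' \<in> A" and x: "x \<in> fst c" "x \<in> fst c'" "x \<in> fst c''"
  shows "frechet_derivative (snd c'' \<circ> chart_inv c) (at (snd c x)) v =
    frechet_derivative (snd c'' \<circ> chart_inv c') (at (snd c' x))
      (frechet_derivative (snd c' \<circ> chart_inv c) (at (snd c x)) v)"
proof -
  let ?T = "snd c' \<circ> chart_inv c" and ?T' = "snd c'' \<circ> chart_inv c'"
  let ?W = "snd c ` (fst c' \<inter> fst c)"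
  have "(?T' has_derivative frechet_derivative ?T' (at (snd c' x))) (at (?T (snd c x)))"
    using transition_has_derivative[OF c(2,3) x(2,3)] c x by (simp add: chart_inv_chart)
  from diff_chain_at[OF transition_has_derivative[OF c(1,2) x(1,2)] this]
  have "((snd c'' \<circ> chart_inv c) has_derivative
      (frechet_derivative ?T' (at (snd c' x)) \<circ> frechet_derivative ?T (at (snd c x)))) (at (snd c x))"
    by (rule has_derivative_transform_within_open[of _ _ _ _ ?W])
      (use c x open_chart_image[OF c(1) open_dom[OF c(2)]] in \<open>auto simp: chart_inv_chart\<close>)
  then show ?thesis
    using frechet_derivative_at by (metis comp_apply)
qed

lemma transition_refl:
  assumes "c \<in> A" "x \<in> fst c"
  shows "frechet_derivative (snd c \<circ> chart_inv c) (at (snd c x)) v = v"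
proof -
  have "((snd c \<circ> chart_inv c) has_derivative (\<lambda>v. v)) (at (snd c x))"
    by (rule has_derivative_transform_within_open[OF has_derivative_ident, of "snd c ` fst c"])
      (use assms open_chart_image_subset[OF assms(1) open_dom] in \<open>auto simp: chart_inv_chart\<close>)
  then show ?thesis using frechet_derivative_at by metis
qed

lemma tvec_of_chart: "c \<in> A \<Longrightarrow> x \<in> fst c \<Longrightarrow> tvec_of A c x y c = y"
  by (simp add: tvec_of_def transition_refl)

lemma tvec_of_tangent: "c \<in> A \<Longrightarrow> x \<in> fst c \<Longrightarrow> tvec_of A c x y \<in> tangent_space A x"
proof -
  assume c: "c \<in> A" "x \<in> fst c"
  have *: "tvec_of A c x y c'' = frechet_derivative (snd c'' \<circ> chart_inv c') (at (snd c' x)) (tvec_of A c x y c')"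
    if "c' \<in> A" "c'' \<in> A" "x \<in> fst c' \<inter> fst c''" for c' c''
    using that transition_cocycle[OF c(1) that(1,2) c(2)] by (simp add: tvec_of_def)
  show ?thesis
    unfolding tangent_space_def by (intro CollectI conjI allI ballI impI) (rule *, assumption+, auto simp: tvec_of_def)
qed

lemma tvec_of_eq:
  assumes "c \<in> A" "x \<in> fst c" "v \<in> tangent_space A x"
  shows "tvec_of A c x (v c) = v"
proof
  fix c'
  have "c' \<in> A \<Longrightarrow> x \<in> fst c' \<Longrightarrow> v c' = frechet_derivative (snd c' \<circ> chart_inv c) (at (snd c x)) (v c)"
    and "\<not> (c' \<in> A \<and> x \<in> fst c') \<Longrightarrow> v c' = 0"
    using assms unfolding tangent_space_def by blast+
  then show "tvec_of A c x (v c) c' = v c'"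
    unfolding tvec_of_def by metis
qed

lemma tvec_of_linear:
  assumes "c \<in> A" "x \<in> fst c"
  shows "tvec_of A c x (a *\<^sub>R y + b *\<^sub>R z) = (\<lambda>c'. a *\<^sub>R tvec_of A c x y c' + b *\<^sub>R tvec_of A c x z c')"
  using linear_transition[OF assms(1) _ assms(2)]
  by (auto simp: tvec_of_def fun_eq_iff linear_add linear_cmul)

section \<open>Smooth functions on the manifold\<close>

lemma smooth_fun_chartD:
  assumes "smooth_fun A V f" "c \<in> A" "V \<subseteq> fst c"
  shows "smooth_on (snd c ` V) (f \<circ> chart_inv c)"
  using assms unfolding smooth_fun_def by (metis inf.absorb1)

lemma smooth_fun_subset: "smooth_fun A V f \<Longrightarrow> W \<subseteq> V \<Longrightarrow> smooth_fun A W f"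
  unfolding smooth_fun_def by (metis Int_mono image_mono order_refl smooth_on_subset)

lemma smooth_fun_cong:
  assumes "open V" "\<And>x. x \<in> V \<Longrightarrow> f x = g x" "smooth_fun A V f"
  shows "smooth_fun A V g"
  unfolding smooth_fun_def
proof
  fix c assume c: "c \<in> A"
  show "smooth_on (snd c ` (V \<inter> fst c)) (g \<circ> chart_inv c)"
    by (rule smooth_on_cong[OF open_chart_image[OF c assms(1)], of "f \<circ> chart_inv c"])
      (use assms c in \<open>auto simp: smooth_fun_def chart_inv_chart\<close>)
qed

lemma smooth_fun_const: "smooth_fun A V (\<lambda>_. a)"
  by (simp add: smooth_fun_def o_def smooth_on_const)

lemma smooth_fun_add:
  assumes "open V" "smooth_fun A V f" "smooth_fun A V g"
  shows "smooth_fun A V (\<lambda>x. f x + g x)"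
  using assms unfolding smooth_fun_def o_def by (intro ballI smooth_on_add open_chart_image) auto

lemma smooth_fun_mult:
  assumes "open V" "smooth_fun A V f" "smooth_fun A V g"
  shows "smooth_fun A V (\<lambda>x. f x * g x)"
  using assms unfolding smooth_fun_def o_def by (intro ballI smooth_on_mult open_chart_image) auto

lemma smooth_fun_minus:
  assumes "open V" "smooth_fun A V f"
  shows "smooth_fun A V (\<lambda>x. - f x)"
  using smooth_fun_mult[OF assms(1) smooth_fun_const[of V "-1"] assms(2)] by simp

lemma smooth_fun_diff:
  assumes "open V" "smooth_fun A V f" "smooth_fun A V g"
  shows "smooth_fun A V (\<lambda>x. f x - g x)"
  using smooth_fun_add[OF assms(1,2) smooth_fun_minus[OF assms(1,3)]] by simp

lemma smooth_fun_sum: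
  assumes "open V" "\<And>i. i \<in> I \<Longrightarrow> smooth_fun A V (f i)"
  shows "smooth_fun A V (\<lambda>x. \<Sum>i\<in>I. f i x)"
  using assms(2)
  by (induction I rule: infinite_finite_induct) (auto simp: smooth_fun_const intro!: smooth_fun_add assms(1))

lemma smooth_fun_prod:
  assumes "open V" "\<And>i. i \<in> I \<Longrightarrow> smooth_fun A V (f i)"
  shows "smooth_fun A V (\<lambda>x. \<Prod>i\<in>I. f i x)"
  using assms(2)
  by (induction I rule: infinite_finite_induct) (auto simp: smooth_fun_const intro!: smooth_fun_mult assms(1))

lemma smooth_fun_inverse:
  assumes "open V" "smooth_fun A V f" "\<And>x. x \<in> V \<Longrightarrow> f x \<noteq> 0"
  shows "smooth_fun A V (\<lambda>x. inverse (f x))"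
  unfolding smooth_fun_def o_def
proof
  fix c assume "c \<in> A"
  then show "smooth_on (snd c ` (V \<inter> fst c)) (\<lambda>x. inverse (f (chart_inv c x)))"
    using assms by (intro smooth_on_inverse open_chart_image) (auto simp: smooth_fun_def o_def chart_inv_chart)
qed

lemma smooth_fun_sqrt:
  assumes "open V" "smooth_fun A V f" "\<And>x. x \<in> V \<Longrightarrow> f x > 0"
  shows "smooth_fun A V (\<lambda>x. sqrt (f x))"
  unfolding smooth_fun_def o_def
proof
  fix c assume "c \<in> A"
  then show "smooth_on (snd c ` (V \<inter> fst c)) (\<lambda>x. sqrt (f (chart_inv c x)))"
    using assms by (intro smooth_on_sqrt open_chart_image) (auto simp: smooth_fun_def o_def chart_inv_chart)
qed

lemma smooth_fun_det:
  fixes M :: "'a \<Rightarrow> real^'n::finite^'n"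
  assumes "open V" "\<And>i j. smooth_fun A V (\<lambda>x. M x $ i $ j)"
  shows "smooth_fun A V (\<lambda>x. det (M x))"
  unfolding det_def using assms(1)
  by (intro smooth_fun_sum smooth_fun_mult smooth_fun_const smooth_fun_prod assms(2))

lemma smooth_on_compose_transition:
  assumes c: "c \<in> A" "c' \<in> A" and V: "open V" "V \<subseteq> fst c"
    and "smooth_on (snd c ` V) g"
  shows "smooth_on (snd c' ` (V \<inter> fst c')) (\<lambda>y. g (snd c (chart_inv c' y)))"
proof -
  have "smooth_on (snd c' ` (V \<inter> fst c')) (snd c \<circ> chart_inv c')"
    by (rule smooth_on_subset[OF transition_smooth[OF c(2,1)]]) (use V in auto)
  then have "smooth_on (snd c' ` (V \<inter> fst c')) (\<lambda>y. g ((snd c \<circ> chart_inv c') y))"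
    by (rule smooth_on_compose[of "snd c' ` (V \<inter> fst c')" "snd c ` V" "snd c \<circ> chart_inv c'" g, rotated 3])
      (use assms open_chart_image[OF c(2) V(1)] open_chart_image_subset[OF c(1) V] in \<open>auto simp: chart_inv_chart\<close>)
  then show ?thesis by simp
qed

text \<open>On an open set inside one chart domain, smoothness in that chart suffices: the
  expressions in all other charts differ by smooth transition maps.\<close>

lemma smooth_funI:
  assumes c: "c \<in> A" and V: "open V" "V \<subseteq> fst c"
    and "smooth_on (snd c ` V) g" and fg: "\<And>x. x \<in> V \<Longrightarrow> f x = g (snd c x)"
  shows "smooth_fun A V f"
  unfolding smooth_fun_def
proof
  fix c' assume c': "c' \<in> A"
  show "smooth_on (snd c' ` (V \<inter> fst c')) (f \<circ> chart_inv c')"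
    by (rule smooth_on_cong[OF _ _ smooth_on_compose_transition[OF c c' V assms(4)]])
      (use open_chart_image[OF c' V(1)] c' in \<open>auto simp: chart_inv_chart fg\<close>)
qed

lemma smooth_fun_continuous_on:
  assumes "open V" "smooth_fun A V f"
  shows "continuous_on V f"
proof -
  have "isCont f x" if x: "x \<in> V" for x
  proof -
    obtain c where c: "c \<in> A" "x \<in> fst c" by (rule chart_exists)
    let ?W = "V \<inter> fst c"
    have "continuous_on (snd c ` ?W) (f \<circ> chart_inv c)"
      using assms(2) c(1) smooth_on_continuous unfolding smooth_fun_def by blast
    moreover have "continuous_on ?W (snd c)"
      by (rule continuous_on_subset[OF homeomorphism_cont1[OF chart_homeo[OF c(1)]]]) simp
    ultimately have "continuous_on ?W (\<lambda>x. (f \<circ> chart_inv c) (snd c x))"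
      by (rule continuous_on_compose2[of "snd c ` ?W" "f \<circ> chart_inv c" ?W "snd c"]) auto
    then have "continuous_on ?W f"
      by (rule continuous_on_eq) (use c in \<open>auto simp: chart_inv_chart\<close>)
    then show ?thesis
      using x c assms(1) open_dom[OF c(1)] continuous_on_eq_continuous_at[of ?W f] by (simp add: open_Int)
  qed
  then show ?thesis by (simp add: continuous_at_imp_continuous_on)
qed

lemma open_smooth_fun_nonzero:
  assumes "open V" "smooth_fun A V f"
  shows "open {x\<in>V. f x \<noteq> 0}"
proof -
  have "{x\<in>V. f x \<noteq> 0} = V \<inter> f -` (-{0})" by auto
  then show ?thesis
    using continuous_open_preimage[OF smooth_fun_continuous_on[OF assms] assms(1) open_Compl[OF closed_singleton[of 0]]]
    by simp
qed

section \<open>Differentials in a chart\<close>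

lemma chart_deriv_has_derivative:
  assumes "open V" "smooth_fun A V f" "c \<in> A" "x \<in> V" "x \<in> fst c"
  shows "((f \<circ> chart_inv c) has_derivative chart_deriv c f x) (at (snd c x))"
  unfolding chart_deriv_def
  by (rule smooth_on_has_derivative[OF open_chart_image[OF assms(3,1)]])
    (use assms in \<open>auto simp: smooth_fun_def\<close>)

lemma chart_deriv_eqI:
  assumes "((f \<circ> chart_inv c) has_derivative D) (at (snd c x))"
  shows "chart_deriv c f x v = D v"
  using frechet_derivative_at[OF assms] by (simp add: chart_deriv_def)

lemma linear_chart_deriv:
  assumes "open V" "smooth_fun A V f" "c \<in> A" "x \<in> V" "x \<in> fst c"
  shows "linear (chart_deriv c f x)"
  using chart_deriv_has_derivative[OF assms] by (rule has_derivative_linear)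

lemma chart_deriv_cong:
  assumes "open V" "c \<in> A" "x \<in> V" "x \<in> fst c" "\<And>y. y \<in> V \<Longrightarrow> f y = g y"
  shows "chart_deriv c f x = chart_deriv c g x"
  unfolding chart_deriv_def
  by (rule frechet_derivative_cong_open[OF open_chart_image[OF assms(2,1)]])
    (use assms in \<open>auto simp: chart_inv_chart\<close>)

lemma chart_deriv_const: "chart_deriv c (\<lambda>_. a) x v = 0"
  by (rule chart_deriv_eqI[where D = "\<lambda>_. 0"]) (simp add: o_def)

lemma chart_deriv_add:
  assumes "open V" "smooth_fun A V f" "smooth_fun A V g" "c \<in> A" "x \<in> V" "x \<in> fst c"
  shows "chart_deriv c (\<lambda>y. f y + g y) x v = chart_deriv c f x v + chart_deriv c g x v"
  using has_derivative_add[OF chart_deriv_has_derivative[OF assms(1,2,4-6)]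
      chart_deriv_has_derivative[OF assms(1,3,4-6)]]
  by (intro chart_deriv_eqI[where D = "\<lambda>v. chart_deriv c f x v + chart_deriv c g x v"]) (simp add: o_def)

lemma chart_deriv_mult:
  assumes "open V" "smooth_fun A V f" "smooth_fun A V g" "c \<in> A" "x \<in> V" "x \<in> fst c"
  shows "chart_deriv c (\<lambda>y. f y * g y) x v = f x * chart_deriv c g x v + chart_deriv c f x v * g x"
  using has_derivative_mult[OF chart_deriv_has_derivative[OF assms(1,2,4-6)]
      chart_deriv_has_derivative[OF assms(1,3,4-6)]] assms
  by (intro chart_deriv_eqI[where D = "\<lambda>v. f x * chart_deriv c g x v + chart_deriv c f x v * g x"])
    (simp add: o_def chart_inv_chart)

lemma smooth_fun_chart_deriv:
  assumes "open V" "smooth_fun A V f" "c \<in> A" "V \<subseteq> fst c"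
  shows "smooth_fun A V (\<lambda>x. chart_deriv c f x v)"
  by (rule smooth_funI[OF assms(3,1,4) smooth_on_frechet_derivative[OF smooth_fun_chartD[OF assms(2,3,4)]]])
    (simp add: chart_deriv_def)

text \<open>At a zero of \<open>l\<close>, differentiate the product.\<close>

lemma mult_eq_0_imp_eq_0:
  assumes "open V" "smooth_fun A V l" "smooth_fun A V f" "c \<in> A" "x \<in> V" "x \<in> fst c"
    and "\<And>y. y \<in> V \<Longrightarrow> l y * f y = 0" and "chart_deriv c l x v \<noteq> 0"
  shows "f x = 0"
proof (cases "l x = 0")
  case True
  have "chart_deriv c (\<lambda>y. l y * f y) x v = chart_deriv c (\<lambda>_. 0) x v"
    using chart_deriv_cong[OF assms(1,4-7)] by simp
  then show ?thesis
    using True assms(8) chart_deriv_mult[OF assms(1-6), of v] by (simp add: chart_deriv_const)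
next
  case False
  then show ?thesis using assms(5,7) by fastforce
qed

text \<open>In another chart the components are the given ones multiplied by the partial derivatives
  of the transition map, hence again smooth.\<close>

lemma smooth_vf_tvec_of:
  assumes c: "c \<in> A" and V: "open V" "V \<subseteq> fst c"
    and Y: "\<And>i. smooth_fun A V (\<lambda>x. Y x $ i)"
  shows "smooth_vf A V (\<lambda>x. tvec_of A c x (Y x))"
  unfolding smooth_vf_def
proof (intro conjI ballI)
  fix x assume "x \<in> V"
  then show "tvec_of A c x (Y x) \<in> tangent_space A x"
    using tvec_of_tangent[OF c] V by blast
next
  fix c' assume c': "c' \<in> A"
  let ?T = "snd c' \<circ> chart_inv c" and ?W = "snd c' ` (V \<inter> fst c')"
  have o: "open ?W" using open_chart_image[OF c' V(1)] .
  have "smooth_on ?W (\<lambda>y. \<Sum>i\<in>UNIV. Y (chart_inv c' y) $ i *\<^sub>R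
      frechet_derivative ?T (at (snd c (chart_inv c' y))) (axis i 1))"
  proof (intro smooth_on_sum smooth_on_scaleR o)
    fix i
    show "smooth_on ?W (\<lambda>y. Y (chart_inv c' y) $ i)"
      using Y c' by (simp add: smooth_fun_def o_def)
    have V': "open (V \<inter> fst c')" "V \<inter> fst c' \<subseteq> fst c" using V open_dom[OF c'] by auto
    have "smooth_on (snd c ` (V \<inter> fst c')) ?T"
      by (rule smooth_on_subset[OF transition_smooth[OF c c']]) (use V in auto)
    from smooth_on_compose_transition[OF c c' V' smooth_on_frechet_derivative[OF this, of "axis i 1"]]
    show "smooth_on ?W (\<lambda>y. frechet_derivative ?T (at (snd c (chart_inv c' y))) (axis i 1))"
      by (simp add: Int_assoc)
  qed
  then show "smooth_on ?W (\<lambda>y. tvec_of A c (chart_inv c' y) (Y (chart_inv c' y)) c')"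
  proof (rule smooth_on_cong[OF o, rotated])
    fix y assume "y \<in> ?W"
    then obtain x where x: "y = snd c' x" "x \<in> V" "x \<in> fst c'" by auto
    have lin: "linear (frechet_derivative ?T (at (snd c x)))"
      using linear_transition[OF c c'] x V by auto
    from linear_axis_expansion[OF lin, of "Y x"] show "(\<Sum>i\<in>UNIV. Y (chart_inv c' y) $ i *\<^sub>R
      frechet_derivative ?T (at (snd c (chart_inv c' y))) (axis i 1))
      = tvec_of A c (chart_inv c' y) (Y (chart_inv c' y)) c'"
      using x c' by (simp add: chart_inv_chart tvec_of_def)
  qed
qed

text \<open>For fields with constant coordinates in \<open>c\<close>, the bracket read in any other
  chart is a difference of mixed second derivatives of the transition map, and these agree.\<close>

lemma lie_bracket_tvec_of:
  assumes c: "c \<in> A" "x \<in> fst c"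
  shows "lie_bracket A (\<lambda>x. tvec_of A c x y) (\<lambda>x. tvec_of A c x z) x = (\<lambda>_. 0)"
proof -
  \<comment> \<open>In the chart c' the constant field b becomes the derivative of the transition
    map along b. Differentiating it along the field of a, itself read in c', leads by the chain rule
    back to the direction a in the chart c.\<close>
  have key: "frechet_derivative (\<lambda>w. tvec_of A c (chart_inv c' w) b c') (at (snd c' x)) (tvec_of A c x a c')
      = frechet_derivative (\<lambda>w. frechet_derivative (snd c' \<circ> chart_inv c) (at w) b) (at (snd c x)) a"
    if c': "c' \<in> A" "x \<in> fst c'" for c' a b
  proof -
    let ?T = "snd c' \<circ> chart_inv c" and ?T' = "snd c \<circ> chart_inv c'"
    let ?W = "snd c' ` (fst c \<inter> fst c')" and ?Z = "snd c ` (fst c' \<inter> fst c)"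
    let ?g = "\<lambda>w. frechet_derivative ?T (at w) b"
    have o: "open ?W" "open ?Z"
      using open_chart_image c c' open_dom by metis+
    have s: "smooth_on ?Z ?T"
      using transition_smooth[OF c(1) c'(1)] by (simp add: Int_commute)
    have "(?g has_derivative frechet_derivative ?g (at (snd c x))) (at (snd c x))"
      by (rule smooth_on_has_derivative[OF o(2) smooth_on_frechet_derivative[OF s]]) (use c c' in auto)
    then have 1: "(?g has_derivative frechet_derivative ?g (at (snd c x))) (at (?T' (snd c' x)))"
      using c' by (simp add: chart_inv_chart)
    have 2: "((?g \<circ> ?T') has_derivative (frechet_derivative ?g (at (snd c x)) \<circ>
        frechet_derivative ?T' (at (snd c' x)))) (at (snd c' x))"
      by (rule diff_chain_at[OF transition_has_derivative[OF c'(1) c(1) c'(2) c(2)] 1])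
    have "((\<lambda>w. tvec_of A c (chart_inv c' w) b c') has_derivative
        (frechet_derivative ?g (at (snd c x)) \<circ> frechet_derivative ?T' (at (snd c' x)))) (at (snd c' x))"
      by (rule has_derivative_transform_within_open[OF 2, of ?W])
        (use c c' o(1) in \<open>auto simp: chart_inv_chart tvec_of_def\<close>)
    from frechet_derivative_at[OF this]
    have "frechet_derivative (\<lambda>w. tvec_of A c (chart_inv c' w) b c') (at (snd c' x)) (tvec_of A c x a c')
      = frechet_derivative ?g (at (snd c x)) (frechet_derivative ?T' (at (snd c' x)) (tvec_of A c x a c'))"
      by (metis comp_apply)
    also have "frechet_derivative ?T' (at (snd c' x)) (tvec_of A c x a c') = a"
      using transition_cocycle[OF c(1) c'(1) c(1) c(2) c'(2) c(2), of a] transition_refl[OF c] c'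
      by (simp add: tvec_of_def)
    finally show ?thesis .
  qed
  show ?thesis
  proof
    fix c'
    show "lie_bracket A (\<lambda>x. tvec_of A c x y) (\<lambda>x. tvec_of A c x z) x c' = 0"
    proof (cases "c' \<in> A \<and> x \<in> fst c'")
      case True
      have "open (snd c ` (fst c \<inter> fst c'))"
        using open_chart_image[OF c(1) open_dom, of c'] True by (simp add: Int_commute)
      from second_derivative_symmetric[OF this transition_smooth, of "snd c x" y z] True c
      show ?thesis by (simp add: lie_bracket_def key)
    qed (auto simp: lie_bracket_def)
  qed
qed

end

context oriented_manifold
begin

section \<open>Smooth curves and their velocities\<close>

text \<open>Continuity of the local extension \<open>h\<close> gives this. The form relative to
  \<open>J\<close> is the one needed at the endpoint 0 of the interval [0,1].\<close>

lemma smooth_curve_eventually_within: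
  assumes "smooth_curve A J \<alpha>" "t \<in> J" "open V" "\<alpha> t \<in> V"
  shows "\<forall>\<^sub>F s in nhds t. s \<in> J \<longrightarrow> \<alpha> s \<in> V"
proof -
  obtain c where c: "c \<in> A" "\<alpha> t \<in> fst c" by (rule chart_exists)
  obtain N h where h: "open N" "t \<in> N" "smooth_on N h"
    "\<And>s. s \<in> N \<inter> J \<Longrightarrow> \<alpha> s \<in> fst c \<and> snd c (\<alpha> s) = h s"
    using assms(1,2) c unfolding smooth_curve_def by metis
  have "isCont h t"
    using smooth_on_continuous[OF h(3)] h(1,2) continuous_on_eq_continuous_at by blast
  then have "(h \<longlongrightarrow> h t) (nhds t)"
    using isCont_def tendsto_at_iff_tendsto_nhds by blast
  moreover have "open (snd c ` (V \<inter> fst c))" "h t \<in> snd c ` (V \<inter> fst c)"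
    using open_chart_image[OF c(1) assms(3)] h(4)[of t] h(2) assms(2,4) by (simp, metis IntI imageI)
  ultimately have "\<forall>\<^sub>F s in nhds t. h s \<in> snd c ` (V \<inter> fst c)"
    by (rule topological_tendstoD)
  moreover have "\<forall>\<^sub>F s in nhds t. s \<in> N"
    using h by (intro eventually_nhds_in_open) auto
  ultimately show ?thesis
  proof eventually_elim
    case (elim s)
    then obtain y where "y \<in> V" "y \<in> fst c" "h s = snd c y" by auto
    then show ?case
      using h(4)[of s] elim(2) chart_inv_chart[OF c(1)] by (metis IntI)
  qed
qed

lemma smooth_curve_eventually:
  assumes "smooth_curve A J \<alpha>" "open J" "t \<in> J" "open V" "\<alpha> t \<in> V"
  shows "\<forall>\<^sub>F s in nhds t. \<alpha> s \<in> V"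
  using smooth_curve_eventually_within[OF assms(1,3-5)] eventually_nhds_in_open[OF assms(2,3)]
  by eventually_elim simp

lemma velocity_has_vector_derivative:
  assumes "smooth_curve A J \<alpha>" "open J" "t \<in> J" "c \<in> A" "\<alpha> t \<in> fst c"
  shows "((\<lambda>s. snd c (\<alpha> s)) has_vector_derivative velocity A J \<alpha> t c) (at t)"
proof -
  obtain N h where h: "open N" "t \<in> N" "smooth_on N h"
    "\<And>s. s \<in> N \<inter> J \<Longrightarrow> \<alpha> s \<in> fst c \<and> snd c (\<alpha> s) = h s"
    using assms unfolding smooth_curve_def by metis
  have "h differentiable (at t)"
    using smooth_on_differentiable[OF h(1,3,2)] .
  then have "(h has_vector_derivative vector_derivative h (at t)) (at t)"
    by (simp add: vector_derivative_works)
  then have "((\<lambda>s. snd c (\<alpha> s)) has_vector_derivative vector_derivative h (at t)) (at t)"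
    by (rule has_vector_derivative_transform_within_open[of _ _ _ "N \<inter> J"]) (use h assms in auto)
  then show ?thesis
    using assms vector_derivative_at unfolding velocity_def by (simp add: at_within_open[OF assms(3,2)] vector_derivative_at)
qed

lemma velocity_tangent:
  assumes "smooth_curve A J \<alpha>" "open J" "t \<in> J"
  shows "velocity A J \<alpha> t \<in> tangent_space A (\<alpha> t)"
  unfolding tangent_space_def
proof (intro CollectI conjI ballI allI impI)
  fix c c' assume c: "c \<in> A" "c' \<in> A" "\<alpha> t \<in> fst c \<inter> fst c'"
  let ?T = "snd c' \<circ> chart_inv c"
  let ?v = "velocity A J \<alpha> t"
  have x: "\<alpha> t \<in> fst c" "\<alpha> t \<in> fst c'" using c(3) by auto
  have T: "(?T has_derivative frechet_derivative ?T (at (snd c (\<alpha> t)))) (at (snd c (\<alpha> t)) within range (\<lambda>s. snd c (\<alpha> s)))"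
    using transition_has_derivative[OF c(1,2) x] by (rule has_derivative_at_withinI)
  have "((?T \<circ> (\<lambda>s. snd c (\<alpha> s))) has_vector_derivative frechet_derivative ?T (at (snd c (\<alpha> t))) (?v c)) (at t)"
    by (rule vector_derivative_diff_chain_within[OF velocity_has_vector_derivative[OF assms c(1) x(1)] T])
  moreover have "\<forall>\<^sub>F s in nhds t. \<alpha> s \<in> fst c"
    by (rule smooth_curve_eventually[OF assms open_dom[OF c(1)] x(1)])
  then obtain S where "open S" "t \<in> S" "\<And>s. s \<in> S \<Longrightarrow> \<alpha> s \<in> fst c"
    unfolding eventually_nhds by blast
  ultimately have "((\<lambda>s. snd c' (\<alpha> s)) has_vector_derivative frechet_derivative ?T (at (snd c (\<alpha> t))) (?v c)) (at t)"
    by (elim has_vector_derivative_transform_within_open) (auto simp: chart_inv_chart[OF c(1)])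
  from vector_derivative_unique_at[OF this velocity_has_vector_derivative[OF assms c(2) x(2)]]
  show "?v c' = frechet_derivative ?T (at (snd c (\<alpha> t))) (?v c)" by simp
qed (auto simp: velocity_def)

text \<open>The function f vanishes along the curve near t, and the chain rule expresses the
  derivative of this zero function. With f = \<lambda>, velocities of curves in the singular set lie
  in the kernel of d\<lambda>.\<close>

lemma chart_deriv_velocity_eq_0:
  assumes "smooth_curve A J \<alpha>" "open J" "t \<in> J" "c \<in> A" "\<alpha> t \<in> fst c"
    and V: "open V" "smooth_fun A V f" "\<alpha> t \<in> V"
    and 0: "\<And>s. s \<in> J \<Longrightarrow> \<alpha> s \<in> V \<Longrightarrow> f (\<alpha> s) = 0"
  shows "chart_deriv c f (\<alpha> t) (velocity A J \<alpha> t c) = 0"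
proof -
  have D: "((f \<circ> chart_inv c) has_derivative chart_deriv c f (\<alpha> t)) (at (snd c (\<alpha> t)) within range (\<lambda>s. snd c (\<alpha> s)))"
    using chart_deriv_has_derivative[OF V(1,2) assms(4) V(3) assms(5)] by (rule has_derivative_at_withinI)
  have 1: "((f \<circ> chart_inv c \<circ> (\<lambda>s. snd c (\<alpha> s))) has_vector_derivative
      chart_deriv c f (\<alpha> t) (velocity A J \<alpha> t c)) (at t)"
    by (rule vector_derivative_diff_chain_within[OF velocity_has_vector_derivative[OF assms(1-5)] D])
  have "\<forall>\<^sub>F s in nhds t. \<alpha> s \<in> fst c \<inter> V"
    by (rule smooth_curve_eventually[OF assms(1-3)]) (use V assms(4,5) open_dom[OF assms(4)] in auto)
  moreover have "\<forall>\<^sub>F s in nhds t. s \<in> J"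
    using assms(2,3) by (rule eventually_nhds_in_open)
  ultimately have "\<forall>\<^sub>F s in nhds t. s \<in> J \<and> \<alpha> s \<in> fst c \<inter> V"
    by eventually_elim auto
  then obtain S where S: "open S" "t \<in> S" "\<And>s. s \<in> S \<Longrightarrow> s \<in> J \<and> \<alpha> s \<in> fst c \<inter> V"
    unfolding eventually_nhds by blast
  have "((\<lambda>_. 0) has_vector_derivative chart_deriv c f (\<alpha> t) (velocity A J \<alpha> t c)) (at t)"
    by (rule has_vector_derivative_transform_within_open[OF 1 S(1,2)])
      (use S(3) 0 in \<open>auto simp: chart_inv_chart[OF assms(4)]\<close>)
  then show ?thesis
    using vector_derivative_unique_at has_vector_derivative_const by blast
qed

text \<open>The converse realization: every coordinate vector in the kernel of the differential is
  the velocity of a curve in the zero set. \<open>smooth_level_curve\<close> is applied in one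
  chart, and transition maps give smoothness in the others.\<close>

lemma level_curve:
  assumes c: "c \<in> A" and V: "open V" "V \<subseteq> fst c" "smooth_fun A V f" and x: "x \<in> V" "f x = 0"
    and k: "chart_deriv c f x (axis k 1) \<noteq> 0" and y: "chart_deriv c f x y = 0"
  obtains \<alpha> where "smooth_curve A {-1<..<1} \<alpha>" "\<And>s. \<alpha> s \<in> V" "\<And>s. f (\<alpha> s) = 0" "\<alpha> 0 = x"
    "velocity A {-1<..<1} \<alpha> 0 = tvec_of A c x y"
proof -
  have xc: "x \<in> fst c" using x V by auto
  have o: "open (snd c ` V)" by (rule open_chart_image_subset[OF c V(1,2)])
  obtain \<beta> where \<beta>: "smooth_on UNIV \<beta>" "\<And>s. \<beta> s \<in> snd c ` V" "\<And>s. (f \<circ> chart_inv c) (\<beta> s) = 0"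
    "\<beta> 0 = snd c x" "(\<beta> has_vector_derivative y) (at 0)"
  proof (rule smooth_level_curve[OF o smooth_fun_chartD[OF V(3) c V(2)], of "snd c x" k y])
    show "(f \<circ> chart_inv c) (snd c x) = 0"
      using x c xc by (simp add: chart_inv_chart)
  qed (use x k y in \<open>auto simp: chart_deriv_def\<close>)
  define \<alpha> where "\<alpha> s = chart_inv c (\<beta> s)" for s
  have \<alpha>V: "\<alpha> s \<in> V" and c\<alpha>: "snd c (\<alpha> s) = \<beta> s" for s
  proof -
    obtain z where "z \<in> V" "\<beta> s = snd c z" using \<beta>(2)[of s] by auto
    then show "\<alpha> s \<in> V" "snd c (\<alpha> s) = \<beta> s"
      using V(2) chart_inv_chart[OF c] by (auto simp: \<alpha>_def)
  qed
  have sc: "smooth_curve A {-1<..<1} \<alpha>"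
    unfolding smooth_curve_def
  proof (intro ballI impI)
    fix t :: real and c' assume t: "t \<in> {-1<..<1}" and c': "c' \<in> A" "\<alpha> t \<in> fst c'"
    let ?W = "snd c ` (fst c' \<inter> fst c)"
    have oW: "open ?W" by (rule open_chart_image[OF c open_dom[OF c'(1)]])
    define N where "N = \<beta> -` ?W"
    have "open N"
      unfolding N_def using smooth_on_continuous[OF \<beta>(1)] oW
      by (simp add: continuous_on_eq_continuous_at continuous_open_vimage)
    have N: "\<alpha> s \<in> fst c'" if "s \<in> N" for s
      using that chart_inv_chart[OF c] by (auto simp: N_def \<alpha>_def)
    have "t \<in> N"
      using c'(2) c\<alpha>[of t] \<alpha>V[of t] V(2) unfolding N_def by (metis IntI imageI subsetD vimageI)
    have "smooth_on N (\<lambda>s. (snd c' \<circ> chart_inv c) (\<beta> s))"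
    proof (rule smooth_on_compose[OF \<open>open N\<close> oW, of \<beta> "snd c' \<circ> chart_inv c"])
      show "smooth_on ?W (snd c' \<circ> chart_inv c)"
        using transition_smooth[OF c c'(1)] by (simp add: Int_commute)
    qed (use smooth_on_subset[OF \<beta>(1)] in \<open>auto simp: N_def\<close>)
    with \<open>open N\<close> \<open>t \<in> N\<close> N
    show "\<exists>N h. open N \<and> t \<in> N \<and> smooth_on N h \<and>
      (\<forall>s\<in>N \<inter> {- 1<..<1}. \<alpha> s \<in> fst c' \<and> snd c' (\<alpha> s) = h s)"
      by (intro exI[of _ N] exI[of _ "\<lambda>s. (snd c' \<circ> chart_inv c) (\<beta> s)"]) (simp add: \<alpha>_def)
  qed
  have \<alpha>0: "\<alpha> 0 = x" using c xc by (simp add: \<alpha>_def \<beta>(4) chart_inv_chart)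
  have "((\<lambda>s. snd c (\<alpha> s)) has_vector_derivative velocity A {-1<..<1} \<alpha> 0 c) (at 0)"
    by (rule velocity_has_vector_derivative[OF sc]) (use c xc \<alpha>0 in auto)
  then have "velocity A {-1<..<1} \<alpha> 0 c = y"
    using \<beta>(5) unfolding c\<alpha> by (rule vector_derivative_unique_at)
  moreover have "velocity A {-1<..<1} \<alpha> 0 \<in> tangent_space A x"
    using velocity_tangent[OF sc, of 0] \<alpha>0 by simp
  ultimately have "velocity A {-1<..<1} \<alpha> 0 = tvec_of A c x y"
    using tvec_of_eq[OF c xc] by metis
  with sc \<alpha>V \<alpha>0 show thesis
    using \<beta>(3) by (intro that[of \<alpha>]) (auto simp: \<alpha>_def)
qed

text \<open>Gram-Schmidt carried out on coefficient functions, with the Gram matrix \<open>G\<close>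
  as only input. It thus serves both for bundle frames, whose fibres have no topology, and for
  tangent frames of the singular set.\<close>

lemma smooth_gram_schmidt:
  fixes G :: "'i \<Rightarrow> 'i \<Rightarrow> 'a \<Rightarrow> real"
  assumes S: "finite S" and V: "open V"
    and smooth: "\<And>i j. i \<in> S \<Longrightarrow> j \<in> S \<Longrightarrow> smooth_fun A V (G i j)"
    and sym: "\<And>i j x. i \<in> S \<Longrightarrow> j \<in> S \<Longrightarrow> x \<in> V \<Longrightarrow> G i j x = G j i x"
    and pos: "\<And>x d. x \<in> V \<Longrightarrow> \<exists>i\<in>S. d i \<noteq> 0 \<Longrightarrow> (\<Sum>k\<in>S. \<Sum>l\<in>S. d k * d l * G k l x) > 0"
  obtains a where "\<And>i j. i \<in> S \<Longrightarrow> smooth_fun A V (a i j)"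
    "\<And>x i j. x \<in> V \<Longrightarrow> i \<in> S \<Longrightarrow> j \<in> S \<Longrightarrow>
      (\<Sum>k\<in>S. \<Sum>l\<in>S. a i k x * a j l x * G k l x) = (if i = j then 1 else 0)"
proof -
  define Q where "Q x u v = (\<Sum>k\<in>S. \<Sum>l\<in>S. u k * v l * G k l x)" for x and u v :: "'i \<Rightarrow> real"
  have Q_sym: "Q x u v = Q x v u" if "x \<in> V" for x u v
    unfolding Q_def by (subst sum.swap) (auto intro!: sum.cong simp: sym[OF _ _ that])
  have Q_diff: "Q x (\<lambda>k. u k - (\<Sum>i\<in>I. f i * w i k)) v = Q x u v - (\<Sum>i\<in>I. f i * Q x (w i) v)"
    if "finite I" for x u v I f and w :: "'i \<Rightarrow> 'i \<Rightarrow> real"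
    using that
  proof (induction I)
    case (insert m I)
    have sub: "Q x (\<lambda>k. u k - r * z k) v = Q x u v - r * Q x z v" for u z r
      unfolding Q_def by (simp add: sum_distrib_left sum_subtractf algebra_simps)
    have "Q x (\<lambda>k. u k - (\<Sum>i\<in>insert m I. f i * w i k)) v
        = Q x (\<lambda>k. (u k - (\<Sum>i\<in>I. f i * w i k)) - f m * w m k) v"
      using insert.hyps by (simp add: algebra_simps)
    also have "\<dots> = Q x u v - (\<Sum>i\<in>insert m I. f i * Q x (w i) v)"
      unfolding sub insert.IH using insert.hyps by simp
    finally show ?case .
  qed (simp add: Q_def)
  have Q_mult: "Q x (\<lambda>k. r * u k) v = r * Q x u v" for x r u v
    unfolding Q_def by (simp add: sum_distrib_left mult.assoc)
  have Q_smooth: "smooth_fun A V (\<lambda>x. Q x (\<lambda>k. f k x) (\<lambda>k. g k x))"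
    if "\<And>k. smooth_fun A V (f k)" "\<And>k. smooth_fun A V (g k)" for f g
    unfolding Q_def by (intro smooth_fun_sum smooth_fun_mult V that smooth)
  \<comment> \<open>The middle clause, that the vectors obtained so far involve only indices in
    \<open>I\<close>, strengthens the induction: it keeps the next residual from vanishing.\<close>
  have "\<exists>a. (\<forall>i\<in>I. \<forall>k. smooth_fun A V (a i k)) \<and> (\<forall>i\<in>I. \<forall>k. k \<notin> I \<longrightarrow> (\<forall>x. a i k x = 0)) \<and>
      (\<forall>x\<in>V. \<forall>i\<in>I. \<forall>j\<in>I. Q x (\<lambda>k. a i k x) (\<lambda>k. a j k x) = (if i = j then 1 else 0))"
    if "I \<subseteq> S" for I
    using finite_subset[OF that S] that
  proof (induction I rule: finite_induct)
    case empty
    then show ?case by simp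
  next
    case (insert m I)
    have "I \<subseteq> S" using insert.prems by auto
    from insert.IH[OF this] obtain a where a: "\<forall>i\<in>I. \<forall>k. smooth_fun A V (a i k)"
      "\<forall>i\<in>I. \<forall>k. k \<notin> I \<longrightarrow> (\<forall>x. a i k x = 0)"
      "\<forall>x\<in>V. \<forall>i\<in>I. \<forall>j\<in>I. Q x (\<lambda>k. a i k x) (\<lambda>k. a j k x) = (if i = j then 1 else 0)"
      by (elim exE conjE) (rule that)
    note sm = a(1)[rule_format] and supp = a(2)[rule_format] and on = a(3)[rule_format]
    define e where "e k = (if k = m then 1 else 0 :: real)" for k
    define f where "f i x = Q x e (\<lambda>k. a i k x)" for i x
    define b where "b k x = e k - (\<Sum>i\<in>I. f i x * a i k x)" for k x
    have sf: "smooth_fun A V (f i)" if "i \<in> I" for i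
      unfolding f_def using that by (intro Q_smooth smooth_fun_const sm)
    have sb: "smooth_fun A V (b k)" for k
      unfolding b_def by (intro smooth_fun_diff smooth_fun_const smooth_fun_sum smooth_fun_mult V sf sm)
    \<comment> \<open>The subtracted projections have no component at m, so the coefficient 1
      survives and positivity of \<open>G\<close> makes the residual normalizable.\<close>
    have bm: "b m x = 1" for x
      using insert.hyps supp by (simp add: b_def e_def)
    have bsupp: "b k x = 0" if "k \<notin> insert m I" for k x
      using that supp by (simp add: b_def e_def)
    define n where "n x = Q x (\<lambda>k. b k x) (\<lambda>k. b k x)" for x
    have npos: "n x > 0" if "x \<in> V" for x
    proof -
      have "\<exists>i\<in>S. b i x \<noteq> 0" using bm[of x] insert.prems by (intro bexI[of _ m]) auto
      from pos[OF that this] show ?thesis by (simp add: n_def Q_def)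
    qed
    have sn: "smooth_fun A V n"
      unfolding n_def by (intro Q_smooth sb)
    have orth: "Q x (\<lambda>k. b k x) (\<lambda>k. a j k x) = 0" if "x \<in> V" "j \<in> I" for x j
    proof -
      have "Q x (\<lambda>k. b k x) (\<lambda>k. a j k x) = f j x - (\<Sum>i\<in>I. f i x * Q x (\<lambda>k. a i k x) (\<lambda>k. a j k x))"
        unfolding b_def using Q_diff[OF insert.hyps(1)] by (simp add: f_def)
      also have "(\<Sum>i\<in>I. f i x * Q x (\<lambda>k. a i k x) (\<lambda>k. a j k x)) = (\<Sum>i\<in>I. if i = j then f j x else 0)"
        by (rule sum.cong) (auto simp: on that)
      finally show ?thesis using insert.hyps(1) that(2) by simp
    qed
    define r where "r x = inverse (sqrt (n x))" for x
    have sr: "smooth_fun A V r"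
      unfolding r_def
      by (intro smooth_fun_inverse smooth_fun_sqrt V sn npos) (simp_all add: less_imp_neq[OF npos, symmetric])
    have r1: "r x * (r x * n x) = 1" if "x \<in> V" for x
      using npos[OF that] real_sqrt_mult_self[of "n x"]
      by (simp add: r_def field_simps)
    define a' where "a' i k = (if i = m then \<lambda>x. r x * b k x else a i k)" for i k
    have a'I: "a' i = a i" if "i \<in> I" for i
      using that insert.hyps by (auto simp: a'_def)
    have a'm: "a' m k x = r x * b k x" for k x by (simp add: a'_def)
    have mm: "Q x (\<lambda>k. a' m k x) (\<lambda>k. a' m k x) = 1" if x: "x \<in> V" for x
      unfolding a'm Q_mult using Q_sym[OF x, of "\<lambda>k. b k x" "\<lambda>k. r x * b k x"] r1[OF x]
      by (simp add: Q_mult n_def)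
    have mj: "Q x (\<lambda>k. a' m k x) (\<lambda>k. a' j k x) = 0" if x: "x \<in> V" and "j \<in> I" for x j
      unfolding a'm Q_mult using orth that by (simp add: a'I)
    have jm: "Q x (\<lambda>k. a' j k x) (\<lambda>k. a' m k x) = 0" if x: "x \<in> V" and "j \<in> I" for x j
      using mj[OF that] Q_sym[OF x] by metis
    have ij: "Q x (\<lambda>k. a' i k x) (\<lambda>k. a' j k x) = (if i = j then 1 else 0)"
      if "x \<in> V" "i \<in> I" "j \<in> I" for x i j
      using on[OF that] that by (simp add: a'I)
    have "smooth_fun A V (a' i k)" if "i \<in> insert m I" for i k
      using that smooth_fun_mult[OF V sr sb[of k]] sm by (auto simp: a'_def)
    moreover have "a' i k x = 0" if "i \<in> insert m I" "k \<notin> insert m I" for i k x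
      using that bsupp supp by (auto simp: a'_def)
    moreover have "Q x (\<lambda>k. a' i k x) (\<lambda>k. a' j k x) = (if i = j then 1 else 0)"
      if "x \<in> V" "i \<in> insert m I" "j \<in> insert m I" for x i j
      using that mm mj jm ij insert.hyps by (elim insertE) auto
    ultimately show ?case by (intro exI[of _ a']) blast
  qed
  from this[OF order_refl] obtain a where "\<forall>i\<in>S. \<forall>k. smooth_fun A V (a i k)"
      "\<forall>x\<in>V. \<forall>i\<in>S. \<forall>j\<in>S. Q x (\<lambda>k. a i k x) (\<lambda>k. a j k x) = (if i = j then 1 else 0)"
    by blast
  then show thesis by (intro that[of a]) (auto simp: Q_def)
qed

end

section \<open>Alternating multilinear forms\<close>

text \<open>Multilinearity is assumed only on the subspace \<open>S\<close>, as the co-orientation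
  is constrained only on a fibre. The matrix is treated by row operations and column swaps, under
  which both sides change in the same way.\<close>

lemma alternating_form_det:
  fixes F :: "('m::finite \<Rightarrow> 'e::real_vector) \<Rightarrow> real" and E :: "real^'m^'m"
  assumes S: "subspace S"
    and lin: "\<And>f i a b u v. u \<in> S \<Longrightarrow> v \<in> S \<Longrightarrow> (\<forall>j. f j \<in> S) \<Longrightarrow>
      F (f(i := a *\<^sub>R u + b *\<^sub>R v)) = a * F (f(i := u)) + b * F (f(i := v))"
    and alt: "\<And>f i j. (\<forall>k. f k \<in> S) \<Longrightarrow> i \<noteq> j \<Longrightarrow> f i = f j \<Longrightarrow> F f = 0"
    and w: "\<And>j. w j \<in> S"
  shows "F (\<lambda>i. \<Sum>j\<in>UNIV. E $ i $ j *\<^sub>R w j) = det E * F w"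
proof -
  have cmul: "F (f(i := a *\<^sub>R u)) = a * F (f(i := u))" if "u \<in> S" "\<forall>j. f j \<in> S" for f i a u
    using lin[OF that(1,1,2), of i a 0] by simp
  have add: "F (f(i := u + v)) = F (f(i := u)) + F (f(i := v))" if "u \<in> S" "v \<in> S" "\<forall>j. f j \<in> S" for f i u v
    using lin[OF that, of i 1 1] by simp
  have zero: "F f = 0" if "\<forall>j. f j \<in> S" "f i = 0" for f i
    using cmul[of "f i" f i 0] fun_upd_triv[of f i] subspace_0[OF S] that by simp
  have inS: "(\<Sum>j\<in>UNIV. d j *\<^sub>R w j) \<in> S" if "\<And>j. w j \<in> S" for d and w :: "'m \<Rightarrow> 'e"
    using S that by (intro subspace_sum subspace_scale) auto
  \<comment> \<open>Antisymmetry: with the sum of the two vectors in both slots the form vanishes,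
    and expanding leaves only the two swapped terms.\<close>
  have swap: "F (w \<circ> Transposition.transpose m n) = - F w" if "m \<noteq> n" and w: "\<And>j. w j \<in> S" for m n w
  proof -
    let ?s = "w m + w n"
    have wS: "\<forall>j. w j \<in> S" "\<forall>j. (w(m := u)) j \<in> S" if "u \<in> S" for u using w that by auto
    have s: "?s \<in> S" using w S subspace_add by blast
    have "F (w(m := ?s, n := ?s)) = 0"
      by (rule alt[of _ m n]) (use that s in auto)
    moreover have "F (w(m := ?s, n := ?s)) = F (w(m := ?s, n := w m)) + F (w(m := ?s, n := w n))"
      by (rule add) (use w s in auto)
    moreover have "F (w(n := x, m := ?s)) = F (w(n := x, m := w m)) + F (w(n := x, m := w n))" if "x \<in> S" for x
      by (rule add) (use w that in auto)
    moreover have "w(m := a, n := b) = w(n := b, m := a)" for a b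
      using that(1) by (rule fun_upd_twist)
    moreover have "F (w(n := w m, m := w m)) = 0" "F (w(n := w n, m := w n)) = 0"
      by (rule alt[of _ m n]; use that in auto)+
    moreover have "w(n := w n, m := w m) = w" by auto
    moreover have "w(n := w m, m := w n) = w \<circ> Transposition.transpose m n"
      using that(1) by (auto simp: fun_eq_iff Transposition.transpose_def)
    ultimately show ?thesis using w by (smt (verit))
  qed
  \<comment> \<open>The vectors w must be universally quantified, since a column swap is absorbed by
    permuting them.\<close>
  have "\<forall>w. (\<forall>j. w j \<in> S) \<longrightarrow> F (\<lambda>i. \<Sum>j\<in>UNIV. E $ i $ j *\<^sub>R w j) = det E * F w"
  proof (rule induct_matrix_row_operations[where A = E], goal_cases zero_row diagonal swap_cols row_op)
    case (zero_row A i)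
    then have "A $ i $ j = 0" for j by (simp add: row_def vec_eq_iff)
    then show ?case
      using zero[of "\<lambda>i. \<Sum>j\<in>UNIV. A $ i $ j *\<^sub>R _ j" i] inS det_zero_row(1)[OF zero_row] by simp
  next
    case (diagonal A)
    show ?case
    proof (intro allI impI)
      fix w :: "'m \<Rightarrow> 'e" assume w: "\<forall>j. w j \<in> S"
      have eq: "(\<Sum>j\<in>UNIV. A $ i $ j *\<^sub>R w j) = A $ i $ i *\<^sub>R w i" for i
      proof -
        have "(\<Sum>j\<in>UNIV. A $ i $ j *\<^sub>R w j) = (\<Sum>j\<in>UNIV. if j = i then A $ i $ i *\<^sub>R w i else 0)"
          by (rule sum.cong) (use diagonal in auto)
        then show ?thesis by simp
      qed
      have "F (\<lambda>i. if i \<in> K then A $ i $ i *\<^sub>R w i else w i) = (\<Prod>i\<in>K. A $ i $ i) * F w" for K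
      proof (induction K rule: infinite_finite_induct)
        case (insert k K)
        let ?f = "\<lambda>i. if i \<in> K then A $ i $ i *\<^sub>R w i else w i"
        have fS: "\<forall>j. ?f j \<in> S" using w S by (auto intro: subspace_scale)
        have "(\<lambda>i. if i \<in> insert k K then A $ i $ i *\<^sub>R w i else w i) = ?f(k := A $ k $ k *\<^sub>R w k)"
          by auto
        moreover have "?f(k := w k) = ?f" using insert by auto
        ultimately show ?case
          using cmul[OF spec[OF w, of k] fS, of k "A $ k $ k"] insert by simp
      qed auto
      from this[of UNIV] show "F (\<lambda>i. \<Sum>j\<in>UNIV. A $ i $ j *\<^sub>R w j) = det A * F w"
        using det_diagonal[of A] diagonal by (simp add: eq)
    qed
  next
    case (swap_cols A m n)
    let ?\<tau> = "Transposition.transpose m n"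
    show ?case
    proof (intro allI impI)
      fix w :: "'m \<Rightarrow> 'e" assume w: "\<forall>j. w j \<in> S"
      have "(\<Sum>j\<in>UNIV. A $ i $ ?\<tau> j *\<^sub>R w j) = (\<Sum>j\<in>UNIV. A $ i $ j *\<^sub>R (w \<circ> ?\<tau>) j)" for i
        by (rule sum.reindex_bij_witness[of _ ?\<tau> ?\<tau>]) auto
      moreover have "F (\<lambda>i. \<Sum>j\<in>UNIV. A $ i $ j *\<^sub>R (w \<circ> ?\<tau>) j) = det A * F (w \<circ> ?\<tau>)"
        using swap_cols(1)[rule_format, of "w \<circ> ?\<tau>"] w by (simp add: o_def)
      moreover have "det (\<chi> i j. A $ i $ ?\<tau> j) = - det A"
        using det_permute_columns[of ?\<tau> A] swap_cols(2) by (simp add: permutes_swap_id sign_swap_id)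
      ultimately show "F (\<lambda>i. \<Sum>j\<in>UNIV. (\<chi> i j. A $ i $ ?\<tau> j) $ i $ j *\<^sub>R w j) = det (\<chi> i j. A $ i $ ?\<tau> j) * F w"
        using swap[OF swap_cols(2)] w by (simp add: o_def)
    qed
  next
    case (row_op A m n c)
    show ?case
    proof (intro allI impI)
      fix w :: "'m \<Rightarrow> 'e" assume w: "\<forall>j. w j \<in> S"
      let ?R = "\<lambda>i. \<Sum>j\<in>UNIV. A $ i $ j *\<^sub>R w j"
      let ?A = "\<chi> i. if i = m then row m A + c *\<^sub>R row n A else row i A"
      have R: "\<forall>i. ?R i \<in> S" using inS w by blast
      have IH: "F ?R = det A * F w" using row_op(1) w by blast
      have comb: "(\<Sum>j\<in>UNIV. ?A $ i $ j *\<^sub>R w j) = (?R(m := 1 *\<^sub>R ?R m + c *\<^sub>R ?R n)) i" for i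
        by (simp add: row_def scaleR_add_left sum.distrib scaleR_sum_right)
      have "F (\<lambda>i. \<Sum>j\<in>UNIV. ?A $ i $ j *\<^sub>R w j) = F (?R(m := 1 *\<^sub>R ?R m + c *\<^sub>R ?R n))"
        by (rule arg_cong[of _ _ F]) (rule ext, rule comb)
      also have "\<dots> = 1 * F (?R(m := ?R m)) + c * F (?R(m := ?R n))"
        by (rule lin[OF spec[OF R, of m] spec[OF R, of n] R])
      also have "F (?R(m := ?R n)) = 0"
        by (rule alt[of _ m n]) (use R row_op(2) in auto)
      finally have "F (\<lambda>i. \<Sum>j\<in>UNIV. ?A $ i $ j *\<^sub>R w j) = det A * F w"
        unfolding fun_upd_triv[of ?R m] IH by (simp only: mult_1 mult_zero_right add_0_right)
      moreover have "det ?A = det A"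
        by (rule det_row_operation[OF row_op(2), of A c, unfolded scalar_mult_eq_scaleR])
      ultimately show "F (\<lambda>i. \<Sum>j\<in>UNIV. ?A $ i $ j *\<^sub>R w j) = det ?A * F w" by simp
    qed
  qed
  then show ?thesis using w by blast
qed

section \<open>Local frames of a coherent tangent bundle\<close>

locale coherent_bundle =
  fixes B :: "('a::t2_space, 'm::{finite,linorder}, 'e::real_vector) ctb"
  assumes ctb: "coherent_tangent_bundle B"
begin

abbreviation "A \<equiv> ctb_atlas B"
abbreviation "fib \<equiv> ctb_fibre B"
abbreviation "ip \<equiv> ctb_inner B"
abbreviation "phi \<equiv> ctb_phi B"

sublocale oriented_manifold A
  using ctb by unfold_locales (simp add: coherent_tangent_bundle_def)

lemma vb: "vector_bundle B" and bm: "bundle_metric B" and mc: "metric_connection B"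
  and bh: "bundle_hom B" and tf: "torsion_free B" and co: "co_orientation B" and conn: "connection B"
  using ctb unfolding coherent_tangent_bundle_def metric_connection_def by blast+

lemma frame_exists:
  obtains W f where "(W, f) \<in> ctb_frames B" "x \<in> W"
  using vb unfolding vector_bundle_def by blast

lemma frameD:
  assumes "(W, f) \<in> ctb_frames B"
  shows "open W" "\<And>x. x \<in> W \<Longrightarrow> inj (\<lambda>i. f i x)" "\<And>x. x \<in> W \<Longrightarrow> independent (range (\<lambda>i. f i x))"
    "\<And>x. x \<in> W \<Longrightarrow> span (range (\<lambda>i. f i x)) = fib x" "\<And>i. smooth_section B W (f i)"
  using vb assms unfolding vector_bundle_def by fast+

lemma subspace_fibre: "subspace (fib x)"
proof -
  obtain W f where f: "(W, f) \<in> ctb_frames B" "x \<in> W" by (rule frame_exists)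
  show ?thesis unfolding frameD(4)[OF f, symmetric] by (rule subspace_span)
qed

lemmas fibre_add = subspace_add[OF subspace_fibre]
  and fibre_scale = subspace_scale[OF subspace_fibre]
  and fibre_diff = subspace_diff[OF subspace_fibre]
  and fibre_0 = subspace_0[OF subspace_fibre]
  and fibre_sum = subspace_sum[OF subspace_fibre]

section \<open>Rules for the fibre metric\<close>

lemmas inner_sym = bm[unfolded bundle_metric_def, THEN conjunct1, rule_format]
  and inner_lin = bm[unfolded bundle_metric_def, THEN conjunct2, THEN conjunct1, rule_format]
  and inner_pos = bm[unfolded bundle_metric_def, THEN conjunct2, THEN conjunct2, THEN conjunct1, rule_format]
  and inner_smooth =
    bm[unfolded bundle_metric_def, THEN conjunct2, THEN conjunct2, THEN conjunct2, rule_format]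

lemma inner_add_left: "u \<in> fib x \<Longrightarrow> v \<in> fib x \<Longrightarrow> w \<in> fib x \<Longrightarrow>
    ip x (u + v) w = ip x u w + ip x v w"
  using inner_lin[of u x v w 1 1] by simp

lemma inner_scale_left: "u \<in> fib x \<Longrightarrow> w \<in> fib x \<Longrightarrow>
    ip x (a *\<^sub>R u) w = a * ip x u w"
  using inner_lin[of u x u w a 0] by simp

lemma inner_diff_left: "u \<in> fib x \<Longrightarrow> v \<in> fib x \<Longrightarrow> w \<in> fib x \<Longrightarrow>
    ip x (u - v) w = ip x u w - ip x v w"
  using inner_lin[of u x v w 1 "-1"] by simp

lemma inner_0_left: "w \<in> fib x \<Longrightarrow> ip x 0 w = 0"
  using inner_scale_left[of w x w 0] by simp

lemma inner_sum_left:
  assumes "\<And>i. i \<in> I \<Longrightarrow> g i \<in> fib x" "w \<in> fib x"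
  shows "ip x (\<Sum>i\<in>I. a i *\<^sub>R g i) w = (\<Sum>i\<in>I. a i * ip x (g i) w)"
  using assms(1)
proof (induction I rule: infinite_finite_induct)
  case (insert i I)
  have "(\<Sum>i\<in>I. a i *\<^sub>R g i) \<in> fib x"
    by (rule fibre_sum) (simp add: fibre_scale insert.prems)
  then show ?case
    using insert inner_add_left inner_scale_left fibre_scale assms(2) by simp
qed (simp_all add: inner_0_left assms(2))

lemma inner_sum_right:
  assumes "\<And>i. i \<in> I \<Longrightarrow> g i \<in> fib x" "w \<in> fib x"
  shows "ip x w (\<Sum>i\<in>I. a i *\<^sub>R g i) = (\<Sum>i\<in>I. a i * ip x w (g i))"
proof -
  have "(\<Sum>i\<in>I. a i *\<^sub>R g i) \<in> fib x"
    by (rule fibre_sum) (simp add: fibre_scale assms(1))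
  then show ?thesis
    using inner_sum_left[OF assms, of I "\<lambda>i. i" a] inner_sym assms by (simp cong: sum.cong)
qed

section \<open>Smooth sections\<close>

lemma smooth_section_fibre: "smooth_section B V s \<Longrightarrow> x \<in> V \<Longrightarrow> s x \<in> fib x"
  by (simp add: smooth_section_def)

lemma smooth_sectionI:
  assumes "\<And>x. x \<in> V \<Longrightarrow> s x \<in> fib x"
    and "\<And>W f. (W, f) \<in> ctb_frames B \<Longrightarrow> \<exists>a. (\<forall>i. smooth_fun A (V \<inter> W) (a i)) \<and>
      (\<forall>x\<in>V \<inter> W. s x = (\<Sum>i\<in>UNIV. a i x *\<^sub>R f i x))"
  shows "smooth_section B V s"
  unfolding smooth_section_def
proof (intro conjI ballI)
  fix Wf assume "Wf \<in> ctb_frames B"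
  then show "case Wf of (W, f) \<Rightarrow> \<exists>a. (\<forall>i. smooth_fun A (V \<inter> W) (a i)) \<and>
      (\<forall>x\<in>V \<inter> W. s x = (\<Sum>i\<in>UNIV. a i x *\<^sub>R f i x))"
    using assms(2)[of "fst Wf" "snd Wf"] by (simp add: case_prod_beta)
qed (rule assms(1))

lemma smooth_sectionE:
  assumes "smooth_section B V s" "(W, f) \<in> ctb_frames B"
  obtains a where "\<And>i. smooth_fun A (V \<inter> W) (a i)"
    "\<And>x. x \<in> V \<inter> W \<Longrightarrow> s x = (\<Sum>i\<in>UNIV. a i x *\<^sub>R f i x)"
proof -
  have "\<exists>a. (\<forall>i. smooth_fun A (V \<inter> W) (a i)) \<and> (\<forall>x\<in>V \<inter> W. s x = (\<Sum>i\<in>UNIV. a i x *\<^sub>R f i x))"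
    using bspec[OF conjunct2[OF assms(1)[unfolded smooth_section_def]] assms(2)] by simp
  then show thesis using that by blast
qed

lemma smooth_section_subset:
  assumes "smooth_section B V s" "U \<subseteq> V"
  shows "smooth_section B U s"
proof -
  have "\<exists>a. (\<forall>i. smooth_fun A (U \<inter> W) (a i)) \<and> (\<forall>x\<in>U \<inter> W. s x = (\<Sum>i\<in>UNIV. a i x *\<^sub>R f i x))"
    if Wf: "(W, f) \<in> ctb_frames B" for W f
  proof -
    obtain a where a: "\<And>i. smooth_fun A (V \<inter> W) (a i)" "\<And>x. x \<in> V \<inter> W \<Longrightarrow> s x = (\<Sum>i\<in>UNIV. a i x *\<^sub>R f i x)"
      using smooth_sectionE[OF assms(1) Wf] by blast
    show ?thesis
      using assms(2) by (intro exI[of _ a] conjI allI smooth_fun_subset[OF a(1)] ballI a(2)) auto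
  qed
  then show ?thesis
    using smooth_section_fibre[OF assms(1)] assms(2) by (intro smooth_sectionI) blast+
qed

lemma smooth_section_add:
  assumes V: "open V" and s: "smooth_section B V s" and t: "smooth_section B V t"
  shows "smooth_section B V (\<lambda>x. s x + t x)"
proof -
  have "\<exists>a. (\<forall>i. smooth_fun A (V \<inter> W) (a i)) \<and> (\<forall>x\<in>V \<inter> W. s x + t x = (\<Sum>i\<in>UNIV. a i x *\<^sub>R f i x))"
    if Wf: "(W, f) \<in> ctb_frames B" for W f
  proof -
    obtain a where a: "\<And>i. smooth_fun A (V \<inter> W) (a i)" "\<And>x. x \<in> V \<inter> W \<Longrightarrow> s x = (\<Sum>i\<in>UNIV. a i x *\<^sub>R f i x)"
      using smooth_sectionE[OF s Wf] by blast
    obtain b where b: "\<And>i. smooth_fun A (V \<inter> W) (b i)" "\<And>x. x \<in> V \<inter> W \<Longrightarrow> t x = (\<Sum>i\<in>UNIV. b i x *\<^sub>R f i x)"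
      using smooth_sectionE[OF t Wf] by blast
    have "open (V \<inter> W)" using V frameD(1)[OF Wf] by auto
    then show ?thesis
      using a b by (intro exI[of _ "\<lambda>i x. a i x + b i x"])
        (auto simp: scaleR_add_left sum.distrib intro!: smooth_fun_add)
  qed
  then show ?thesis
    by (intro smooth_sectionI fibre_add smooth_section_fibre[OF s] smooth_section_fibre[OF t])
qed

lemma smooth_section_scale:
  assumes V: "open V" and s: "smooth_section B V s" and g: "smooth_fun A V g"
  shows "smooth_section B V (\<lambda>x. g x *\<^sub>R s x)"
proof -
  have "\<exists>a. (\<forall>i. smooth_fun A (V \<inter> W) (a i)) \<and> (\<forall>x\<in>V \<inter> W. g x *\<^sub>R s x = (\<Sum>i\<in>UNIV. a i x *\<^sub>R f i x))"
    if Wf: "(W, f) \<in> ctb_frames B" for W f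
  proof -
    obtain a where a: "\<And>i. smooth_fun A (V \<inter> W) (a i)" "\<And>x. x \<in> V \<inter> W \<Longrightarrow> s x = (\<Sum>i\<in>UNIV. a i x *\<^sub>R f i x)"
      using smooth_sectionE[OF s Wf] by blast
    have o: "open (V \<inter> W)" using V frameD(1)[OF Wf] by auto
    have g': "smooth_fun A (V \<inter> W) g" by (rule smooth_fun_subset[OF g]) auto
    show ?thesis
      using a smooth_fun_mult[OF o g'] by (intro exI[of _ "\<lambda>i x. g x * a i x"])
        (auto simp: scaleR_sum_right)
  qed
  then show ?thesis
    by (intro smooth_sectionI fibre_scale smooth_section_fibre[OF s])
qed

lemma smooth_section_0: "smooth_section B V (\<lambda>_. 0)"
  unfolding smooth_section_def
  by (auto simp: fibre_0 intro!: exI[of _ "\<lambda>_ _. 0"] smooth_fun_const)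

lemma smooth_section_sum:
  assumes "open V" "\<And>i. i \<in> I \<Longrightarrow> smooth_fun A V (g i)" "\<And>i. i \<in> I \<Longrightarrow> smooth_section B V (s i)"
  shows "smooth_section B V (\<lambda>x. \<Sum>i\<in>I. g i x *\<^sub>R s i x)"
  using assms(2,3)
  by (induction I rule: infinite_finite_induct)
    (simp_all add: smooth_section_0 smooth_section_add smooth_section_scale assms(1))

section \<open>The co-orientation and orthonormal frames\<close>

lemma coor_smooth: "open V \<Longrightarrow> (\<And>i. smooth_section B V (s i)) \<Longrightarrow>
    smooth_fun A V (\<lambda>x. ctb_coor B x (\<lambda>i. s i x))"
  by (rule co[unfolded co_orientation_def, THEN conjunct2, THEN conjunct2, THEN conjunct1, rule_format])

lemma coor_lin:
  "u \<in> fib x \<Longrightarrow> v \<in> fib x \<Longrightarrow> (\<forall>j. f j \<in> fib x) \<Longrightarrow>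
   ctb_coor B x (f(i := a *\<^sub>R u + b *\<^sub>R v)) = a * ctb_coor B x (f(i := u)) + b * ctb_coor B x (f(i := v))"
  by (rule co[unfolded co_orientation_def, THEN conjunct1, rule_format]) auto

lemma coor_scale:
  "u \<in> fib x \<Longrightarrow> (\<forall>j. f j \<in> fib x) \<Longrightarrow>
   ctb_coor B x (f(i := a *\<^sub>R u)) = a * ctb_coor B x (f(i := u))"
  using coor_lin[of u x u f i a 0] by simp

lemma coor_alt: "(\<forall>k. f k \<in> fib x) \<Longrightarrow> i \<noteq> j \<Longrightarrow> f i = f j \<Longrightarrow> ctb_coor B x f = 0"
  using co[unfolded co_orientation_def, THEN conjunct2, THEN conjunct1,
      THEN spec[of _ x], THEN spec[of _ f], THEN spec[of _ i], THEN spec[of _ j]] by blast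

lemma coor_orthonormal: "orthonormal_frame B x f \<Longrightarrow> ctb_coor B x f = 1 \<or> ctb_coor B x f = -1"
  by (rule co[unfolded co_orientation_def, THEN conjunct2, THEN conjunct2, THEN conjunct2, rule_format])

lemma coor_det:
  assumes "\<And>j. w j \<in> fib x"
  shows "ctb_coor B x (\<lambda>i. \<Sum>j\<in>UNIV. E $ i $ j *\<^sub>R w j) = det E * ctb_coor B x w"
  using assms by (intro alternating_form_det[OF subspace_fibre] coor_lin coor_alt)

text \<open>A dimension count: a nonzero residual, orthogonal to all \<open>e i\<close>, would
  extend them to more than \<open>CARD('m)\<close> independent vectors in a fibre spanned by at most
  that many.\<close>

lemma orthonormal_expansion:
  assumes e: "orthonormal_frame B x e" and u: "u \<in> fib x"
  shows "u = (\<Sum>i\<in>UNIV. ip x u (e i) *\<^sub>R e i)"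
proof (rule ccontr)
  assume ne: "u \<noteq> (\<Sum>i\<in>UNIV. ip x u (e i) *\<^sub>R e i)"
  define w where "w = u - (\<Sum>i\<in>UNIV. ip x u (e i) *\<^sub>R e i)"
  have eE: "e i \<in> fib x" and eo: "ip x (e i) (e j) = (if i = j then 1 else 0)" for i j
    using e unfolding orthonormal_frame_def by blast+
  have sE: "(\<Sum>i\<in>UNIV. d i *\<^sub>R e i) \<in> fib x" for d
    by (rule fibre_sum) (simp add: eE fibre_scale)
  have wE: "w \<in> fib x" unfolding w_def by (rule fibre_diff[OF u sE])
  have s: "ip x (\<Sum>i\<in>UNIV. d i *\<^sub>R e i) (e j) = d j" for d j
    by (subst inner_sum_left) (simp_all add: eE eo if_distrib cong: if_cong)
  have "ip x w (e j) = 0" for j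
    unfolding w_def by (subst inner_diff_left[OF u sE eE]) (simp add: s)
  then have we: "ip x (e j) w = 0" for j using inner_sym[OF eE wE] by simp
  have sw: "ip x (\<Sum>i\<in>UNIV. d i *\<^sub>R e i) w = 0" for d
    by (subst inner_sum_left) (simp_all add: eE wE we)
  have inj: "inj e"
    using eo by (metis injI zero_neq_one)
  have span: "\<exists>d. v = (\<Sum>i\<in>UNIV. d i *\<^sub>R e i)" if v: "v \<in> span (range e)" for v
  proof -
    obtain r where "(\<Sum>z\<in>range e. r z *\<^sub>R z) = v"
      using v by (auto simp: span_finite)
    then show ?thesis
      by (intro exI[of _ "\<lambda>i. r (e i)"]) (simp add: sum.reindex[OF inj] o_def)
  qed
  have "independent (range e)"
    unfolding independent_explicit_finite_subsets
  proof (intro allI impI ballI)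
    fix S r v assume S: "S \<subseteq> range e" "finite S" "(\<Sum>v\<in>S. r v *\<^sub>R v) = 0" "v \<in> S"
    then obtain j where j: "v = e j" by auto
    have "ip x (\<Sum>v\<in>S. r v *\<^sub>R v) (e j) = (\<Sum>v\<in>S. r v * ip x v (e j))"
      by (rule inner_sum_left) (use S(1) eE in auto)
    also have "\<dots> = (\<Sum>v\<in>S. if v = e j then r v else 0)"
    proof (rule sum.cong[OF refl])
      fix z assume "z \<in> S"
      then obtain i where "z = e i" using S(1) by auto
      then show "r z * ip x z (e j) = (if z = e j then r z else 0)"
        using eo[of i j] injD[OF inj, of i j] by (cases "i = j") auto
    qed
    also have "\<dots> = r v" using S j by simp
    finally show "r v = 0" using S(3) inner_0_left[OF eE] by simp
  qed
  moreover have "w \<notin> span (range e)"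
  proof
    assume "w \<in> span (range e)"
    then obtain d where "w = (\<Sum>i\<in>UNIV. d i *\<^sub>R e i)" using span by blast
    then have "ip x w w = 0" using sw[of d] by simp
    then show False using inner_pos[OF wE] ne by (simp add: w_def)
  qed
  ultimately have ind: "independent (insert w (range e))" by (rule independent_insertI[rotated])
  obtain W f where f: "(W, f) \<in> ctb_frames B" "x \<in> W" by (rule frame_exists)
  have "insert w (range e) \<subseteq> span (range (\<lambda>i. f i x))"
    using wE eE unfolding frameD(4)[OF f] by auto
  from independent_span_bound[OF _ ind this]
  have "card (insert w (range e)) \<le> card (range (\<lambda>i. f i x))" by simp
  also have "\<dots> \<le> CARD('m)" by (rule card_image_le) simp
  finally have "card (insert w (range e)) \<le> CARD('m)" .
  moreover have "w \<notin> range e" using \<open>w \<notin> span (range e)\<close> span_base[of w "range e"] by (rule contrapos_nn)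
  then have "card (insert w (range e)) = Suc (card (range e))" by (intro card_insert_disjoint) simp_all
  ultimately show False unfolding card_image[OF inj] by linarith
qed

lemma orthonormal_inner:
  assumes e: "orthonormal_frame B x e" and u: "u \<in> fib x" "v \<in> fib x"
  shows "ip x u v = (\<Sum>i\<in>UNIV. ip x u (e i) * ip x v (e i))"
proof -
  have eE: "e i \<in> fib x" for i using e unfolding orthonormal_frame_def by blast
  have "ip x (\<Sum>i\<in>UNIV. ip x u (e i) *\<^sub>R e i) v
      = (\<Sum>i\<in>UNIV. ip x u (e i) * ip x (e i) v)"
    by (rule inner_sum_left) (use eE u in auto)
  then show ?thesis
    unfolding orthonormal_expansion[OF e u(1), symmetric] by (simp only: inner_sym[OF eE u(2)])
qed

lemma coor_frame_det:
  assumes e: "orthonormal_frame B x e" "ctb_coor B x e = 1" and v: "\<And>i. v i \<in> fib x"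
  shows "ctb_coor B x v = det (\<chi> i j. ip x (v i) (e j))"
proof -
  have "e j \<in> fib x" for j using e unfolding orthonormal_frame_def by blast
  from coor_det[OF this, where E = "\<chi> i j. ip x (v i) (e j)"]
  have "ctb_coor B x (\<lambda>i. \<Sum>j\<in>UNIV. ip x (v i) (e j) *\<^sub>R e j) = det (\<chi> i j. ip x (v i) (e j))"
    using e(2) by simp
  then show ?thesis unfolding orthonormal_expansion[OF e(1) v, symmetric] .
qed

text \<open>Gram-Schmidt on a local frame gives an orthonormal one. Its co-orientation is a smooth
  function with values 1 and -1, and multiplying one vector by it makes the frame positive.\<close>

lemma positive_orthonormal_frame:
  obtains W \<epsilon> where "open W" "p \<in> W" "\<And>i. smooth_section B W (\<epsilon> i)"
    "\<And>x. x \<in> W \<Longrightarrow> orthonormal_frame B x (\<lambda>i. \<epsilon> i x)"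
    "\<And>x. x \<in> W \<Longrightarrow> ctb_coor B x (\<lambda>i. \<epsilon> i x) = 1"
proof -
  obtain W f where f: "(W, f) \<in> ctb_frames B" "p \<in> W" by (rule frame_exists)
  note fD = frameD[OF f(1)]
  have fE: "f i x \<in> fib x" if "x \<in> W" for i x
    using smooth_section_fibre[OF fD(5) that] .
  define G where "G i j x = ip x (f i x) (f j x)" for i j x
  have pos: "(\<Sum>k\<in>UNIV. \<Sum>l\<in>UNIV. d k * d l * G k l x) > 0" if x: "x \<in> W" and d: "\<exists>i\<in>UNIV. d i \<noteq> 0" for x d
  proof -
    define u where "u = (\<Sum>k\<in>UNIV. d k *\<^sub>R f k x)"
    have uE: "u \<in> fib x"
      unfolding u_def by (rule fibre_sum) (simp add: fibre_scale fE[OF x])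
    have "u \<noteq> 0"
    proof
      assume "u = 0"
      \<comment> \<open>Independence is a statement about the set of frame vectors, so the indexed
        coefficients are carried over by the injective enumeration.\<close>
      define r where "r z = d (the_inv (\<lambda>i. f i x) z)" for z
      have r: "r (f i x) = d i" for i
        unfolding r_def by (rule arg_cong[of _ _ d]) (rule the_inv_f_f[OF fD(2)[OF x]])
      have "(\<Sum>z\<in>range (\<lambda>i. f i x). r z *\<^sub>R z) = (\<Sum>k\<in>UNIV. d k *\<^sub>R f k x)"
        unfolding sum.reindex[OF fD(2)[OF x]] o_def r ..
      then have "(\<Sum>z\<in>range (\<lambda>i. f i x). r z *\<^sub>R z) = 0"
        using \<open>u = 0\<close> unfolding u_def by (rule trans)
      then have "\<forall>z\<in>range (\<lambda>i. f i x). r z = 0"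
        using fD(3)[OF x, unfolded independent_explicit_finite_subsets, rule_format, of "range (\<lambda>i. f i x)" r]
        by simp
      then show False using d r by auto
    qed
    have "ip x u u = (\<Sum>k\<in>UNIV. d k * ip x (f k x) u)"
      unfolding u_def by (rule inner_sum_left) (use fE x uE u_def in auto)
    also have "\<dots> = (\<Sum>k\<in>UNIV. \<Sum>l\<in>UNIV. d k * d l * G k l x)"
    proof (rule sum.cong[OF refl])
      fix k
      show "d k * ip x (f k x) u = (\<Sum>l\<in>UNIV. d k * d l * G k l x)"
        unfolding u_def G_def
        by (subst inner_sum_right) (simp_all add: fE x sum_distrib_left mult.assoc)
    qed
    finally show ?thesis using inner_pos[OF uE \<open>u \<noteq> 0\<close>] by simp
  qed
  obtain a :: "'m \<Rightarrow> 'm \<Rightarrow> 'a \<Rightarrow> real" where a: "\<And>i j. smooth_fun A W (a i j)"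
    "\<And>x i j. x \<in> W \<Longrightarrow> (\<Sum>k\<in>UNIV. \<Sum>l\<in>UNIV. a i k x * a j l x * G k l x) = (if i = j then 1 else 0)"
  proof (rule smooth_gram_schmidt[OF finite_class.finite_UNIV fD(1), of G])
    show "smooth_fun A W (G i j)" for i j
      unfolding G_def by (intro inner_smooth fD)
    show "G i j x = G j i x" if "x \<in> W" for i j x
      unfolding G_def using that by (intro inner_sym fE)
    show "(\<Sum>k\<in>UNIV. \<Sum>l\<in>UNIV. d k * d l * G k l x) > 0"
      if "x \<in> W" "\<exists>i\<in>UNIV. d i \<noteq> 0" for x d
      using pos[OF that] .
  next
    fix a :: "'m \<Rightarrow> 'm \<Rightarrow> 'a \<Rightarrow> real" assume "\<And>i j. i \<in> UNIV \<Longrightarrow> smooth_fun A W (a i j)"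
      "\<And>x i j. x \<in> W \<Longrightarrow> i \<in> UNIV \<Longrightarrow> j \<in> UNIV \<Longrightarrow>
        (\<Sum>k\<in>UNIV. \<Sum>l\<in>UNIV. a i k x * a j l x * G k l x) = (if i = j then 1 else 0)"
    then show thesis by (intro that[of a]) simp_all
  qed
  define g where "g i x = (\<Sum>k\<in>UNIV. a i k x *\<^sub>R f k x)" for i x
  have gs: "smooth_section B W (g i)" for i
    unfolding g_def by (intro smooth_section_sum fD a)
  have gE: "g i x \<in> fib x" if "x \<in> W" for i x
    using smooth_section_fibre[OF gs that] .
  have go: "ip x (g i x) (g j x) = (if i = j then 1 else 0)" if x: "x \<in> W" for x i j
  proof -
    have "ip x (g i x) (g j x) = (\<Sum>k\<in>UNIV. a i k x * ip x (f k x) (g j x))"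
      unfolding g_def[of i] by (rule inner_sum_left) (use fE gE x in auto)
    also have "\<dots> = (\<Sum>k\<in>UNIV. \<Sum>l\<in>UNIV. a i k x * a j l x * G k l x)"
      unfolding g_def[of j] G_def
      by (rule sum.cong[OF refl], subst inner_sum_right) (simp_all add: fE x sum_distrib_left mult.assoc)
    finally show ?thesis using a(2)[OF x] by simp
  qed
  have gon: "orthonormal_frame B x (\<lambda>i. g i x)" if "x \<in> W" for x
    unfolding orthonormal_frame_def using go gE that by auto
  define h where "h x = ctb_coor B x (\<lambda>i. g i x)" for x
  have hs: "smooth_fun A W h" unfolding h_def by (intro coor_smooth gs fD)
  have h1: "h x * h x = 1" if "x \<in> W" for x
    using coor_orthonormal[OF gon[OF that]] by (auto simp: h_def)
  define \<epsilon> where "\<epsilon> i x = (if i = last_index then h x *\<^sub>R g i x else g i x)" for i x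
  show thesis
  proof (rule that[OF fD(1) f(2)])
    show "smooth_section B W (\<epsilon> i)" for i
      using smooth_section_scale[OF fD(1) gs hs] gs by (cases "i = last_index") (simp_all add: \<epsilon>_def[abs_def])
    fix x assume x: "x \<in> W"
    show "orthonormal_frame B x (\<lambda>i. \<epsilon> i x)"
      unfolding orthonormal_frame_def
    proof (intro conjI allI)
      show "\<epsilon> i x \<in> fib x" for i
        using gE[OF x] fibre_scale by (simp add: \<epsilon>_def)
      have right: "ip x u (r *\<^sub>R g j x) = r * ip x u (g j x)" if "u \<in> fib x" for u r j
        using that gE[OF x] fibre_scale inner_scale_left inner_sym by metis
      show "ip x (\<epsilon> i x) (\<epsilon> j x) = (if i = j then 1 else 0)" for i j
        using h1[OF x] go[OF x] by (simp add: \<epsilon>_def right inner_scale_left gE[OF x] fibre_scale)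
    qed
    have "(\<lambda>i. \<epsilon> i x) = (\<lambda>i. g i x)(last_index := h x *\<^sub>R g last_index x)"
      by (auto simp: \<epsilon>_def)
    then have "ctb_coor B x (\<lambda>i. \<epsilon> i x) = h x * ctb_coor B x ((\<lambda>i. g i x)(last_index := g last_index x))"
      using coor_scale[OF gE[OF x]] gE[OF x] by simp
    then show "ctb_coor B x (\<lambda>i. \<epsilon> i x) = 1"
      using h1[OF x] fun_upd_triv[of "\<lambda>i. g i x" last_index] by (simp add: h_def)
  qed
qed

end

context oriented_manifold
begin

lemma chart_deriv_sum:
  assumes "open V" "\<And>i. i \<in> I \<Longrightarrow> smooth_fun A V (f i)" "c \<in> A" "x \<in> V" "x \<in> fst c"
  shows "chart_deriv c (\<lambda>y. \<Sum>i\<in>I. f i y) x v = (\<Sum>i\<in>I. chart_deriv c (f i) x v)"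
  using assms(2)
proof (induction I rule: infinite_finite_induct)
  case (insert i I)
  have "smooth_fun A V (\<lambda>y. \<Sum>i\<in>I. f i y)"
    by (rule smooth_fun_sum[OF assms(1)]) (simp add: insert.prems)
  then show ?case
    using insert chart_deriv_add[OF assms(1) _ _ assms(3-5), of "f i" "\<lambda>y. \<Sum>i\<in>I. f i y" v] by simp
qed (simp_all add: chart_deriv_const)

end

section \<open>The matrix of \<open>\<phi>\<close> and its cofactors\<close>

text \<open>The neighbourhood is small enough that d\<lambda> is nonzero along one fixed direction
  at all its points, singular or not. This permits cancelling \<lambda> in smooth identities and
  makes the singular set a regular level set.\<close>

locale framed_chart = coherent_bundle B
  for B :: "('a::t2_space, 'm::{finite,linorder}, 'e::real_vector) ctb" +
  fixes c :: "('a, 'm) chart" and W :: "'a set" and \<epsilon> :: "'m \<Rightarrow> 'a \<Rightarrow> 'e" and k :: 'm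
  assumes c: "c \<in> A" and W: "open W" "W \<subseteq> fst c"
    and \<epsilon>_smooth: "\<And>i. smooth_section B W (\<epsilon> i)"
    and \<epsilon>_frame: "\<And>x. x \<in> W \<Longrightarrow> orthonormal_frame B x (\<lambda>i. \<epsilon> i x)"
    and \<epsilon>_pos: "\<And>x. x \<in> W \<Longrightarrow> ctb_coor B x (\<lambda>i. \<epsilon> i x) = 1"
    and dlam_k: "\<And>x. x \<in> W \<Longrightarrow> chart_deriv c (phi_jacobian B c) x (axis k 1) \<noteq> 0"
begin

abbreviation "lam \<equiv> phi_jacobian B c"
abbreviation "dlam \<equiv> chart_deriv c lam"

definition \<Phi> :: "'m \<Rightarrow> 'a \<Rightarrow> 'e" where "\<Phi> j x = phi x (coord_vec A c j x)"
text \<open>Row \<open>j\<close> holds the components of the image of the j-th coordinate vector in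
  the orthonormal frame, so \<phi> sends coordinates y to the row combination y P.\<close>

definition P :: "'a \<Rightarrow> ((real, 'm) vec, 'm) vec" where "P x = (\<chi> j b. ip x (\<Phi> j x) (\<epsilon> b x))"
text \<open>The i-th numerator in Cramer's rule: a linear form in \<open>u\<close> whose
  coefficients are the i-th row of the cofactor matrix. As a determinant it needs no minors or
  signs.\<close>

definition cof :: "'a \<Rightarrow> 'm \<Rightarrow> (real, 'm) vec \<Rightarrow> real" where "cof x i u = det (\<chi> j. if j = i then u else P x $ j)"
definition sec :: "'a \<Rightarrow> (real, 'm) vec \<Rightarrow> 'e" where "sec x u = (\<Sum>b\<in>UNIV. u $ b *\<^sub>R \<epsilon> b x)"

lemma dom: "x \<in> W \<Longrightarrow> x \<in> fst c" using W by auto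

lemma \<epsilon>_fibre: "x \<in> W \<Longrightarrow> \<epsilon> i x \<in> fib x"
  using smooth_section_fibre[OF \<epsilon>_smooth] .

lemma phi_fibre: "v \<in> tangent_space A x \<Longrightarrow> phi x v \<in> fib x"
  using bh unfolding bundle_hom_def by simp

lemma \<Phi>_fibre: "x \<in> fst c \<Longrightarrow> \<Phi> j x \<in> fib x"
  unfolding \<Phi>_def coord_vec_tvec_of by (intro phi_fibre tvec_of_tangent c)

lemma phi_lin:
  assumes "v \<in> tangent_space A x" "w \<in> tangent_space A x"
  shows "phi x (\<lambda>c. a *\<^sub>R v c + b *\<^sub>R w c) = a *\<^sub>R phi x v + b *\<^sub>R phi x w"
  using bh[unfolded bundle_hom_def, THEN conjunct2, THEN conjunct1, THEN spec[of _ x]] assms by blast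

lemma linear_phi_tvec: "x \<in> fst c \<Longrightarrow> linear (\<lambda>y. phi x (tvec_of A c x y))"
proof -
  assume x: "x \<in> fst c"
  note t = tvec_of_tangent[OF c x]
  show ?thesis
  proof (rule linearI)
    show "phi x (tvec_of A c x (y + z)) = phi x (tvec_of A c x y) + phi x (tvec_of A c x z)" for y z
      using phi_lin[OF t t, of 1 y 1 z] tvec_of_linear[OF c x, of 1 y 1 z] by simp
    show "phi x (tvec_of A c x (r *\<^sub>R y)) = r *\<^sub>R phi x (tvec_of A c x y)" for r y
      using phi_lin[OF t t, of r y 0 y] tvec_of_linear[OF c x, of r y 0 y] by simp
  qed
qed

lemma phi_tvec: "x \<in> fst c \<Longrightarrow> phi x (tvec_of A c x y) = (\<Sum>j\<in>UNIV. y $ j *\<^sub>R \<Phi> j x)"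
  unfolding \<Phi>_def coord_vec_tvec_of by (rule linear_axis_expansion[OF linear_phi_tvec])

lemma \<Phi>_smooth: "smooth_section B W (\<Phi> j)"
proof -
  have "smooth_vf A W (\<lambda>x. tvec_of A c x (axis j 1))"
    by (rule smooth_vf_tvec_of[OF c W]) (rule smooth_fun_const)
  then have "smooth_section B W (\<lambda>x. phi x (tvec_of A c x (axis j 1)))"
    using bh[unfolded bundle_hom_def, THEN conjunct2, THEN conjunct2] W(1) by blast
  then show ?thesis unfolding \<Phi>_def[abs_def] coord_vec_tvec_of .
qed

lemma sec_fibre: "x \<in> W \<Longrightarrow> sec x u \<in> fib x"
  unfolding sec_def by (rule fibre_sum) (simp add: fibre_scale \<epsilon>_fibre)

lemma linear_sec: "linear (sec x)"
  by (rule linearI) (simp_all add: sec_def scaleR_add_left sum.distrib scaleR_sum_right)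

lemma inner_sec_\<epsilon>: "x \<in> W \<Longrightarrow> ip x (sec x u) (\<epsilon> b x) = u $ b"
proof -
  assume x: "x \<in> W"
  have "ip x (sec x u) (\<epsilon> b x) = (\<Sum>a\<in>UNIV. u $ a * ip x (\<epsilon> a x) (\<epsilon> b x))"
    unfolding sec_def by (rule inner_sum_left) (simp_all add: \<epsilon>_fibre x)
  also have "\<dots> = (\<Sum>a\<in>UNIV. if a = b then u $ a else 0)"
    using \<epsilon>_frame[OF x] unfolding orthonormal_frame_def by (intro sum.cong) auto
  finally show ?thesis by simp
qed

lemma inner_sec: "x \<in> W \<Longrightarrow> ip x (sec x u) (sec x v) = u \<bullet> v"
  by (subst orthonormal_inner[OF \<epsilon>_frame]) (simp_all add: sec_fibre inner_sec_\<epsilon> inner_vec_def)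

lemma sec_eq_0: "x \<in> W \<Longrightarrow> sec x u = 0 \<longleftrightarrow> u = 0"
  using inner_sec[of x u u] inner_0_left[OF sec_fibre, of x u] linear_0[OF linear_sec] by auto

lemma fibre_sec: "x \<in> W \<Longrightarrow> u \<in> fib x \<Longrightarrow> u = sec x (\<chi> b. ip x u (\<epsilon> b x))"
  unfolding sec_def using orthonormal_expansion[OF \<epsilon>_frame] by simp

lemma \<Phi>_sec: "x \<in> W \<Longrightarrow> \<Phi> j x = sec x (P x $ j)"
  using fibre_sec[OF _ \<Phi>_fibre[OF dom]] by (simp add: P_def)

lemma phi_sec: "x \<in> W \<Longrightarrow> phi x (tvec_of A c x y) = sec x (\<Sum>j\<in>UNIV. y $ j *\<^sub>R P x $ j)"
  by (simp add: phi_tvec dom \<Phi>_sec linear_sum[OF linear_sec] linear_cmul[OF linear_sec])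

lemma lam_det: "x \<in> W \<Longrightarrow> lam x = det (P x)"
  unfolding phi_jacobian_def P_def \<Phi>_def
  by (rule coor_frame_det[OF \<epsilon>_frame \<epsilon>_pos]) (use \<Phi>_fibre[OF dom] in \<open>simp_all add: \<Phi>_def\<close>)

lemma P_smooth: "smooth_fun A W (\<lambda>x. P x $ i $ j)"
  unfolding P_def by (simp add: inner_smooth[OF W(1) \<Phi>_smooth \<epsilon>_smooth])

lemma lam_smooth: "smooth_fun A W lam"
  by (rule smooth_fun_cong[OF W(1) _ smooth_fun_det[OF W(1) P_smooth]]) (simp add: lam_det)

lemma linear_dlam: "x \<in> W \<Longrightarrow> linear (dlam x)"
  by (rule linear_chart_deriv[OF W(1) lam_smooth c _ dom])

lemma cof_smooth:
  assumes "\<And>b. smooth_fun A W (\<lambda>x. u x $ b)"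
  shows "smooth_fun A W (\<lambda>x. cof x i (u x))"
  unfolding cof_def
proof (rule smooth_fun_det[OF W(1)])
  fix a b show "smooth_fun A W (\<lambda>x. (\<chi> j. if j = i then u x else P x $ j) $ a $ b)"
    by (cases "a = i") (simp_all add: assms P_smooth)
qed

lemma linear_cof: "linear (cof x i)"
proof (rule linearI)
  show "cof x i (u + v) = cof x i u + cof x i v" for u v
    unfolding cof_def by (rule det_row_add)
  show "cof x i (r *\<^sub>R u) = r *\<^sub>R cof x i u" for r u
    unfolding cof_def scalar_mult_eq_scaleR[symmetric] real_scaleR_def by (rule det_row_mul)
qed

lemma cof_row: "x \<in> W \<Longrightarrow> cof x i (P x $ j) = (if i = j then lam x else 0)"
proof -
  assume x: "x \<in> W"
  show ?thesis
  proof (cases "i = j")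
    case True
    then have "(\<chi> l. if l = i then P x $ j else P x $ l) = P x" by (simp add: vec_eq_iff)
    then show ?thesis using True by (simp add: cof_def lam_det[OF x])
  next
    case False
    then show ?thesis unfolding cof_def
      by (simp, intro det_identical_rows[of i j]) (simp_all add: row_def vec_eq_iff)
  qed
qed

text \<open>Off the singular set this is Cramer's rule for the transpose of \<open>P\<close>. Each
  component of the difference of the two sides is annihilated by \<lambda>, hence vanishes on the
  singular set too because d\<lambda> is nonzero.\<close>

lemma cramer_row:
  assumes "x \<in> W"
  shows "(\<Sum>i\<in>UNIV. cof x i u *\<^sub>R P x $ i) = lam x *\<^sub>R u"
proof -
  define f where "f b y = (\<Sum>i\<in>UNIV. cof y i u * P y $ i $ b) - lam y * u $ b" for b y
  have "f b x = 0" for b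
  proof (rule mult_eq_0_imp_eq_0[OF W(1) lam_smooth _ c assms dom[OF assms] _ dlam_k[OF assms]])
    show "smooth_fun A W (f b)"
      unfolding f_def
      by (intro smooth_fun_diff smooth_fun_sum smooth_fun_mult lam_smooth P_smooth cof_smooth smooth_fun_const W)
    fix y assume y: "y \<in> W"
    show "lam y * f b y = 0"
    proof (cases "lam y = 0")
      case False
      let ?T = "transpose (P y)"
      let ?z = "\<chi> l. det (\<chi> i j. if j = l then u $ i else ?T $ i $ j) / det ?T"
      have "?T *v ?z = u"
        using cramer[of ?T ?z u] False by (simp add: det_transpose lam_det[OF y])
      moreover have "det (\<chi> i j. if j = l then u $ i else ?T $ i $ j) = cof y l u" for l
      proof -
        have "(\<chi> i j. if j = l then u $ i else ?T $ i $ j) = transpose (\<chi> j. if j = l then u else P y $ j)"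
          by (simp add: vec_eq_iff transpose_def)
        then show ?thesis by (simp only: cof_def det_transpose)
      qed
      moreover have "det ?T = lam y" by (simp only: det_transpose lam_det[OF y])
      ultimately have "?T *v (\<chi> l. cof y l u / lam y) = u" by (simp only:)
      from arg_cong[OF this, of "\<lambda>v. v $ b"]
      have "(\<Sum>l\<in>UNIV. P y $ l $ b * (cof y l u / lam y)) = u $ b"
        by (simp add: matrix_vector_mult_def transpose_def)
      then have "(\<Sum>l\<in>UNIV. cof y l u * P y $ l $ b) / lam y = u $ b"
        by (simp add: sum_divide_distrib mult.commute)
      then show ?thesis using False by (simp add: f_def field_simps)
    qed simp
  qed
  then show ?thesis by (simp add: f_def vec_eq_iff)
qed

text \<open>Where \<lambda> is nonzero the cofactors give an explicit inverse of \<phi>. Conversely,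
  preimages of the frame vectors are the rows of a left inverse of \<open>P\<close>.\<close>

lemma singular_iff:
  assumes x: "x \<in> W"
  shows "x \<in> singular_set B \<longleftrightarrow> lam x = 0"
proof -
  have tv: "v \<in> tangent_space A x \<Longrightarrow> phi x v = sec x (\<Sum>j\<in>UNIV. v c $ j *\<^sub>R P x $ j)" for v
    using phi_sec[OF x, of "v c"] tvec_of_eq[OF c dom[OF x]] by simp
  have "bij_betw (phi x) (tangent_space A x) (fib x)" if l: "lam x \<noteq> 0"
    unfolding bij_betw_def
  proof
    show "inj_on (phi x) (tangent_space A x)"
    proof (rule inj_onI)
      fix v w assume v: "v \<in> tangent_space A x" and w: "w \<in> tangent_space A x" and "phi x v = phi x w"
      then have "sec x (\<Sum>j\<in>UNIV. (v c - w c) $ j *\<^sub>R P x $ j) = 0"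
        by (simp add: tv scaleR_diff_left sum_subtractf linear_diff[OF linear_sec])
      then have 0: "(\<Sum>j\<in>UNIV. (v c - w c) $ j *\<^sub>R P x $ j) = 0" by (simp only: sec_eq_0[OF x])
      have "(v c - w c) $ i * lam x = 0" for i
      proof -
        have "cof x i (\<Sum>j\<in>UNIV. (v c - w c) $ j *\<^sub>R P x $ j) = (\<Sum>j\<in>UNIV. if i = j then (v c - w c) $ j * lam x else 0)"
          unfolding linear_sum[OF linear_cof]
          by (intro sum.cong) (auto simp: linear_cmul[OF linear_cof] cof_row[OF x])
        then show ?thesis unfolding 0 linear_0[OF linear_cof] by simp
      qed
      then have "v c = w c" using l by (simp add: vec_eq_iff)
      then show "v = w" using tvec_of_eq[OF c dom[OF x]] v w by metis
    qed
    show "phi x ` tangent_space A x = fib x"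
    proof (intro equalityI subsetI)
      fix u assume "u \<in> fib x"
      then obtain u' where u': "u = sec x u'" using fibre_sec[OF x] by blast
      let ?y = "\<chi> i. cof x i u' / lam x"
      have "(\<Sum>j\<in>UNIV. ?y $ j *\<^sub>R P x $ j) = (1 / lam x) *\<^sub>R (\<Sum>i\<in>UNIV. cof x i u' *\<^sub>R P x $ i)"
        by (simp add: scaleR_sum_right)
      also have "\<dots> = u'" using l by (simp add: cramer_row[OF x])
      finally have "phi x (tvec_of A c x ?y) = u" using phi_sec[OF x] u' by simp
      then show "u \<in> phi x ` tangent_space A x"
        using tvec_of_tangent[OF c dom[OF x]] by blast
    qed (auto simp: phi_fibre)
  qed
  moreover have "lam x \<noteq> 0" if b: "bij_betw (phi x) (tangent_space A x) (fib x)"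
  proof -
    have "\<exists>z. (\<Sum>j\<in>UNIV. z $ j *\<^sub>R P x $ j) = u" for u
    proof -
      obtain v where "v \<in> tangent_space A x" "phi x v = sec x u"
        using b sec_fibre[OF x, of u] unfolding bij_betw_def by (metis imageE)
      then have "sec x ((\<Sum>j\<in>UNIV. v c $ j *\<^sub>R P x $ j) - u) = 0"
        using tv linear_diff[OF linear_sec] by simp
      then show ?thesis by (auto simp: sec_eq_0[OF x])
    qed
    then obtain Z where Z: "\<And>u. (\<Sum>j\<in>UNIV. Z u $ j *\<^sub>R P x $ j) = u" by metis
    have "(\<chi> a. Z (axis a 1)) ** P x = mat 1"
      using Z[of "axis _ 1"] by (simp add: matrix_matrix_mult_def vec_eq_iff mat_def axis_def)
    then have "det (\<chi> a. Z (axis a 1)) * det (P x) = 1" by (metis det_I det_mul)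
    then show ?thesis using lam_det[OF x] by auto
  qed
  ultimately show ?thesis unfolding singular_set_def by blast
qed

text \<open>The rank of \<phi> drops by one only. If all cofactors vanished at x, the derivative of
  Cramer's identity along the direction k would write every u as a combination of the rows of the
  singular matrix \<open>P x\<close>.\<close>

lemma cof_nonzero:
  assumes x: "x \<in> W" "lam x = 0"
  obtains i u where "cof x i u \<noteq> 0"
proof (rule ccontr)
  assume "\<not> thesis"
  then have 0: "cof x i u = 0" for i u using that by blast
  let ?e = "axis k 1"
  \<comment> \<open>The coefficients left by that derivative: terms with an undifferentiated
    cofactor disappear, and division by d\<lambda> normalizes the right-hand side to u.\<close>
  define Z where "Z u i = chart_deriv c (\<lambda>y. cof y i u) x ?e / dlam x ?e" for u i
  have "(\<Sum>i\<in>UNIV. Z u i * P x $ i $ b) = u $ b" for u b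
  proof -
    have sm: "smooth_fun A W (\<lambda>y. cof y i u)" for i
      by (intro cof_smooth smooth_fun_const)
    have "chart_deriv c (\<lambda>y. \<Sum>i\<in>UNIV. cof y i u * P y $ i $ b) x ?e = chart_deriv c (\<lambda>y. lam y * u $ b) x ?e"
    proof -
      have "(\<Sum>i\<in>UNIV. cof y i u * P y $ i $ b) = lam y * u $ b" if "y \<in> W" for y
        using arg_cong[OF cramer_row[OF that, of u], of "\<lambda>v. v $ b"] by simp
      from chart_deriv_cong[OF W(1) c x(1) dom[OF x(1)] this] show ?thesis by simp
    qed
    also have "chart_deriv c (\<lambda>y. lam y * u $ b) x ?e = dlam x ?e * u $ b"
      by (simp add: chart_deriv_mult[OF W(1) lam_smooth smooth_fun_const c x(1) dom[OF x(1)]] chart_deriv_const)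
    also have "chart_deriv c (\<lambda>y. \<Sum>i\<in>UNIV. cof y i u * P y $ i $ b) x ?e
       = (\<Sum>i\<in>UNIV. chart_deriv c (\<lambda>y. cof y i u * P y $ i $ b) x ?e)"
      by (rule chart_deriv_sum[OF W(1) _ c x(1) dom[OF x(1)]]) (intro smooth_fun_mult W sm P_smooth)
    also have "\<dots> = (\<Sum>i\<in>UNIV. chart_deriv c (\<lambda>y. cof y i u) x ?e * P x $ i $ b)"
      by (simp add: chart_deriv_mult[OF W(1) sm P_smooth c x(1) dom[OF x(1)]] 0)
    finally have "(\<Sum>i\<in>UNIV. chart_deriv c (\<lambda>y. cof y i u) x ?e * P x $ i $ b) / dlam x ?e = u $ b"
      using dlam_k[OF x(1)] by simp
    then show ?thesis by (simp add: Z_def sum_divide_distrib)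
  qed
  then have "(\<chi> a i. Z (axis a 1) i) ** P x = mat 1"
    by (simp add: matrix_matrix_mult_def vec_eq_iff mat_def axis_def)
  then have "det (\<chi> a i. Z (axis a 1) i) * det (P x) = 1" by (metis det_I det_mul)
  then show False using x lam_det by auto
qed

text \<open>Tangent vectors defined by curves are exactly the kernel of d\<lambda>: one inclusion is
  the chain rule, the other the existence of level curves.\<close>

lemma singular_tangent_space_eq:
  assumes x: "x \<in> W" "lam x = 0"
  shows "singular_tangent_space B x = {tvec_of A c x y | y. dlam x y = 0}"
proof (intro equalityI subsetI)
  fix v assume "v \<in> singular_tangent_space B x"
  then obtain \<alpha> where \<alpha>: "v = velocity A {-1<..<1} \<alpha> 0" "smooth_curve A {-1<..<1} \<alpha>"
    "\<alpha> ` {-1<..<1} \<subseteq> singular_set B" "\<alpha> 0 = x"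
    unfolding singular_tangent_space_def by blast
  have v: "v \<in> tangent_space A x"
    using velocity_tangent[OF \<alpha>(2), of 0] \<alpha> by simp
  have "dlam (\<alpha> 0) (velocity A {-1<..<1} \<alpha> 0 c) = 0"
  proof (rule chart_deriv_velocity_eq_0[OF \<alpha>(2) _ _ c _ W(1) lam_smooth])
    show "lam (\<alpha> s) = 0" if "s \<in> {-1<..<1}" "\<alpha> s \<in> W" for s
      using that \<alpha>(3) singular_iff by blast
  qed (use x \<alpha>(4) dom in auto)
  then have "dlam x (v c) = 0" using \<alpha> by simp
  then show "v \<in> {tvec_of A c x y | y. dlam x y = 0}"
    using tvec_of_eq[OF c dom[OF x(1)] v] by force
next
  fix v assume "v \<in> {tvec_of A c x y | y. dlam x y = 0}"
  then obtain y where y: "v = tvec_of A c x y" "dlam x y = 0" by blast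
  show "v \<in> singular_tangent_space B x"
  proof (rule level_curve[OF c W lam_smooth x dlam_k[OF x(1)] y(2)])
    fix \<alpha> assume \<alpha>: "smooth_curve A {-1<..<1} \<alpha>" "\<And>s. \<alpha> s \<in> W" "\<And>s. lam (\<alpha> s) = 0" "\<alpha> 0 = x"
      "velocity A {-1<..<1} \<alpha> 0 = tvec_of A c x y"
    have "\<alpha> ` {-1<..<1} \<subseteq> singular_set B" using singular_iff[OF \<alpha>(2)] \<alpha>(3) by auto
    then show ?thesis
      unfolding singular_tangent_space_def using \<alpha>(1,4,5) y(1) by (intro CollectI exI[of _ \<alpha>]) simp
  qed
qed

lemma nondegenerateI:
  assumes x: "x \<in> W" "lam x = 0"
  shows "nondegenerate B x"
  unfolding nondegenerate_def
proof (intro conjI bexI[OF _ c])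
  show "x \<in> singular_set B" using singular_iff x by blast
  show "\<exists>v\<in>tangent_space A x. dfun c lam x v \<noteq> 0"
    using dlam_k[OF x(1)] tvec_of_tangent[OF c dom[OF x(1)]] tvec_of_chart[OF c dom[OF x(1)]]
    unfolding dfun_chart_deriv by metis
qed (rule dom[OF x(1)])

end

section \<open>The unit normal and the null vector field\<close>

text \<open>One cofactor row is nonzero throughout the neighbourhood, so it can be normalized there
  smoothly.\<close>

locale normal_chart = framed_chart B c W \<epsilon> k
  for B :: "('a::t2_space, 'm::{finite,linorder}, 'e::real_vector) ctb" and c W \<epsilon> k +
  fixes i0 :: 'm
  assumes cof_i0: "\<And>x. x \<in> W \<Longrightarrow> \<exists>a. cof x i0 (axis a 1) \<noteq> 0"
begin

text \<open>The cofactor row \<open>i0\<close>. It is orthogonal to every row of \<open>P\<close>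
  except row \<open>i0\<close>, with which its product is \<lambda>; on the singular set it is
  therefore normal to the image of \<phi>.\<close>

definition rr :: "'a \<Rightarrow> (real, 'm) vec" where "rr x = (\<chi> a. cof x i0 (axis a 1))"
definition nrm :: "'a \<Rightarrow> real" where "nrm x = sqrt (rr x \<bullet> rr x)"
definition \<nu> :: "'a \<Rightarrow> (real, 'm) vec" where "\<nu> x = inverse (nrm x) *\<^sub>R rr x"
text \<open>Chart coordinates of \<eta>: all cofactor rows applied to the unit normal. Cramer's rule
  gives \<phi>(\<eta>) = \<lambda> n, and the component \<open>i0\<close> equals \<open>nrm\<close>,
  so the field vanishes nowhere on \<open>W\<close>.\<close>

definition etac :: "'a \<Rightarrow> (real, 'm) vec" where "etac x = (\<chi> i. cof x i (\<nu> x))"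
definition \<eta> :: "'a \<Rightarrow> ('a, 'm) tvec" where "\<eta> x = tvec_of A c x (etac x)"
definition nn :: "'a \<Rightarrow> 'e" where "nn x = sec x (\<nu> x)"

lemma cof_rr: "cof x i0 u = rr x \<bullet> u"
  using linear_axis_expansion[OF linear_cof, of x i0 u] by (simp add: rr_def inner_vec_def mult.commute)

lemma rr_pos: "x \<in> W \<Longrightarrow> rr x \<bullet> rr x > 0"
  using cof_i0[of x] by (auto simp: rr_def vec_eq_iff)

lemma nrm_pos: "x \<in> W \<Longrightarrow> nrm x > 0"
  using rr_pos by (simp add: nrm_def)

lemma nrm_sq: "nrm x * nrm x = rr x \<bullet> rr x"
  by (simp add: nrm_def)

lemma \<nu>_unit: "x \<in> W \<Longrightarrow> \<nu> x \<bullet> \<nu> x = 1"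
  using nrm_pos[of x] by (simp add: \<nu>_def nrm_sq[symmetric] field_simps)

lemma \<nu>_row: "x \<in> W \<Longrightarrow> \<nu> x \<bullet> P x $ j = inverse (nrm x) * (if i0 = j then lam x else 0)"
  by (simp add: \<nu>_def cof_rr[symmetric] cof_row)

lemma etac_i0: "x \<in> W \<Longrightarrow> etac x $ i0 = nrm x"
  using nrm_pos[of x] by (simp add: etac_def cof_rr \<nu>_def nrm_sq[symmetric])

lemma etac_row: "x \<in> W \<Longrightarrow> (\<Sum>j\<in>UNIV. etac x $ j *\<^sub>R P x $ j) = lam x *\<^sub>R \<nu> x"
  by (simp add: etac_def cramer_row)

lemma phi_\<eta>: "x \<in> W \<Longrightarrow> phi x (\<eta> x) = lam x *\<^sub>R nn x"
  by (simp add: \<eta>_def phi_sec etac_row nn_def linear_cmul[OF linear_sec])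

lemma nn_fibre: "x \<in> W \<Longrightarrow> nn x \<in> fib x"
  unfolding nn_def by (rule sec_fibre)

lemma nn_unit: "x \<in> W \<Longrightarrow> ip x (nn x) (nn x) = 1"
  by (simp add: nn_def inner_sec \<nu>_unit)

lemma nn_\<Phi>: "x \<in> W \<Longrightarrow> ip x (nn x) (\<Phi> j x) = inverse (nrm x) * (if i0 = j then 1 else 0) * lam x"
  by (simp add: nn_def \<Phi>_sec inner_sec \<nu>_row)

lemma rr_smooth: "smooth_fun A W (\<lambda>x. rr x $ a)"
  unfolding rr_def by (simp add: cof_smooth smooth_fun_const)

lemma nrm_smooth: "smooth_fun A W nrm"
proof -
  have "smooth_fun A W (\<lambda>x. sqrt (\<Sum>a\<in>UNIV. rr x $ a * rr x $ a))"
    by (intro smooth_fun_sqrt smooth_fun_sum smooth_fun_mult rr_smooth W) (use rr_pos in \<open>simp add: inner_vec_def\<close>)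
  then show ?thesis by (simp add: nrm_def[abs_def] inner_vec_def)
qed

lemma inverse_nrm_smooth: "smooth_fun A W (\<lambda>x. inverse (nrm x))"
  by (intro smooth_fun_inverse nrm_smooth W) (rule less_imp_neq[OF nrm_pos, symmetric])

lemma \<nu>_smooth: "smooth_fun A W (\<lambda>x. \<nu> x $ a)"
  unfolding \<nu>_def using smooth_fun_mult[OF W(1) inverse_nrm_smooth rr_smooth] by simp

lemma etac_smooth: "smooth_fun A W (\<lambda>x. etac x $ i)"
  unfolding etac_def using cof_smooth[OF \<nu>_smooth] by simp

lemma \<eta>_smooth: "smooth_vf A W \<eta>"
  unfolding \<eta>_def[abs_def] by (rule smooth_vf_tvec_of[OF c W etac_smooth])

lemma nn_smooth: "smooth_section B W nn"
  unfolding nn_def[abs_def] sec_def by (intro smooth_section_sum W \<nu>_smooth \<epsilon>_smooth)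

text \<open>After subtracting the multiple of \<open>etac\<close> that removes the component
  \<open>i0\<close>, the relation involves only the other rows of \<open>P\<close>. These are
  independent, as together with the normal they form an invertible matrix.\<close>

lemma kernel:
  assumes x: "x \<in> W" "lam x = 0" and y: "(\<Sum>j\<in>UNIV. y $ j *\<^sub>R P x $ j) = 0"
  shows "y = (y $ i0 / nrm x) *\<^sub>R etac x"
proof -
  define w where "w = y - (y $ i0 / nrm x) *\<^sub>R etac x"
  \<comment> \<open>Row \<open>i0\<close> of \<open>P\<close> is replaced by the unit normal. The
    determinant is then \<open>cof x i0\<close> at that normal, that is \<open>nrm x\<close>, which
    is positive.\<close>
  define M where "M = (\<chi> j. if j = i0 then \<nu> x else P x $ j)"
  have w0: "w $ i0 = 0" using nrm_pos[OF x(1)] by (simp add: w_def etac_i0[OF x(1)])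
  have "(\<Sum>j\<in>UNIV. w $ j *\<^sub>R P x $ j) = (\<Sum>j\<in>UNIV. y $ j *\<^sub>R P x $ j)
      - (y $ i0 / nrm x) *\<^sub>R (\<Sum>j\<in>UNIV. etac x $ j *\<^sub>R P x $ j)"
    by (simp add: w_def scaleR_diff_left sum_subtractf scaleR_sum_right)
  then have wP: "(\<Sum>j\<in>UNIV. w $ j *\<^sub>R P x $ j) = 0" by (simp add: y etac_row[OF x(1)] x(2))
  have "(\<Sum>j\<in>UNIV. w $ j *s row j M) = (\<Sum>j\<in>UNIV. w $ j *\<^sub>R P x $ j)"
    unfolding scalar_mult_eq_scaleR
    by (rule sum.cong[OF refl]) (auto simp: M_def row_def w0 vec_eq_iff)
  then have wM: "(\<Sum>j\<in>UNIV. w $ j *s row j M) = 0" using wP by simp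
  have detM: "det M = nrm x"
    using etac_i0[OF x(1)] by (simp add: M_def etac_def cof_def)
  have "w $ l = 0" for l
  proof -
    have "w $ l * det M = det (\<chi> i. if i = l then (\<Sum>j\<in>UNIV. w $ j *s row j M) else row i M)"
      by (rule cramer_lemma_transpose[symmetric])
    also have "\<dots> = 0"
      unfolding wM by (rule det_zero_row(1)[of l]) (simp add: row_def vec_eq_iff)
    finally show ?thesis unfolding detM using nrm_pos[OF x(1)] by simp
  qed
  then have "w = 0" by (simp add: vec_eq_iff)
  then show ?thesis unfolding w_def by (rule eq_iff_diff_eq_0[THEN iffD2])
qed

lemma kernel_phi:
  assumes x: "x \<in> W" "lam x = 0"
  shows "phi x (tvec_of A c x y) = 0 \<longleftrightarrow> (\<exists>r. y = r *\<^sub>R etac x)"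
proof
  assume "phi x (tvec_of A c x y) = 0"
  then show "\<exists>r. y = r *\<^sub>R etac x"
    using kernel[OF x] by (auto simp: phi_sec[OF x(1)] sec_eq_0[OF x(1)])
next
  assume "\<exists>r. y = r *\<^sub>R etac x"
  then obtain r where r: "y = r *\<^sub>R etac x" ..
  have "(\<Sum>j\<in>UNIV. y $ j *\<^sub>R P x $ j) = r *\<^sub>R (\<Sum>j\<in>UNIV. etac x $ j *\<^sub>R P x $ j)"
    by (simp add: r scaleR_sum_right)
  then show "phi x (tvec_of A c x y) = 0"
    by (simp add: phi_sec[OF x(1)] sec_eq_0[OF x(1)] etac_row[OF x(1)] x(2))
qed

lemma etac_nonzero: "x \<in> W \<Longrightarrow> etac x \<noteq> 0"
  using etac_i0[of x] nrm_pos[of x] by auto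

lemma tvec_of_scale: "x \<in> W \<Longrightarrow> tvec_of A c x (r *\<^sub>R y) = (\<lambda>c'. r *\<^sub>R tvec_of A c x y c')"
  using tvec_of_linear[OF c dom, of x r y 0 y] by simp

lemma null_\<eta>:
  assumes "U \<subseteq> W"
  shows "null_vector_field B (U \<inter> singular_set B) \<eta>"
  unfolding null_vector_field_def
proof (intro conjI ballI)
  show "smooth_vf_along A (U \<inter> singular_set B) \<eta>"
    unfolding smooth_vf_along_def
    by (intro ballI exI[of _ W] exI[of _ \<eta>]) (use assms W \<eta>_smooth in auto)
  fix x assume "x \<in> U \<inter> singular_set B"
  then have x: "x \<in> W" "lam x = 0" using assms singular_iff by auto
  show "\<eta> x \<noteq> (\<lambda>_. 0)"
  proof
    assume "\<eta> x = (\<lambda>_. 0)"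
    then have "\<eta> x c = 0" by simp
    then show False using etac_nonzero[OF x(1)] by (simp add: \<eta>_def tvec_of_chart[OF c dom[OF x(1)]])
  qed
  show "{v \<in> tangent_space A x. phi x v = 0} = range (\<lambda>a c. a *\<^sub>R \<eta> x c)"
  proof (intro equalityI subsetI)
    fix v assume "v \<in> {v \<in> tangent_space A x. phi x v = 0}"
    then have v: "v \<in> tangent_space A x" "phi x v = 0" by auto
    have tv: "tvec_of A c x (v c) = v" by (rule tvec_of_eq[OF c dom[OF x(1)] v(1)])
    then obtain r where "v c = r *\<^sub>R etac x"
      using kernel_phi[OF x, of "v c"] v(2) by auto
    then have "v = (\<lambda>c'. r *\<^sub>R \<eta> x c')"
      using tv tvec_of_scale[OF x(1), of r "etac x"] by (simp add: \<eta>_def)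
    then show "v \<in> range (\<lambda>a c. a *\<^sub>R \<eta> x c)" by blast
  next
    fix v assume "v \<in> range (\<lambda>a c. a *\<^sub>R \<eta> x c)"
    then obtain r where "v = tvec_of A c x (r *\<^sub>R etac x)"
      by (auto simp: tvec_of_scale[OF x(1)] \<eta>_def)
    then show "v \<in> {v \<in> tangent_space A x. phi x v = 0}"
      using kernel_phi[OF x] tvec_of_tangent[OF c dom[OF x(1)]] by blast
  qed
qed

text \<open>Any null vector field is proportional to \<open>etac\<close> on the singular set, and
  the tangent space is the kernel of d\<lambda>, so transversality means that d\<lambda> does not
  annihilate \<open>etac\<close>. Otherwise the tangent and null directions together would miss the
  direction k.\<close>

lemma A2_iff:
  assumes x: "x \<in> W" "lam x = 0"
  shows "A2_point B x \<longleftrightarrow> dlam x (etac x) \<noteq> 0"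
proof
  have lin: "linear (dlam x)" by (rule linear_dlam[OF x(1)])
  note T = singular_tangent_space_eq[OF x]
  {
    assume "A2_point B x"
    then obtain W' \<eta>' where n: "x \<in> W'" "null_vector_field B (W' \<inter> singular_set B) \<eta>'"
      and sp: "\<forall>v\<in>tangent_space A x. \<exists>w\<in>singular_tangent_space B x. \<exists>a. v = (\<lambda>c. w c + a *\<^sub>R \<eta>' x c)"
      unfolding A2_point_def by blast
    have xs: "x \<in> W' \<inter> singular_set B" using n(1) singular_iff x by blast
    have "{v \<in> tangent_space A x. phi x v = 0} = range (\<lambda>a c. a *\<^sub>R \<eta>' x c)"
      using n(2) xs unfolding null_vector_field_def by blast
    \<comment> \<open>The scalar 1 shows that the given null vector itself lies in the
      kernel.\<close>
    moreover have "(\<lambda>c. 1 *\<^sub>R \<eta>' x c) \<in> range (\<lambda>a c. a *\<^sub>R \<eta>' x c)" by (rule rangeI)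
    ultimately have \<eta>': "\<eta>' x \<in> tangent_space A x" "phi x (\<eta>' x) = 0" by auto
    have "tvec_of A c x (\<eta>' x c) = \<eta>' x" by (rule tvec_of_eq[OF c dom[OF x(1)] \<eta>'(1)])
    then obtain r where r: "\<eta>' x c = r *\<^sub>R etac x" using kernel_phi[OF x, of "\<eta>' x c"] \<eta>'(2) by auto
    show "dlam x (etac x) \<noteq> 0"
    proof
      assume 0: "dlam x (etac x) = 0"
      have "tvec_of A c x (axis k 1) \<in> tangent_space A x" by (rule tvec_of_tangent[OF c dom[OF x(1)]])
      then obtain w a where w: "w \<in> singular_tangent_space B x"
        "tvec_of A c x (axis k 1) = (\<lambda>c. w c + a *\<^sub>R \<eta>' x c)" using sp by blast
      obtain y where y: "w = tvec_of A c x y" "dlam x y = 0" using w(1) unfolding T by blast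
      have "axis k 1 = y + a *\<^sub>R r *\<^sub>R etac x"
        using fun_cong[OF w(2), of c] by (simp add: y(1) r tvec_of_chart[OF c dom[OF x(1)]])
      then have "dlam x (axis k 1) = 0"
        by (simp add: linear_add[OF lin] linear_cmul[OF lin] y(2) 0)
      then show False using dlam_k[OF x(1)] by simp
    qed
  }
  assume ne: "dlam x (etac x) \<noteq> 0"
  have "\<exists>w\<in>singular_tangent_space B x. \<exists>a. v = (\<lambda>c. w c + a *\<^sub>R \<eta> x c)" if v: "v \<in> tangent_space A x" for v
  proof -
    define a where "a = dlam x (v c) / dlam x (etac x)"
    define y where "y = v c - a *\<^sub>R etac x"
    have "dlam x y = 0" using ne by (simp add: y_def a_def linear_diff[OF lin] linear_cmul[OF lin])
    then have "tvec_of A c x y \<in> singular_tangent_space B x" unfolding T by blast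
    moreover have "v = (\<lambda>c'. tvec_of A c x y c' + a *\<^sub>R \<eta> x c')"
      using tvec_of_linear[OF c dom[OF x(1)], of 1 y a "etac x"] tvec_of_eq[OF c dom[OF x(1)] v]
      by (simp add: y_def \<eta>_def)
    ultimately show ?thesis by blast
  qed
  then show "A2_point B x"
    unfolding A2_point_def using nondegenerateI[OF x] W(1) x(1) null_\<eta>[of W] by blast
qed

section \<open>The second fundamental form along the singular set\<close>

lemmas conn_D = conn[unfolded connection_def]

lemma D_fibre:
  assumes "smooth_section B W s" "x \<in> W"
  shows "ctb_conn B x (tvec_of A c x y) s \<in> fib x"
  using conn_D[THEN conjunct1, THEN spec[of _ W], THEN spec[of _ s], THEN spec[of _ x]] assms W(1)
    tvec_of_tangent[OF c dom[OF assms(2)]] by blast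

lemma linear_D:
  assumes "smooth_section B W s" "x \<in> W"
  shows "linear (\<lambda>y. ctb_conn B x (tvec_of A c x y) s)"
proof -
  have L: "ctb_conn B x (\<lambda>c'. a *\<^sub>R tvec_of A c x y c' + b *\<^sub>R tvec_of A c x z c') s
           = a *\<^sub>R ctb_conn B x (tvec_of A c x y) s + b *\<^sub>R ctb_conn B x (tvec_of A c x z) s" for a b y z
    using conn_D[THEN conjunct2, THEN conjunct1, THEN spec[of _ W], THEN spec[of _ s], THEN spec[of _ x],
        THEN spec[of _ a], THEN spec[of _ b]] assms W(1)
      tvec_of_tangent[OF c dom[OF assms(2)]] by blast
  show ?thesis
  proof (rule linearI)
    show "ctb_conn B x (tvec_of A c x (y + z)) s = ctb_conn B x (tvec_of A c x y) s + ctb_conn B x (tvec_of A c x z) s" for y z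
      using L[of 1 y 1 z] tvec_of_linear[OF c dom[OF assms(2)], of 1 y 1 z] by simp
    show "ctb_conn B x (tvec_of A c x (r *\<^sub>R y)) s = r *\<^sub>R ctb_conn B x (tvec_of A c x y) s" for r y
      using L[of r y 0 y] tvec_of_linear[OF c dom[OF assms(2)], of r y 0 y] by simp
  qed
qed

lemma D_cong:
  assumes "smooth_section B W s" "smooth_section B W t" "\<And>y. y \<in> W \<Longrightarrow> s y = t y" "x \<in> W"
  shows "ctb_conn B x (tvec_of A c x y) s = ctb_conn B x (tvec_of A c x y) t"
  using conn_D[THEN conjunct2, THEN conjunct2, THEN conjunct1, THEN spec[of _ W], THEN spec[of _ s],
      THEN spec[of _ t], THEN spec[of _ x]] assms W(1) tvec_of_tangent[OF c dom[OF assms(4)]] by blast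

lemma D_add:
  assumes "smooth_section B W s" "smooth_section B W t" "x \<in> W"
  shows "ctb_conn B x (tvec_of A c x y) (\<lambda>z. s z + t z)
    = ctb_conn B x (tvec_of A c x y) s + ctb_conn B x (tvec_of A c x y) t"
  using conn_D[THEN conjunct2, THEN conjunct2, THEN conjunct2, THEN conjunct1, THEN spec[of _ W],
      THEN spec[of _ s], THEN spec[of _ t], THEN spec[of _ x]] assms W(1)
    tvec_of_tangent[OF c dom[OF assms(3)]] by blast

lemma D_scale:
  assumes "smooth_fun A W f" "smooth_section B W s" "x \<in> W"
  shows "ctb_conn B x (tvec_of A c x y) (\<lambda>z. f z *\<^sub>R s z)
    = chart_deriv c f x y *\<^sub>R s x + f x *\<^sub>R ctb_conn B x (tvec_of A c x y) s"
  using conn_D[THEN conjunct2, THEN conjunct2, THEN conjunct2, THEN conjunct2, THEN conjunct1,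
      THEN spec[of _ W], THEN spec[of _ f], THEN spec[of _ s], THEN spec[of _ x]] assms W(1) c
    tvec_of_tangent[OF c dom[OF assms(3)]] dom[OF assms(3)]
  by (simp add: dfun_chart_deriv tvec_of_chart[OF c dom[OF assms(3)]])

lemma D_sum:
  assumes "\<And>i. i \<in> I \<Longrightarrow> smooth_fun A W (f i)" "\<And>i. i \<in> I \<Longrightarrow> smooth_section B W (s i)" "x \<in> W" "finite I"
  shows "ctb_conn B x (tvec_of A c x y) (\<lambda>z. \<Sum>i\<in>I. f i z *\<^sub>R s i z)
    = (\<Sum>i\<in>I. chart_deriv c (f i) x y *\<^sub>R s i x + f i x *\<^sub>R ctb_conn B x (tvec_of A c x y) (s i))"
  using assms(4,1,2)
proof (induction I)
  case empty
  \<comment> \<open>The derivative of the zero section is obtained from the Leibniz rule with the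
    zero function as coefficient.\<close>
  show ?case
    using D_scale[where f = "\<lambda>_. 0" and y = y, OF smooth_fun_const \<epsilon>_smooth assms(3)] by (simp add: chart_deriv_const)
next
  case (insert i I)
  have "smooth_section B W (\<lambda>z. f i z *\<^sub>R s i z)"
    by (rule smooth_section_scale[OF W(1)]) (simp_all add: insert.prems)
  moreover have "smooth_section B W (\<lambda>z. \<Sum>i\<in>I. f i z *\<^sub>R s i z)"
    by (rule smooth_section_sum[OF W(1)]) (simp_all add: insert.prems)
  ultimately show ?case
    using insert by (simp add: D_add[OF _ _ assms(3)] D_scale[OF _ _ assms(3)])
qed

lemma D_metric:
  assumes "smooth_section B W s" "smooth_section B W t" "x \<in> W"
  shows "chart_deriv c (\<lambda>y. ip y (s y) (t y)) x y
    = ip x (ctb_conn B x (tvec_of A c x y) s) (t x)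
      + ip x (s x) (ctb_conn B x (tvec_of A c x y) t)"
proof -
  have *: "\<forall>v\<in>tangent_space A x. \<forall>c\<in>A. x \<in> fst c \<longrightarrow>
      dfun c (\<lambda>y. ip y (s y) (t y)) x v
        = ip x (ctb_conn B x v s) (t x) + ip x (s x) (ctb_conn B x v t)"
    using mc[unfolded metric_connection_def, THEN conjunct2, THEN spec[of _ W], THEN spec[of _ s],
      THEN spec[of _ t], THEN spec[of _ x]] assms W(1) by blast
  from bspec[OF bspec[OF * tvec_of_tangent[OF c dom[OF assms(3)], of y]] c] dom[OF assms(3)]
  show ?thesis by (simp add: dfun_chart_deriv tvec_of_chart[OF c dom[OF assms(3)]])
qed

text \<open>Coordinate matrix of the form b. It is defined on all of \<open>W\<close>, so it is a
  smooth function of the point and can be controlled near \<open>p\<close>.\<close>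

definition bb :: "'a \<Rightarrow> 'm \<Rightarrow> 'm \<Rightarrow> real" where
  "bb x i j = ip x (nn x) (ctb_conn B x (tvec_of A c x (axis i 1)) (\<Phi> j))"

lemma bb_smooth: "smooth_fun A W (\<lambda>x. bb x i j)"
proof -
  have "smooth_vf A W (\<lambda>x. tvec_of A c x (axis i 1))"
    by (rule smooth_vf_tvec_of[OF c W]) (rule smooth_fun_const)
  then have "smooth_section B W (\<lambda>x. ctb_conn B x (tvec_of A c x (axis i 1)) (\<Phi> j))"
    using conn_D[THEN conjunct2, THEN conjunct2, THEN conjunct2, THEN conjunct2, THEN conjunct2,
      THEN spec[of _ W]] \<Phi>_smooth[of j] W(1) by blast
  from inner_smooth[OF W(1) nn_smooth this] show ?thesis unfolding bb_def .
qed

text \<open>Coordinate vector fields commute, so vanishing torsion lets the two indices be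
  exchanged.\<close>

lemma bb_sym:
  assumes x: "x \<in> W"
  shows "bb x i j = bb x j i"
proof -
  have vf: "smooth_vf A W (\<lambda>x. tvec_of A c x (axis i 1))" for i
    by (rule smooth_vf_tvec_of[OF c W]) (rule smooth_fun_const)
  have \<Phi>: "(\<lambda>y. phi y (tvec_of A c y (axis j 1))) = \<Phi> j" for j
    by (simp add: \<Phi>_def[abs_def] coord_vec_tvec_of)
  have "phi x (\<lambda>_. 0) = 0"
    using linear_0[OF linear_phi_tvec[OF dom[OF x]]] tvec_of_scale[OF x, of 0 0] by simp
  moreover have "ctb_conn B x (tvec_of A c x (axis i 1)) (\<Phi> j) - ctb_conn B x (tvec_of A c x (axis j 1)) (\<Phi> i)
      - phi x (lie_bracket A (\<lambda>x. tvec_of A c x (axis i 1)) (\<lambda>x. tvec_of A c x (axis j 1)) x) = 0"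
    using tf[unfolded torsion_free_def, THEN spec[of _ W], THEN spec[of _ "\<lambda>x. tvec_of A c x (axis i 1)"],
      THEN spec[of _ "\<lambda>x. tvec_of A c x (axis j 1)"], THEN mp, OF W(1), THEN mp, OF vf, THEN mp, OF vf,
      THEN bspec, OF x] unfolding \<Phi> .
  ultimately have "ctb_conn B x (tvec_of A c x (axis i 1)) (\<Phi> j) = ctb_conn B x (tvec_of A c x (axis j 1)) (\<Phi> i)"
    unfolding lie_bracket_tvec_of[OF c dom[OF x]] by simp
  then show ?thesis by (simp add: bb_def)
qed

lemma bb_expand:
  assumes "x \<in> W"
  shows "ip x (nn x) (ctb_conn B x (tvec_of A c x y) (\<Phi> j)) = (\<Sum>i\<in>UNIV. y $ i * bb x i j)"
proof -
  have "ip x (nn x) (\<Sum>i\<in>UNIV. y $ i *\<^sub>R ctb_conn B x (tvec_of A c x (axis i 1)) (\<Phi> j))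
      = (\<Sum>i\<in>UNIV. y $ i * ip x (nn x) (ctb_conn B x (tvec_of A c x (axis i 1)) (\<Phi> j)))"
    by (rule inner_sum_right[OF D_fibre[OF \<Phi>_smooth assms] nn_fibre[OF assms]])
  then show ?thesis
    using linear_axis_expansion[OF linear_D[OF \<Phi>_smooth[of j] assms], of y] by (simp only: bb_def)
qed

lemma D_nn_nn:
  assumes x: "x \<in> W"
  shows "ip x (ctb_conn B x (tvec_of A c x y) nn) (nn x) = 0"
proof -
  have "chart_deriv c (\<lambda>y. ip y (nn y) (nn y)) x y = chart_deriv c (\<lambda>_. 1) x y"
    by (rule fun_cong[OF chart_deriv_cong[OF W(1) c x dom[OF x] nn_unit]])
  then have "chart_deriv c (\<lambda>y. ip y (nn y) (nn y)) x y = 0"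
    unfolding chart_deriv_const .
  then show ?thesis
    unfolding D_metric[OF nn_smooth nn_smooth x]
    using inner_sym[OF nn_fibre[OF x] D_fibre[OF nn_smooth x, of y]] by linarith
qed

text \<open>The product of n with each image of a coordinate vector is a smooth multiple of
  \<lambda>. At a singular point its derivative in a direction tangent to the singular set is 0, and
  metric compatibility moves the derivative from n to the image, with a sign.\<close>

lemma D_nn_\<Phi>:
  assumes x: "x \<in> W" "lam x = 0" and y: "dlam x y = 0"
  shows "ip x (ctb_conn B x (tvec_of A c x y) nn) (\<Phi> j x) = - (\<Sum>i\<in>UNIV. y $ i * bb x i j)"
proof -
  let ?f = "\<lambda>x. inverse (nrm x) * (if i0 = j then 1 else 0)"
  have "smooth_fun A W ?f" by (intro smooth_fun_mult W inverse_nrm_smooth smooth_fun_const)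
  then have "chart_deriv c (\<lambda>x. ?f x * lam x) x y = 0"
    using chart_deriv_mult[OF W(1) _ lam_smooth c x(1) dom[OF x(1)]] x(2) y by simp
  moreover have "chart_deriv c (\<lambda>x. ip x (nn x) (\<Phi> j x)) x = chart_deriv c (\<lambda>x. ?f x * lam x) x"
    by (rule chart_deriv_cong[OF W(1) c x(1) dom[OF x(1)] nn_\<Phi>])
  ultimately have "chart_deriv c (\<lambda>x. ip x (nn x) (\<Phi> j x)) x y = 0" by simp
  then show ?thesis
    unfolding D_metric[OF nn_smooth \<Phi>_smooth x(1)] bb_expand[OF x(1)] by simp
qed

text \<open>This holds for every direction \<open>y\<close>, tangent or not; the test vector later
  uses it in the transversal direction as well.\<close>

lemma bb_etac:
  assumes x: "x \<in> W" "lam x = 0"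
  shows "(\<Sum>i\<in>UNIV. \<Sum>j\<in>UNIV. y $ i * etac x $ j * bb x i j) = dlam x y"
proof -
  let ?D = "ctb_conn B x (tvec_of A c x y)"
  let ?s = "\<lambda>z. \<Sum>j\<in>UNIV. etac z $ j *\<^sub>R \<Phi> j z"
  have s: "smooth_section B W ?s"
    by (intro smooth_section_sum W etac_smooth \<Phi>_smooth)
  have t: "smooth_section B W (\<lambda>z. lam z *\<^sub>R nn z)"
    by (intro smooth_section_scale W nn_smooth lam_smooth)
  have eq: "?s z = lam z *\<^sub>R nn z" if "z \<in> W" for z
    using phi_\<eta>[OF that] phi_tvec[OF dom[OF that], of "etac z"] by (simp add: \<eta>_def)
  have "?D ?s = dlam x y *\<^sub>R nn x"
    using D_cong[OF s t eq x(1), of y] D_scale[OF lam_smooth nn_smooth x(1), of y] x(2) by simp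
  then have "ip x (?D ?s) (nn x) = dlam x y"
    by (simp add: inner_scale_left nn_fibre[OF x(1)] nn_unit[OF x(1)])
  moreover have "?D ?s = (\<Sum>j\<in>UNIV. chart_deriv c (\<lambda>z. etac z $ j) x y *\<^sub>R \<Phi> j x)
      + (\<Sum>j\<in>UNIV. etac x $ j *\<^sub>R ?D (\<Phi> j))"
    using D_sum[of UNIV "\<lambda>j z. etac z $ j" \<Phi> x y] by (simp add: etac_smooth \<Phi>_smooth x sum.distrib)
  \<comment> \<open>Derivatives of the coefficients of \<eta> multiply vectors in the image of
    \<phi>, which are orthogonal to n at a singular point.\<close>
  moreover have "ip x (\<Sum>j\<in>UNIV. chart_deriv c (\<lambda>z. etac z $ j) x y *\<^sub>R \<Phi> j x) (nn x) = 0"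
    by (subst inner_sum_left)
      (simp_all add: \<Phi>_fibre dom x nn_fibre inner_sym[OF \<Phi>_fibre nn_fibre] nn_\<Phi>)
  moreover have "ip x (\<Sum>j\<in>UNIV. etac x $ j *\<^sub>R ?D (\<Phi> j)) (nn x)
      = (\<Sum>j\<in>UNIV. etac x $ j * (\<Sum>i\<in>UNIV. y $ i * bb x i j))"
    by (subst inner_sum_left)
      (simp_all add: D_fibre \<Phi>_smooth x nn_fibre inner_sym[OF D_fibre nn_fibre] bb_expand)
  moreover have "(\<Sum>j\<in>UNIV. chart_deriv c (\<lambda>z. etac z $ j) x y *\<^sub>R \<Phi> j x) \<in> fib x"
    "(\<Sum>j\<in>UNIV. etac x $ j *\<^sub>R ?D (\<Phi> j)) \<in> fib x"
    by (intro fibre_sum fibre_scale \<Phi>_fibre D_fibre \<Phi>_smooth dom x)+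
  ultimately have "(\<Sum>j\<in>UNIV. etac x $ j * (\<Sum>i\<in>UNIV. y $ i * bb x i j)) = dlam x y"
    by (simp add: inner_add_left nn_fibre x)
  then show ?thesis
    by (subst sum.swap) (simp add: sum_distrib_left mult.assoc mult.left_commute)
qed

end

section \<open>Adapted frames\<close>

lemma det_scale_row:
  fixes v :: "'m::finite \<Rightarrow> real ^ 'm"
  shows "det (\<chi> i. if i = r then s *\<^sub>R v i else v i) = s * det (\<chi> i. v i)"
proof -
  have "det (\<chi> i. if i = r then s *s v i else v i) = s * det (\<chi> i. if i = r then v i else v i)"
    by (rule det_row_mul)
  then show ?thesis by (simp only: scalar_mult_eq_scaleR if_cancel)
qed

text \<open>First-variation argument: a nonzero linear term dominates near t = 0. The value t = -b /
  d with d = |a| + 1 is an explicit witness for every sign of a.\<close>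

lemma nonneg_quadratic_imp_eq_0:
  fixes a b :: real
  assumes "\<And>t. 0 \<le> 2 * t * b + t * t * a"
  shows "b = 0"
proof (rule ccontr)
  assume "b \<noteq> 0"
  define d where "d = \<bar>a\<bar> + 1"
  have d: "d > 0" "a < d" by (auto simp: d_def)
  have "0 \<le> 2 * (- b / d) * b + (- b / d) * (- b / d) * a" by (rule assms)
  also have "\<dots> = b * b * (a / d - 2) / d" using d by (simp add: field_simps)
  finally have "0 \<le> b * b * (a / d - 2) / d" .
  moreover have "b * b * (a / d - 2) / d < 0"
    using d \<open>b \<noteq> 0\<close> by (intro divide_neg_pos mult_pos_neg) (auto simp: field_simps zero_less_mult_iff)
  ultimately show False by linarith
qed

context normal_chart
begin

abbreviation "ph x y \<equiv> phi x (tvec_of A c x y)"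

definition R :: "'a \<Rightarrow> (real, 'm) vec \<Rightarrow> (real, 'm) vec" where "R x y = (\<Sum>j\<in>UNIV. y $ j *\<^sub>R P x $ j)"

definition bil :: "'a \<Rightarrow> (real, 'm) vec \<Rightarrow> (real, 'm) vec \<Rightarrow> real" where
  "bil x y z = (\<Sum>i\<in>UNIV. \<Sum>j\<in>UNIV. y $ i * z $ j * bb x i j)"

lemma ph_R: "x \<in> W \<Longrightarrow> ph x y = sec x (R x y)"
  by (simp add: phi_sec R_def)

lemma ph_fibre: "x \<in> W \<Longrightarrow> ph x y \<in> fib x"
  by (intro phi_fibre tvec_of_tangent c dom)

lemma linear_ph: "x \<in> W \<Longrightarrow> linear (\<lambda>y. ph x y)"
  by (rule linear_phi_tvec[OF dom])

lemma R_smooth: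
  assumes "\<And>j. smooth_fun A U (\<lambda>x. y x $ j)" "open U" "U \<subseteq> W"
  shows "smooth_fun A U (\<lambda>x. R x (y x) $ b)"
proof -
  have "smooth_fun A U (\<lambda>x. \<Sum>j\<in>UNIV. y x $ j * P x $ j $ b)"
    by (intro smooth_fun_sum smooth_fun_mult assms(1,2) smooth_fun_subset[OF P_smooth assms(3)])
  then show ?thesis by (simp add: R_def)
qed

lemma bil_add_left: "bil x (y + y') z = bil x y z + bil x y' z"
  by (simp add: bil_def distrib_right sum.distrib)

lemma bil_scale_left: "bil x (r *\<^sub>R y) z = r * bil x y z"
  by (simp add: bil_def sum_distrib_left mult.assoc)

lemma bil_sym: "x \<in> W \<Longrightarrow> bil x y z = bil x z y"
  unfolding bil_def by (subst sum.swap) (simp add: bb_sym[of x] mult.commute mult.left_commute cong: sum.cong)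

lemma bil_etac: "x \<in> W \<Longrightarrow> lam x = 0 \<Longrightarrow> bil x y (etac x) = dlam x y"
  unfolding bil_def by (rule bb_etac)

lemma D_nn_ph:
  assumes x: "x \<in> W" "lam x = 0" and y: "dlam x y = 0"
  shows "ip x (ctb_conn B x (tvec_of A c x y) nn) (ph x z) = - bil x y z"
proof -
  have "ip x (ctb_conn B x (tvec_of A c x y) nn) (ph x z)
    = (\<Sum>j\<in>UNIV. z $ j * ip x (ctb_conn B x (tvec_of A c x y) nn) (\<Phi> j x))"
    unfolding phi_tvec[OF dom[OF x(1)]]
    by (rule inner_sum_right[OF \<Phi>_fibre[OF dom[OF x(1)]] D_fibre[OF nn_smooth x(1)]])
  also have "\<dots> = - bil x y z"
    unfolding D_nn_\<Phi>[OF x y] bil_def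
    by (subst sum.swap) (simp add: sum_negf sum_distrib_left mult.assoc mult.left_commute)
  finally show ?thesis .
qed

lemma nn_ph:
  assumes x: "x \<in> W" "lam x = 0"
  shows "ip x (ph x y) (nn x) = 0"
proof -
  have "ip x (ph x y) (nn x) = (\<Sum>j\<in>UNIV. y $ j * ip x (\<Phi> j x) (nn x))"
    unfolding phi_tvec[OF dom[OF x(1)]]
    by (rule inner_sum_left[OF \<Phi>_fibre[OF dom[OF x(1)]] nn_fibre[OF x(1)]])
  also have "\<dots> = 0"
    by (simp add: inner_sym[OF \<Phi>_fibre[OF dom[OF x(1)]] nn_fibre[OF x(1)]] nn_\<Phi>[OF x(1)] x(2))
  finally show ?thesis .
qed

text \<open>On the singular set the kernel is spanned by \<open>etac\<close>, which leaves the
  kernel of d\<lambda>; elsewhere \<phi> is injective anyway. Both cases occur because the tangent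
  frame is built on an open set.\<close>

lemma ph_inj:
  assumes x: "x \<in> W" "dlam x (etac x) \<noteq> 0" and y: "dlam x y = 0" "ph x y = 0"
  shows "y = 0"
proof (cases "lam x = 0")
  case True
  then obtain r where "y = r *\<^sub>R etac x" using kernel_phi[OF x(1) True] y(2) by blast
  then show ?thesis using y(1) x(2) by (simp add: linear_cmul[OF linear_dlam[OF x(1)]])
next
  case False
  then have "inj_on (phi x) (tangent_space A x)"
    using singular_iff[OF x(1)] unfolding singular_set_def bij_betw_def by blast
  moreover have "phi x (tvec_of A c x y) = phi x (tvec_of A c x 0)"
    using y(2) linear_0[OF linear_ph[OF x(1)]] by simp
  ultimately have "tvec_of A c x y = tvec_of A c x 0"
    using tvec_of_tangent[OF c dom[OF x(1)], of y] tvec_of_tangent[OF c dom[OF x(1)], of 0]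
    unfolding inj_on_def by blast
  then show ?thesis using tvec_of_chart[OF c dom[OF x(1)]] by metis
qed

text \<open>Passing to another chart multiplies the coordinate matrix by the transposed Jacobian,
  whose determinant is positive in an oriented atlas.\<close>

lemma pos_oriented_tvec_of:
  assumes x: "x \<in> W" and m: "det (\<chi> i. m i) > 0"
  shows "pos_oriented A x (\<lambda>i. tvec_of A c x (m i))"
  unfolding pos_oriented_def
proof (intro conjI allI ballI impI)
  show "tvec_of A c x (m i) \<in> tangent_space A x" for i
    by (rule tvec_of_tangent[OF c dom[OF x]])
  fix c' assume c': "c' \<in> A" "x \<in> fst c'"
  let ?D = "frechet_derivative (snd c' \<circ> chart_inv c) (at (snd c x))"
  have lin: "linear ?D" by (rule linear_transition[OF c c'(1) dom[OF x] c'(2)])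
  have "(\<chi> i. tvec_of A c x (m i) c') = (\<chi> i. m i) ** transpose (matrix ?D)"
  proof -
    have "?D (m i) $ j = (\<Sum>l\<in>UNIV. m i $ l * matrix ?D $ j $ l)" for i j
      using arg_cong[OF linear_axis_expansion[OF lin, of "m i"], of "\<lambda>v. v $ j"]
      by (simp add: matrix_def)
    then show ?thesis
      using c' by (simp add: vec_eq_iff matrix_matrix_mult_def transpose_def tvec_of_def)
  qed
  moreover have "det (matrix ?D) > 0"
    using atlas c c' dom[OF x] unfolding oriented_atlas_def by blast
  ultimately show "0 < det (\<chi> i. tvec_of A c x (m i) c')"
    using m by (simp add: det_mul det_transpose)
qed

text \<open>The two determinants below are those of \<open>(e\<^sub>1, \<dots>, e\<^sub>m\<^sub>-\<^sub>1, \<eta>)\<close> and of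
  \<open>(\<phi>(e\<^sub>1), \<dots>, \<phi>(e\<^sub>m\<^sub>-\<^sub>1), \<nu>)\<close>.  As \<open>\<phi>(\<eta>) = \<lambda> \<nu>\<close>, they agree off the singular set, hence everywhere.\<close>

lemma det_frame_eq:
  assumes U: "open U" "U \<subseteq> W" and x: "x \<in> U"
    and ev: "\<And>i j. smooth_fun A U (\<lambda>x. ev i x $ j)"
  shows "det (\<chi> i. if i = last_index then etac x else ev i x)
    = det (\<chi> i. if i = last_index then \<nu> x else R x (ev i x))"
proof -
  define E where "E x = (\<chi> i. if i = last_index then etac x else ev i x)" for x
  define N where "N x = (\<chi> i. if i = last_index then \<nu> x else R x (ev i x))" for x
  have sE: "smooth_fun A U (\<lambda>x. E x $ i $ j)" for i j
    using smooth_fun_subset[OF etac_smooth U(2)] ev by (cases "i = last_index") (simp_all add: E_def)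
  have sN: "smooth_fun A U (\<lambda>x. N x $ i $ j)" for i j
    using smooth_fun_subset[OF \<nu>_smooth U(2)] R_smooth[OF ev U] by (cases "i = last_index") (simp_all add: N_def)
  have "det (E x) - det (N x) = 0"
  proof (rule mult_eq_0_imp_eq_0[OF U(1) smooth_fun_subset[OF lam_smooth U(2)] _ c x dom _ dlam_k])
    show "smooth_fun A U (\<lambda>x. det (E x) - det (N x))"
      by (intro smooth_fun_diff smooth_fun_det U sE sN)
    show "x \<in> W" "x \<in> W" using x U by auto
    fix y assume "y \<in> U"
    then have y: "y \<in> W" using U by auto
    have "(E y ** P y) $ i = (if i = last_index then lam y *\<^sub>R N y $ i else N y $ i)" for i
    proof -
      have "(E y ** P y) $ i = R y (E y $ i)"
        by (simp add: matrix_matrix_mult_def R_def vec_eq_iff)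
      then show ?thesis by (simp add: E_def N_def) (simp add: R_def etac_row[OF y])
    qed
    then have "E y ** P y = (\<chi> i. if i = last_index then lam y *\<^sub>R N y $ i else N y $ i)"
      by (simp add: vec_eq_iff)
    then have "det (E y) * det (P y) = lam y * det (\<chi> i. N y $ i)"
      using det_mul[of "E y" "P y"] det_scale_row[of last_index "lam y" "\<lambda>i. N y $ i"] by simp
    then show "lam y * (det (E y) - det (N y)) = 0"
      by (simp add: lam_det[OF y] algebra_simps)
  qed
  then show ?thesis by (simp add: E_def N_def)
qed

text \<open>The frame spans the kernel of d\<lambda> on an open set of the manifold, which provides
  the extensions demanded by smoothness along the singular set. Injectivity of \<phi> on that kernel
  makes the Gram matrix positive definite.\<close>

lemma tangent_frame:
  obtains U and ev :: "'m \<Rightarrow> 'a \<Rightarrow> (real, 'm) vec" where "open U" "U = {x\<in>W. dlam x (etac x) \<noteq> 0}" "\<And>i j. smooth_fun A U (\<lambda>x. ev i x $ j)"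
    "\<And>x i. x \<in> U \<Longrightarrow> i \<noteq> last_index \<Longrightarrow> dlam x (ev i x) = 0"
    "\<And>x i j. x \<in> U \<Longrightarrow> i \<noteq> last_index \<Longrightarrow> j \<noteq> last_index \<Longrightarrow>
      ip x (ph x (ev i x)) (ph x (ev j x)) = (if i = j then 1 else 0)"
proof -
  define I where "I = UNIV - {last_index :: 'm}"
  define U where "U = {x\<in>W. dlam x (etac x) \<noteq> 0}"
  have sd: "smooth_fun A W (\<lambda>x. dlam x v)" for v
    by (rule smooth_fun_chart_deriv[OF W(1) lam_smooth c W(2)])
  have "smooth_fun A W (\<lambda>x. \<Sum>i\<in>UNIV. etac x $ i * dlam x (axis i 1))"
    by (intro smooth_fun_sum smooth_fun_mult W etac_smooth sd)
  then have "smooth_fun A W (\<lambda>x. dlam x (etac x))"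
    by (rule smooth_fun_cong[OF W(1), rotated]) (use linear_axis_expansion[OF linear_dlam] in simp)
  then have oU: "open U" unfolding U_def by (rule open_smooth_fun_nonzero[OF W(1)])
  have UW: "U \<subseteq> W" by (auto simp: U_def)
  \<comment> \<open>A basis of the kernel omits the index k, while the frame must omit
    \<open>last_index\<close>; the transposition matches the two index sets.\<close>
  define \<tau> where "\<tau> = Transposition.transpose k (last_index :: 'm)"
  have \<tau>k: "\<tau> i \<noteq> k" if "i \<in> I" for i
    using that by (auto simp: \<tau>_def I_def Transposition.transpose_def split: if_splits)
  have \<tau>inj: "\<tau> i = \<tau> j \<longleftrightarrow> i = j" for i j unfolding \<tau>_def by (metis transpose_involutory)
  define b :: "'m \<Rightarrow> 'a \<Rightarrow> (real, 'm) vec" where "b i x = axis (\<tau> i) 1 - (dlam x (axis (\<tau> i) 1) * inverse (dlam x (axis k 1))) *\<^sub>R axis k 1" for i x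
  have sb: "smooth_fun A U (\<lambda>x. b i x $ j)" for i j
  proof -
    have "smooth_fun A W (\<lambda>x. axis (\<tau> i) 1 $ j - (dlam x (axis (\<tau> i) 1) * inverse (dlam x (axis k 1))) * axis k 1 $ j)"
      by (intro smooth_fun_diff smooth_fun_const smooth_fun_mult smooth_fun_inverse W sd dlam_k)
    then show ?thesis using smooth_fun_subset[OF _ UW] by (simp add: b_def)
  qed
  have db: "dlam x (b i x) = 0" if "x \<in> W" for i x
    using dlam_k[OF that] by (simp add: b_def linear_diff[OF linear_dlam[OF that]] linear_cmul[OF linear_dlam[OF that]])
  define G where "G i j x = R x (b i x) \<bullet> R x (b j x)" for i j x
  have sG: "smooth_fun A U (G i j)" for i j
  proof -
    have "smooth_fun A U (\<lambda>x. \<Sum>a\<in>UNIV. R x (b i x) $ a * R x (b j x) $ a)"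
      by (intro smooth_fun_sum smooth_fun_mult oU R_smooth[OF sb oU UW])
    then show ?thesis by (simp add: G_def[abs_def] inner_vec_def)
  qed
  have Rsum: "R x (\<Sum>i\<in>I. d i *\<^sub>R y i) = (\<Sum>i\<in>I. d i *\<^sub>R R x (y i))" for d x and y :: "'m \<Rightarrow> (real, 'm) vec"
  proof -
    have "linear (R x)"
      by (rule linearI) (simp_all add: R_def scaleR_add_left sum.distrib scaleR_sum_right)
    then show ?thesis by (simp only: linear_sum linear_cmul)
  qed
  have inner_sum2: "(\<Sum>i\<in>I. d i *\<^sub>R y i) \<bullet> (\<Sum>j\<in>I. d' j *\<^sub>R y j) = (\<Sum>i\<in>I. \<Sum>j\<in>I. d i * d' j * (y i \<bullet> y j))"
    for d d' and y :: "'m \<Rightarrow> (real, 'm) vec"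
    by (simp add: Inner_Product.real_inner_class.inner_sum_left Inner_Product.real_inner_class.inner_sum_right
        sum_distrib_left mult.assoc) (subst sum.swap, simp add: mult.left_commute)
  have pos: "(\<Sum>i\<in>I. \<Sum>j\<in>I. d i * d j * G i j x) > 0" if x: "x \<in> U" and d: "\<exists>i\<in>I. d i \<noteq> 0" for x d
  proof -
    have xW: "x \<in> W" "dlam x (etac x) \<noteq> 0" using x by (auto simp: U_def)
    define u where "u = (\<Sum>i\<in>I. d i *\<^sub>R b i x)"
    obtain i where i: "i \<in> I" "d i \<noteq> 0" using d by blast
    have "u $ \<tau> i = (\<Sum>j\<in>I. if j = i then d i else 0)"
      unfolding u_def sum_component
      by (rule sum.cong[OF refl]) (use \<tau>k[OF i(1)] in \<open>auto simp: b_def axis_def \<tau>inj\<close>)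
    then have "u \<noteq> 0" using i by (auto simp: I_def)
    have "dlam x u = 0"
      unfolding u_def linear_sum[OF linear_dlam[OF xW(1)]] by (simp add: linear_cmul[OF linear_dlam[OF xW(1)]] db xW)
    then have "ph x u \<noteq> 0" using ph_inj[OF xW] \<open>u \<noteq> 0\<close> by blast
    then have "R x u \<noteq> 0" using ph_R[OF xW(1), of u] sec_eq_0[OF xW(1)] by simp
    then have "R x u \<bullet> R x u > 0" by simp
    then show ?thesis unfolding u_def Rsum inner_sum2 G_def .
  qed
  obtain a :: "'m \<Rightarrow> 'm \<Rightarrow> 'a \<Rightarrow> real" where a: "\<And>i j. i \<in> I \<Longrightarrow> smooth_fun A U (a i j)"
    "\<And>x i j. x \<in> U \<Longrightarrow> i \<in> I \<Longrightarrow> j \<in> I \<Longrightarrow>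
      (\<Sum>k\<in>I. \<Sum>l\<in>I. a i k x * a j l x * G k l x) = (if i = j then 1 else 0)"
  proof (rule smooth_gram_schmidt[OF _ oU, of I G])
    show "G i j x = G j i x" for i j x by (simp add: G_def inner_commute)
  qed (use sG pos in \<open>auto simp: I_def\<close>)
  \<comment> \<open>The value 0 at \<open>last_index\<close> is a filler that keeps the family
    smooth at every index; that slot is always replaced by \<eta> or the normal.\<close>
  define ev where "ev i x = (if i = last_index then 0 else \<Sum>j\<in>I. a i j x *\<^sub>R b j x)" for i x
  have ev: "ev i x = (\<Sum>j\<in>I. a i j x *\<^sub>R b j x)" if "i \<noteq> last_index" for i x
    using that by (simp add: ev_def)
  show thesis
  proof (rule that[OF oU U_def])
    show "smooth_fun A U (\<lambda>x. ev i x $ j)" for i j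
    proof (cases "i = last_index")
      case True
      then show ?thesis by (simp add: ev_def smooth_fun_const)
    next
      case False
      have "smooth_fun A U (\<lambda>x. \<Sum>l\<in>I. a i l x * b l x $ j)"
        using False by (intro smooth_fun_sum smooth_fun_mult oU a(1) sb) (simp add: I_def)
      then show ?thesis by (simp add: ev[OF False])
    qed
    fix x and i :: 'm assume x: "x \<in> U" and i: "i \<noteq> last_index"
    then have xW: "x \<in> W" using UW by auto
    show "dlam x (ev i x) = 0"
      unfolding ev[OF i] linear_sum[OF linear_dlam[OF xW]] by (simp add: linear_cmul[OF linear_dlam[OF xW]] db xW)
    fix j :: 'm assume j: "j \<noteq> last_index"
    have "ip x (ph x (ev i x)) (ph x (ev j x)) = (\<Sum>k\<in>I. \<Sum>l\<in>I. a i k x * a j l x * G k l x)"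
      unfolding ph_R[OF xW] inner_sec[OF xW] ev[OF i] ev[OF j] Rsum inner_sum2 G_def ..
    then show "ip x (ph x (ev i x)) (ph x (ev j x)) = (if i = j then 1 else 0)"
      using a(2)[OF x, of i j] i j by (simp add: I_def)
  qed
qed

text \<open>The fields \<eta> and n are fixed, so the sign of one tangent vector must meet both
  orientation conditions. The determinants of the two frames agree, hence one correction serves
  both; it is placed at the tangent index \<open>i1\<close>.\<close>

lemma adapted_frame_exists:
  assumes m: "i1 \<noteq> (last_index :: 'm)"
  obtains U e where "open U" "U = {x\<in>W. dlam x (etac x) \<noteq> 0}"
    "adapted_frame B (U \<inter> singular_set B) (\<lambda>i x. tvec_of A c x (e i x)) \<eta> nn"
    "\<And>x i. x \<in> U \<inter> singular_set B \<Longrightarrow> i \<noteq> last_index \<Longrightarrow> dlam x (e i x) = 0"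
    "\<And>x. x \<in> U \<inter> singular_set B \<Longrightarrow> orthonormal_frame B x (\<lambda>i. if i = last_index then nn x else ph x (e i x))"
    "\<And>x y. x \<in> U \<inter> singular_set B \<Longrightarrow> dlam x y = 0 \<Longrightarrow>
      y = (\<Sum>i\<in>UNIV - {last_index}. ip x (ph x y) (ph x (e i x)) *\<^sub>R e i x)"
proof (rule tangent_frame)
  fix U and ev :: "'m \<Rightarrow> 'a \<Rightarrow> (real, 'm) vec"
  assume U: "open U" "U = {x\<in>W. dlam x (etac x) \<noteq> 0}"
    and sev: "\<And>i j. smooth_fun A U (\<lambda>x. ev i x $ j)"
    and dev: "\<And>x i. x \<in> U \<Longrightarrow> i \<noteq> last_index \<Longrightarrow> dlam x (ev i x) = 0"
    and oev: "\<And>x i j. x \<in> U \<Longrightarrow> i \<noteq> last_index \<Longrightarrow> j \<noteq> last_index \<Longrightarrow>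
      ip x (ph x (ev i x)) (ph x (ev j x)) = (if i = j then 1 else 0)"
  have UW: "U \<subseteq> W" using U(2) by auto
  \<comment> \<open>On the singular set within \<open>U\<close> this is the co-orientation of an
    orthonormal frame, hence 1 or -1. Elsewhere it may take other values, so orthonormality after
    scaling by it is claimed only on the singular set.\<close>
  define F where "F x = det (\<chi> i. if i = last_index then etac x else ev i x)" for x
  define e where "e i x = (if i = i1 then F x *\<^sub>R ev i x else ev i x)" for i x
  define fr where "fr x i = (if i = last_index then nn x else ph x (e i x))" for x i
  have sF: "smooth_fun A U F"
    unfolding F_def
  proof (rule smooth_fun_det[OF U(1)])
    show "smooth_fun A U (\<lambda>x. (\<chi> i. if i = last_index then etac x else ev i x) $ i $ j)" for i j
      using smooth_fun_subset[OF etac_smooth UW] sev by (cases "i = last_index") simp_all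
  qed
  have se: "smooth_fun A U (\<lambda>x. e i x $ j)" for i j
    using smooth_fun_mult[OF U(1) sF sev] sev by (cases "i = i1") (simp_all add: e_def)
  have xS: "x \<in> W" "x \<in> U" "lam x = 0" "dlam x (etac x) \<noteq> 0" if "x \<in> U \<inter> singular_set B" for x
    using that U(2) singular_iff by auto
  have frame_of: "orthonormal_frame B x (\<lambda>i. if i = last_index then nn x else ph x (y i))"
    if x: "x \<in> U \<inter> singular_set B"
      and y: "\<And>i j. i \<noteq> last_index \<Longrightarrow> j \<noteq> last_index \<Longrightarrow> ip x (ph x (y i)) (ph x (y j)) = (if i = j then 1 else 0)"
    for x y
    unfolding orthonormal_frame_def
    using y nn_fibre[OF xS(1)[OF x]] ph_fibre[OF xS(1)[OF x]] nn_unit[OF xS(1)[OF x]] nn_ph[OF xS(1)[OF x] xS(3)[OF x]]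
      inner_sym[OF nn_fibre[OF xS(1)[OF x]] ph_fibre[OF xS(1)[OF x]]]
    by simp
  have coor_of: "ctb_coor B x (\<lambda>i. if i = last_index then nn x else ph x (y i))
      = det (\<chi> i. if i = last_index then \<nu> x else R x (y i))" if x: "x \<in> W" for x y
  proof -
    have "ctb_coor B x (\<lambda>i. if i = last_index then nn x else ph x (y i))
      = det (\<chi> i j. ip x (if i = last_index then nn x else ph x (y i)) (\<epsilon> j x))"
      by (rule coor_frame_det[OF \<epsilon>_frame[OF x] \<epsilon>_pos[OF x]]) (simp add: nn_fibre[OF x] ph_fibre[OF x])
    also have "(\<chi> i j. ip x (if i = last_index then nn x else ph x (y i)) (\<epsilon> j x))
      = (\<chi> i. if i = last_index then \<nu> x else R x (y i))"
      by (simp add: vec_eq_iff nn_def ph_R[OF x] inner_sec_\<epsilon>[OF x])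
    finally show ?thesis .
  qed
  have F1: "F x * F x = 1" if x: "x \<in> U \<inter> singular_set B" for x
  proof -
    have "ctb_coor B x (\<lambda>i. if i = last_index then nn x else ph x (ev i x)) = F x"
      unfolding coor_of[OF xS(1)[OF x]] F_def
      by (rule det_frame_eq[OF U(1) UW xS(2)[OF x] sev, symmetric])
    then show ?thesis
      using coor_orthonormal[OF frame_of[OF x oev[OF xS(2)[OF x]]]] by auto
  qed
  have phe: "ph x (e i x) = (if i = i1 then F x *\<^sub>R ph x (ev i x) else ph x (ev i x))" if "x \<in> W" for x i
    by (simp add: e_def linear_cmul[OF linear_ph[OF that]])
  have oe: "ip x (ph x (e i x)) (ph x (e j x)) = (if i = j then 1 else 0)"
    if x: "x \<in> U \<inter> singular_set B" and ij: "i \<noteq> last_index" "j \<noteq> last_index" for x i j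
  proof -
    have xW: "x \<in> W" using xS(1)[OF x] .
    have right: "ip x u (r *\<^sub>R ph x y) = r * ip x u (ph x y)" if "u \<in> fib x" for u r y
      using inner_sym[OF that fibre_scale[OF ph_fibre[OF xW]]] inner_sym[OF that ph_fibre[OF xW]]
        inner_scale_left[OF ph_fibre[OF xW] that] by simp
    show ?thesis
      using oev[OF xS(2)[OF x] ij] F1[OF x]
      by (cases "i = i1"; cases "j = i1")
        (simp_all add: phe[OF xW] right inner_scale_left ph_fibre[OF xW] fibre_scale)
  qed
  have de: "dlam x (e i x) = 0" if x: "x \<in> U \<inter> singular_set B" and i: "i \<noteq> last_index" for x i
    using dev[OF xS(2)[OF x] i]
    by (cases "i = i1") (simp_all add: e_def linear_cmul[OF linear_dlam[OF xS(1)[OF x]]])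
  have on: "orthonormal_frame B x (\<lambda>i. if i = last_index then nn x else ph x (e i x))"
    if x: "x \<in> U \<inter> singular_set B" for x
    by (rule frame_of[OF x oe[OF x]])
  have span: "y = (\<Sum>i\<in>UNIV - {last_index}. ip x (ph x y) (ph x (e i x)) *\<^sub>R e i x)"
    if x: "x \<in> U \<inter> singular_set B" and y: "dlam x y = 0" for x y
  proof -
    let ?I = "UNIV - {last_index :: 'm}"
    let ?z = "\<Sum>i\<in>?I. ip x (ph x y) (ph x (e i x)) *\<^sub>R e i x"
    note xW = xS(1)[OF x]
    have "ph x y = (\<Sum>i\<in>UNIV. ip x (ph x y) (if i = last_index then nn x else ph x (e i x))
        *\<^sub>R (if i = last_index then nn x else ph x (e i x)))"
      by (rule orthonormal_expansion[OF on[OF x] ph_fibre[OF xW]])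
    also have "\<dots> = (\<Sum>i\<in>?I. ip x (ph x y) (ph x (e i x)) *\<^sub>R ph x (e i x))"
      by (subst sum.remove[of _ last_index]) (simp_all add: nn_ph[OF xW xS(3)[OF x]])
    also have "\<dots> = ph x ?z"
      unfolding linear_sum[OF linear_ph[OF xW]] linear_cmul[OF linear_ph[OF xW]] ..
    finally have "ph x (y - ?z) = 0" by (simp add: linear_diff[OF linear_ph[OF xW]])
    moreover have "dlam x ?z = 0"
      unfolding linear_sum[OF linear_dlam[OF xW]] by (simp add: linear_cmul[OF linear_dlam[OF xW]] de[OF x])
    then have "dlam x (y - ?z) = 0" by (simp add: linear_diff[OF linear_dlam[OF xW]] y)
    ultimately have "y - ?z = 0" using ph_inj[OF xW xS(4)[OF x]] by blast
    then show ?thesis by simp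
  qed
  have dete: "det (\<chi> i. if i = last_index then etac x else e i x) = 1" if x: "x \<in> U \<inter> singular_set B" for x
  proof -
    have "(\<chi> i. if i = last_index then etac x else e i x)
      = (\<chi> i. if i = i1 then F x *\<^sub>R (if i = last_index then etac x else ev i x) else (if i = last_index then etac x else ev i x))"
      using m by (simp add: vec_eq_iff e_def)
    then show ?thesis
      using F1[OF x] det_scale_row[of i1 "F x" "\<lambda>i. if i = last_index then etac x else ev i x"] by (simp add: F_def)
  qed
  have "adapted_frame B (U \<inter> singular_set B) (\<lambda>i x. tvec_of A c x (e i x)) \<eta> nn"
    unfolding adapted_frame_def
  proof (intro conjI allI impI ballI)
    have "smooth_vf A U (\<lambda>x. tvec_of A c x (e i x))" for i
      by (rule smooth_vf_tvec_of[OF c U(1) _ se]) (use UW W(2) in auto)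
    then show "smooth_vf_along A (U \<inter> singular_set B) (\<lambda>x. tvec_of A c x (e i x))" for i
      unfolding smooth_vf_along_def using U(1) by blast
    show "null_vector_field B (U \<inter> singular_set B) \<eta>" by (rule null_\<eta>[OF UW])
    show "smooth_section_along B (U \<inter> singular_set B) nn"
      unfolding smooth_section_along_def using smooth_section_subset[OF nn_smooth UW] U(1) by blast
    fix x assume x: "x \<in> U \<inter> singular_set B"
    note xW = xS(1)[OF x] and T = singular_tangent_space_eq[OF xS(1)[OF x] xS(3)[OF x]]
    show "tvec_of A c x (e i x) \<in> singular_tangent_space B x" if "i \<noteq> last_index" for i
      unfolding T using de[OF x that] by blast
    show "phi_metric B x (tvec_of A c x (e i x)) (tvec_of A c x (e j x)) = (if i = j then 1 else 0)"
      if "i \<noteq> last_index" "j \<noteq> last_index" for i j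
      unfolding phi_metric_def by (rule oe[OF x that])
    show "orthonormal_frame B x (\<lambda>i. if i = last_index then nn x else ph x (e i x))" by (rule on[OF x])
    show "0 < ctb_coor B x (\<lambda>i. if i = last_index then nn x else ph x (e i x))"
      unfolding coor_of[OF xW] det_frame_eq[OF U(1) UW xS(2)[OF x] se, symmetric] dete[OF x] by simp
    have "pos_oriented A x (\<lambda>i. tvec_of A c x (if i = last_index then etac x else e i x))"
      by (rule pos_oriented_tvec_of[OF xW]) (simp add: dete[OF x])
    then show "pos_oriented A x (\<lambda>i. if i = last_index then \<eta> x else tvec_of A c x (e i x))"
      unfolding \<eta>_def if_distrib[of "tvec_of A c x"] .
    fix v assume "v \<in> singular_tangent_space B x"
    then obtain y where y: "v = tvec_of A c x y" "dlam x y = 0" unfolding T by blast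
    let ?a = "\<lambda>i. ip x (ph x y) (ph x (e i x))"
    have "tvec_of A c x (\<Sum>i\<in>J. ?a i *\<^sub>R e i x) = (\<lambda>c'. \<Sum>i\<in>J. ?a i *\<^sub>R tvec_of A c x (e i x) c')" for J
    proof (induction J rule: infinite_finite_induct)
      case (insert i J)
      then show ?case
        using tvec_of_linear[OF c dom[OF xW], of "?a i" "e i x" 1 "\<Sum>i\<in>J. ?a i *\<^sub>R e i x"] by simp
    qed (use tvec_of_scale[OF xW, of 0 0] in auto)
    from this[of "UNIV - {last_index}"] span[OF x y(2)]
    have "v = (\<lambda>c'. \<Sum>i\<in>UNIV - {last_index}. ?a i *\<^sub>R tvec_of A c x (e i x) c')" using y(1) by metis
    then show "\<exists>a. v = (\<lambda>c'. \<Sum>i\<in>UNIV - {last_index}. a i *\<^sub>R tvec_of A c x (e i x) c')"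
      by (rule exI[of _ ?a])
  qed
  from that[OF U this de on span] show thesis .
qed

end

section \<open>The smallest singular principal curvature\<close>

context normal_chart
begin

text \<open>The minimum of the Rayleigh quotient over the compact unit sphere of the tangent space
  is an eigenvalue, so it bounds all quotients from below. The operator itself is constructed from
  an adapted frame.\<close>

lemma principal_curvature_exists:
  assumes m: "i1 \<noteq> (last_index :: 'm)" and q: "q \<in> W" "lam q = 0" "A2_point B q"
  obtains \<kappa> where "singular_principal_curvature B q \<kappa>"
    "\<And>y. dlam q y = 0 \<Longrightarrow> \<kappa> * ip q (ph q y) (ph q y) \<le> sgn (dlam q (etac q)) * bil q y y"
proof (rule adapted_frame_exists[OF m])
  fix U and e :: "'m \<Rightarrow> 'a \<Rightarrow> (real, 'm) vec"
  assume U: "open U" "U = {x\<in>W. dlam x (etac x) \<noteq> 0}"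
    and af: "adapted_frame B (U \<inter> singular_set B) (\<lambda>i x. tvec_of A c x (e i x)) \<eta> nn"
    and de': "\<And>x i. x \<in> U \<inter> singular_set B \<Longrightarrow> i \<noteq> last_index \<Longrightarrow> dlam x (e i x) = 0"
    and on': "\<And>x. x \<in> U \<inter> singular_set B \<Longrightarrow> orthonormal_frame B x (\<lambda>i. if i = last_index then nn x else ph x (e i x))"
    and span': "\<And>x y. x \<in> U \<inter> singular_set B \<Longrightarrow> dlam x y = 0 \<Longrightarrow>
      y = (\<Sum>i\<in>UNIV - {last_index}. ip x (ph x y) (ph x (e i x)) *\<^sub>R e i x)"
  define I where "I = UNIV - {last_index :: 'm}"
  define \<delta> where "\<delta> = dlam q (etac q)"
  have "\<delta> \<noteq> 0" using A2_iff[OF q(1,2)] q(3) by (simp add: \<delta>_def)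
  then have qU: "q \<in> U" using q(1) by (simp add: U(2) \<delta>_def)
  then have qS: "q \<in> U \<inter> singular_set B" using q singular_iff by auto
  note de = de'[OF qS] and on = on'[OF qS] and span = span'[OF qS, folded I_def]
  have lind: "linear (dlam q)" by (rule linear_dlam[OF q(1)])
  note T = singular_tangent_space_eq[OF q(1,2)]
  define u where "u i = ph q (e i q)" for i
  have uE: "u i \<in> fib q" for i unfolding u_def by (rule ph_fibre[OF q(1)])
  have uu: "ip q (u i) (u j) = (if i = j then 1 else 0)" if "i \<in> I" "j \<in> I" for i j
    using on[unfolded orthonormal_frame_def, THEN conjunct2, rule_format, of i j] that
    by (simp add: u_def I_def)
  define Y where "Y x = (\<Sum>i\<in>I. x $ i *\<^sub>R e i q)" for x :: "(real, 'm) vec"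
  have dY: "dlam q (Y x) = 0" for x
    unfolding Y_def linear_sum[OF lind] by (simp add: linear_cmul[OF lind] de I_def)
  have phY: "ph q (Y x) = (\<Sum>i\<in>I. x $ i *\<^sub>R u i)" for x
    unfolding Y_def u_def linear_sum[OF linear_ph[OF q(1)]] linear_cmul[OF linear_ph[OF q(1)]] ..
  have innerY: "ip q (ph q (Y x)) (ph q (Y x)) = (\<Sum>i\<in>I. x $ i * x $ i)" for x
  proof -
    have *: "ip q (u i) (ph q (Y x)) = x $ i" if i: "i \<in> I" for i
    proof -
      have "ip q (u i) (ph q (Y x)) = (\<Sum>j\<in>I. x $ j * ip q (u i) (u j))"
        unfolding phY by (rule inner_sum_right[OF uE uE])
      also have "\<dots> = (\<Sum>j\<in>I. if j = i then x $ i else 0)"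
        by (rule sum.cong[OF refl]) (auto simp: uu[OF i])
      finally show ?thesis using i by (simp add: I_def)
    qed
    have "ip q (ph q (Y x)) (ph q (Y x)) = (\<Sum>i\<in>I. x $ i * ip q (u i) (ph q (Y x)))"
      by (subst (1) phY) (rule inner_sum_left[OF uE ph_fibre[OF q(1)]])
    then show ?thesis using * by simp
  qed
  have norm_I: "(\<Sum>i\<in>I. x $ i * x $ i) = x \<bullet> x" if "x $ last_index = 0" for x :: "(real, 'm) vec"
    unfolding inner_vec_def using that
    by (subst sum.remove[of UNIV last_index]) (simp_all add: I_def)
  \<comment> \<open>The shape operator as a bilinear form in the coordinates of the orthonormal
    tangent frame.\<close>
  define h where "h x z = sgn \<delta> * bil q (Y x) (Y z)" for x z
  have Yadd: "Y (x + r *\<^sub>R z) = Y x + r *\<^sub>R Y z" for x z r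
    by (simp add: Y_def scaleR_add_left sum.distrib scaleR_sum_right)
  have Yscale: "Y (r *\<^sub>R z) = r *\<^sub>R Y z" for z r
    by (simp add: Y_def scaleR_sum_right)
  have bil_add_right: "bil q y (z + z') = bil q y z + bil q y z'" for y z z'
    using bil_sym[OF q(1), of y] bil_add_left by simp
  have bil_scale_right: "bil q y (r *\<^sub>R z) = r * bil q y z" for y z r
    using bil_sym[OF q(1), of y] bil_scale_left by simp
  have hexp: "h (x + r *\<^sub>R z) (x + r *\<^sub>R z) = h x x + 2 * r * h x z + r * r * h z z" for x z r
    using bil_sym[OF q(1), of "Y z" "Y x"]
    by (simp add: h_def Yadd bil_add_left bil_add_right bil_scale_left bil_scale_right algebra_simps)
  have hscale: "h (r *\<^sub>R z) (r *\<^sub>R z) = r * r * h z z" for z r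
    by (simp add: h_def Yscale bil_scale_left bil_scale_right)
  \<comment> \<open>The unit sphere of dimension m-2, realized as vectors with last coordinate 0;
    the index \<open>i1\<close> makes it nonempty.\<close>
  define K where "K = {x :: (real, 'm) vec. norm x = 1 \<and> x $ last_index = 0}"
  have "K = sphere 0 1 \<inter> {x. x $ last_index = 0}" by (auto simp: K_def)
  moreover have "closed {x :: (real, 'm) vec. x $ last_index = 0}"
    by (intro closed_Collect_eq continuous_intros)
  ultimately have cK: "compact K" by (simp add: compact_Int_closed)
  have neK: "K \<noteq> {}"
  proof -
    have "axis i1 (1 :: real) $ last_index = 0" using m by (simp add: axis_def)
    moreover have "norm (axis i1 (1 :: real)) = 1" by (simp add: norm_eq_1 inner_axis_axis)
    ultimately have "axis i1 1 \<in> K" by (simp add: K_def)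
    then show ?thesis by blast
  qed
  have "continuous_on K (\<lambda>x. h x x)"
    unfolding h_def bil_def Y_def sum_component by (intro continuous_intros)
  then obtain x0 where x0: "x0 \<in> K" and min: "\<And>x. x \<in> K \<Longrightarrow> h x0 x0 \<le> h x x"
    using continuous_attains_inf[OF cK neK] by blast
  define \<kappa> where "\<kappa> = h x0 x0"
  have x0l: "x0 $ last_index = 0" "x0 \<bullet> x0 = 1"
    using x0 by (simp_all add: K_def norm_eq_1)
  have hmin: "\<kappa> * (x \<bullet> x) \<le> h x x" if xl: "x $ last_index = 0" for x
  proof (cases "x = 0")
    case True
    then show ?thesis using hscale[of 0 x] by simp
  next
    case False
    let ?r = "inverse (norm x)"
    have "?r *\<^sub>R x \<in> K" using False xl by (simp add: K_def)
    from min[OF this] have "\<kappa> \<le> ?r * ?r * h x x" unfolding hscale \<kappa>_def .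
    then have "\<kappa> * (norm x * norm x) \<le> ?r * ?r * h x x * (norm x * norm x)"
      by (rule mult_right_mono) simp
    also have "\<dots> = h x x" using False by (simp add: field_simps)
    finally show ?thesis by (simp add: dot_square_norm power2_eq_square)
  qed
  \<comment> \<open>The minimum inequality at x0 + t z is an equality for t = 0, so its linear term
    in t vanishes. This is the eigenvector equation tested against z.\<close>
  have crit: "h x0 z = \<kappa> * (x0 \<bullet> z)" if z: "z $ last_index = 0" for z
  proof -
    have "h x0 z - \<kappa> * (x0 \<bullet> z) = 0"
    proof (rule nonneg_quadratic_imp_eq_0[where a = "h z z - \<kappa> * (z \<bullet> z)"])
      fix t
      have "(x0 + t *\<^sub>R z) $ last_index = 0" using x0l z by simp
      from hmin[OF this] have "\<kappa> * (1 + 2 * t * (x0 \<bullet> z) + t * t * (z \<bullet> z)) \<le> \<kappa> + 2 * t * h x0 z + t * t * h z z"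
        unfolding hexp by (simp add: inner_add_left inner_add_right
            Inner_Product.real_inner_class.inner_add_left x0l \<kappa>_def inner_commute algebra_simps)
      then show "0 \<le> 2 * t * (h x0 z - \<kappa> * (x0 \<bullet> z)) + t * t * (h z z - \<kappa> * (z \<bullet> z))"
        by (simp add: algebra_simps)
    qed
    then show ?thesis by simp
  qed
  have spanY: "y = Y (\<chi> i. if i = last_index then 0 else ip q (ph q y) (u i))" if "dlam q y = 0" for y
  proof -
    have "Y (\<chi> i. if i = last_index then 0 else ip q (ph q y) (u i))
      = (\<Sum>i\<in>I. ip q (ph q y) (u i) *\<^sub>R e i q)"
      unfolding Y_def by (rule sum.cong[OF refl]) (simp add: I_def)
    then show ?thesis using span[OF that] by (simp only: u_def)
  qed
  have bound: "\<kappa> * ip q (ph q y) (ph q y) \<le> sgn (dlam q (etac q)) * bil q y y" if y: "dlam q y = 0" for y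
  proof -
    define x where "x = (\<chi> i. if i = last_index then 0 else ip q (ph q y) (u i))"
    have xl: "x $ last_index = 0" by (simp add: x_def)
    have yY: "y = Y x" unfolding x_def by (rule spanY[OF y])
    show ?thesis
      using hmin[OF xl] unfolding yY innerY norm_I[OF xl] h_def \<delta>_def .
  qed
  \<comment> \<open>Frame coefficients of the desired image of X. The derivative of n has no
    component along n, so they determine it completely.\<close>
  define s where "s X i = - sgn \<delta> * ip q (ctb_conn B q X nn) (u i)" for X i
  define S where "S X = tvec_of A c q (\<Sum>i\<in>I. s X i *\<^sub>R e i q)" for X
  have shape: "singular_shape_operator B q S"
    unfolding singular_shape_operator_def
  proof (intro conjI exI ballI)
    show "A2_point B q" by (rule q(3))
    show "open U" "q \<in> U" by (rule U(1), rule qU)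
    show "adapted_frame B (U \<inter> singular_set B) (\<lambda>i x. tvec_of A c x (e i x)) \<eta> nn" by (rule af)
    show "smooth_section B U nn" by (rule smooth_section_subset[OF nn_smooth]) (auto simp: U(2))
    show "c \<in> A" "q \<in> fst c" by (rule c, rule dom[OF q(1)])
    fix X assume "X \<in> singular_tangent_space B q"
    then obtain y where y: "X = tvec_of A c q y" "dlam q y = 0" unfolding T by blast
    have "dlam q (\<Sum>i\<in>I. s X i *\<^sub>R e i q) = 0"
      unfolding linear_sum[OF lind] by (simp add: linear_cmul[OF lind] de I_def)
    then show "S X \<in> singular_tangent_space B q" unfolding T S_def by blast
    let ?D = "ctb_conn B q X nn"
    have DE: "?D \<in> fib q" unfolding y(1) by (rule D_fibre[OF nn_smooth q(1)])
    have "?D = (\<Sum>i\<in>UNIV. ip q ?D (if i = last_index then nn q else ph q (e i q))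
        *\<^sub>R (if i = last_index then nn q else ph q (e i q)))"
      by (rule orthonormal_expansion[OF on DE])
    also have "\<dots> = (\<Sum>i\<in>I. ip q ?D (u i) *\<^sub>R u i)"
      unfolding I_def u_def
      by (subst sum.remove[of _ last_index]) (simp_all add: y(1) D_nn_nn[OF q(1)])
    finally have D: "?D = (\<Sum>i\<in>I. ip q ?D (u i) *\<^sub>R u i)" .
    have "phi q (S X) = (\<Sum>i\<in>I. s X i *\<^sub>R u i)"
      unfolding S_def u_def linear_sum[OF linear_ph[OF q(1)]] linear_cmul[OF linear_ph[OF q(1)]] ..
    also have "\<dots> = (- sgn \<delta>) *\<^sub>R (\<Sum>i\<in>I. ip q ?D (u i) *\<^sub>R u i)"
      by (simp add: s_def scaleR_sum_right)
    also have "\<dots> = (- sgn \<delta>) *\<^sub>R ?D" by (simp only: D[symmetric])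
    finally show "phi q (S X) = - sgn (dfun c lam q (\<eta> q)) *\<^sub>R ctb_conn B q X nn"
      by (simp add: \<delta>_def dfun_chart_deriv \<eta>_def tvec_of_chart[OF c dom[OF q(1)]])
  qed simp
  define X where "X = tvec_of A c q (Y x0)"
  have "s X i = \<kappa> * x0 $ i" if i: "i \<in> I" for i
  proof -
    have eY: "e i q = Y (axis i 1)"
    proof -
      have "Y (axis i 1) = (\<Sum>j\<in>I. if j = i then e i q else 0)"
        unfolding Y_def by (rule sum.cong[OF refl]) (auto simp: axis_def)
      then show ?thesis using i by (simp add: I_def)
    qed
    have "s X i = sgn \<delta> * bil q (Y x0) (e i q)"
      unfolding s_def X_def u_def D_nn_ph[OF q(1,2) dY] by simp
    also have "\<dots> = h x0 (axis i 1)" by (simp add: h_def eY)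
    also have "\<dots> = \<kappa> * x0 $ i"
    proof -
      have "axis i (1 :: real) $ last_index = 0" using i by (simp add: I_def axis_def)
      from crit[OF this] show ?thesis by (simp add: inner_axis)
    qed
    finally show ?thesis .
  qed
  then have "(\<Sum>i\<in>I. s X i *\<^sub>R e i q) = \<kappa> *\<^sub>R Y x0"
    by (simp add: Y_def scaleR_sum_right)
  then have SX: "S X = (\<lambda>c'. \<kappa> *\<^sub>R X c')"
    by (simp add: S_def X_def tvec_of_scale[OF q(1)])
  have X: "X \<in> singular_tangent_space B q" unfolding T X_def using dY by blast
  have "X \<noteq> (\<lambda>_. 0)"
  proof
    assume "X = (\<lambda>_. 0)"
    then have "Y x0 = 0"
      using tvec_of_chart[OF c dom[OF q(1)], of "Y x0"] by (simp add: X_def)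
    then have "ip q (ph q (Y x0)) (ph q (Y x0)) = 0"
      using linear_0[OF linear_ph[OF q(1)]] inner_0_left[OF fibre_0] by simp
    then show False using innerY[of x0] norm_I[OF x0l(1)] x0l(2) by simp
  qed
  with shape X SX have "singular_principal_curvature B q \<kappa>"
    unfolding singular_principal_curvature_def by blast
  from that[OF this bound] show thesis .
qed

text \<open>The Rayleigh quotient is evaluated at the projection of \<open>\<eta>\<close> to the tangent space of the
  singular set along the \<open>k\<close>-th coordinate direction.\<close>

lemma curvature_bound:
  assumes q: "q \<in> W" "lam q = 0" "A2_point B q"
    and \<kappa>: "\<And>y. dlam q y = 0 \<Longrightarrow> \<kappa> * ip q (ph q y) (ph q y) \<le> sgn (dlam q (etac q)) * bil q y y"
    and bd: "\<bar>dlam q (etac q)\<bar> * (\<bar>bb q k k\<bar> - C * ip q (\<Phi> k q) (\<Phi> k q))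
      < dlam q (axis k 1) * dlam q (axis k 1)"
  shows "\<kappa> \<le> C"
proof (rule ccontr)
  assume "\<not> \<kappa> \<le> C"
  let ?e = "axis k 1 :: (real, 'm) vec"
  define \<delta> where "\<delta> = dlam q (etac q)"
  define d where "d = dlam q ?e"
  define g where "g = ip q (\<Phi> k q) (\<Phi> k q)"
  define a where "a = \<delta> / d"
  have d: "d \<noteq> 0" using dlam_k[OF q(1)] by (simp add: d_def)
  have \<delta>: "\<delta> \<noteq> 0" using A2_iff[OF q(1,2)] q(3) by (simp add: \<delta>_def)
  have lind: "linear (dlam q)" by (rule linear_dlam[OF q(1)])
  define y where "y = etac q - a *\<^sub>R ?e"
  have dy: "dlam q y = 0"
    using d by (simp add: y_def linear_diff[OF lind] linear_cmul[OF lind] a_def \<delta>_def[symmetric] d_def[symmetric])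
  have pe: "ph q ?e = \<Phi> k q" by (simp add: \<Phi>_def coord_vec_tvec_of)
  have "ph q (etac q) = 0" using phi_\<eta>[OF q(1)] q(2) by (simp add: \<eta>_def)
  then have py: "ph q y = (- a) *\<^sub>R \<Phi> k q"
    by (simp add: y_def linear_diff[OF linear_ph[OF q(1)]] linear_cmul[OF linear_ph[OF q(1)]] pe)
  have \<Phi>E: "\<Phi> k q \<in> fib q" by (rule \<Phi>_fibre[OF dom[OF q(1)]])
  have gy: "ip q (ph q y) (ph q y) = a * a * g"
  proof -
    have "ip q (r *\<^sub>R \<Phi> k q) (r *\<^sub>R \<Phi> k q) = r * r * g" for r
      using inner_sym[OF \<Phi>E fibre_scale[OF \<Phi>E, of r]]
      by (simp add: inner_scale_left \<Phi>E fibre_scale g_def)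
    from this[of "- a"] show ?thesis unfolding py by simp
  qed
  have g0: "g \<ge> 0"
    using inner_pos[OF \<Phi>E] inner_0_left[OF fibre_0, of q] by (cases "\<Phi> k q = 0") (auto simp: g_def)
  have bee: "bil q ?e ?e = bb q k k"
    by (simp add: bil_def axis_def if_distrib[of "\<lambda>x. x * _"] if_distrib[of "\<lambda>x. _ * x"] cong: if_cong)
  have bd1: "bil q z (etac q) = dlam q z" for z by (rule bil_etac[OF q(1,2)])
  have bd2: "bil q (etac q) z = dlam q z" for z using bd1 bil_sym[OF q(1)] by simp
  have neg: "y = etac q + (- a) *\<^sub>R ?e" by (simp add: y_def)
  have byz: "bil q y z = bil q (etac q) z - a * bil q ?e z" for z
    using bil_add_left[of q "etac q" "(- a) *\<^sub>R ?e" z] unfolding bil_scale_left neg[symmetric] by simp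
  \<comment> \<open>The term b(\<eta>,y) is d\<lambda>(y) = 0. The other term is -a (d - a b(v,v)),
    and a d = \<delta> leaves -\<delta> + a^2 b(v,v).\<close>
  have "bil q y y = bil q (etac q) y - a * bil q ?e y" by (rule byz)
  also have "bil q ?e y = d - a * bb q k k"
    unfolding bil_sym[OF q(1), of ?e y] byz[of ?e] by (simp add: bd2 bee d_def)
  finally have "bil q y y = - \<delta> + a * a * bb q k k"
    using d by (simp add: bd2 dy a_def field_simps)
  then have "\<kappa> * (a * a * g) \<le> sgn \<delta> * (- \<delta> + a * a * bb q k k)"
    using \<kappa>[OF dy] by (simp add: gy \<delta>_def)
  also have "\<dots> \<le> - \<bar>\<delta>\<bar> + a * a * \<bar>bb q k k\<bar>"
  proof -
    have "sgn \<delta> * bb q k k \<le> \<bar>bb q k k\<bar>"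
      using abs_ge_self[of "bb q k k"] abs_ge_minus_self[of "bb q k k"] by (simp add: sgn_if)
    then have "a * a * (sgn \<delta> * bb q k k) \<le> a * a * \<bar>bb q k k\<bar>" by (rule mult_left_mono) simp
    moreover have "sgn \<delta> * \<delta> = \<bar>\<delta>\<bar>" by (simp add: sgn_if)
    ultimately show ?thesis by (simp add: algebra_simps)
  qed
  finally have "\<kappa> * (a * a * g) \<le> - \<bar>\<delta>\<bar> + a * a * \<bar>bb q k k\<bar>" .
  moreover have "C * (a * a * g) \<le> \<kappa> * (a * a * g)"
    using \<open>\<not> \<kappa> \<le> C\<close> g0 by (intro mult_right_mono) auto
  ultimately have "\<bar>\<delta>\<bar> \<le> a * a * (\<bar>bb q k k\<bar> - C * g)" by (simp add: algebra_simps)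
  \<comment> \<open>Since a^2 d^2 = \<delta>^2, clearing the denominator and cancelling one factor
    |\<delta>| > 0 gives the negation of the assumed strict inequality.\<close>
  then have "\<bar>\<delta>\<bar> * (d * d) \<le> a * a * (\<bar>bb q k k\<bar> - C * g) * (d * d)" by (rule mult_right_mono) simp
  also have "\<dots> = \<bar>\<delta>\<bar> * (\<bar>\<delta>\<bar> * (\<bar>bb q k k\<bar> - C * g))"
    using d by (simp add: a_def field_simps)
  finally have "d * d \<le> \<bar>\<delta>\<bar> * (\<bar>bb q k k\<bar> - C * g)" using \<delta> by simp
  then show False using bd by (simp add: d_def g_def \<delta>_def)
qed

text \<open>Both sides are continuous. At \<open>p\<close> the left side is 0, as d\<lambda>(\<eta>)
  vanishes off the A2-points, and the right side is a positive square; hence the inequality persists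
  nearby, for each fixed \<open>C\<close>.\<close>

lemma eventually_bound:
  assumes p: "p \<in> W" "lam p = 0" "\<not> A2_point B p"
  obtains V where "open V" "p \<in> V" "V \<subseteq> W"
    "\<And>q. q \<in> V \<Longrightarrow> \<bar>dlam q (etac q)\<bar> * (\<bar>bb q k k\<bar> - C * ip q (\<Phi> k q) (\<Phi> k q))
      < dlam q (axis k 1) * dlam q (axis k 1)"
proof -
  let ?f = "\<lambda>q. \<bar>dlam q (etac q)\<bar> * (\<bar>bb q k k\<bar> - C * ip q (\<Phi> k q) (\<Phi> k q))
      - dlam q (axis k 1) * dlam q (axis k 1)"
  have sd: "smooth_fun A W (\<lambda>x. dlam x v)" for v
    by (rule smooth_fun_chart_deriv[OF W(1) lam_smooth c W(2)])
  have "smooth_fun A W (\<lambda>x. \<Sum>i\<in>UNIV. etac x $ i * dlam x (axis i 1))"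
    by (intro smooth_fun_sum smooth_fun_mult W etac_smooth sd)
  then have "smooth_fun A W (\<lambda>x. dlam x (etac x))"
    by (rule smooth_fun_cong[OF W(1), rotated]) (use linear_axis_expansion[OF linear_dlam] in simp)
  note this[THEN smooth_fun_continuous_on[OF W(1)]] and sd[THEN smooth_fun_continuous_on[OF W(1)]]
    and bb_smooth[THEN smooth_fun_continuous_on[OF W(1)]]
    and inner_smooth[OF W(1) \<Phi>_smooth \<Phi>_smooth, THEN smooth_fun_continuous_on[OF W(1)]]
  then have "continuous_on W ?f" by (intro continuous_intros)
  then have "open (W \<inter> ?f -` {..<0})"
    by (rule continuous_open_preimage[OF _ W(1)]) simp
  moreover have "dlam p (etac p) = 0" using A2_iff[OF p(1,2)] p(3) by blast
  then have "p \<in> W \<inter> ?f -` {..<0}"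
    using p(1) dlam_k[OF p(1)] by (simp add: zero_less_mult_iff) linarith
  ultimately show thesis by (intro that[of "W \<inter> ?f -` {..<0}"]) auto
qed

text \<open>With a single index, \<open>etac\<close> would be a nonzero multiple of the direction k,
  on which d\<lambda> is nonzero, and \<open>p\<close> would be an A2-point.\<close>

lemma not_A2_imp_last_index:
  assumes p: "p \<in> W" "lam p = 0" "\<not> A2_point B p"
  shows "\<exists>i1. i1 \<noteq> (last_index :: 'm)"
proof (rule ccontr)
  assume "\<not> ?thesis"
  then have eq: "i = k" for i :: 'm by metis
  have "dlam p (etac p) = 0" using A2_iff[OF p(1,2)] p(3) by blast
  moreover have "etac p = etac p $ k *\<^sub>R axis k 1"
    unfolding vec_eq_iff using eq by (metis axis_nth mult.right_neutral real_scaleR_def vector_scaleR_component)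
  then have "dlam p (etac p) = etac p $ k * dlam p (axis k 1)"
    using linear_cmul[OF linear_dlam[OF p(1)], of "etac p $ k" "axis k 1"] by simp
  ultimately have "etac p $ k = 0" using dlam_k[OF p(1)] by simp
  then have "etac p = 0" using eq by (simp add: vec_eq_iff) metis
  then show False using etac_nonzero[OF p(1)] by blast
qed

end

section \<open>Existence of the local setting at a non-degenerate point\<close>

context coherent_bundle
begin

text \<open>Each condition of the locale is open and holds at \<open>p\<close>, so finitely many
  shrinkings suffice. The cofactor condition comes last, since the cofactors are taken with respect
  to the frame already chosen.\<close>

lemma normal_chart_exists:
  assumes p: "nondegenerate B p"
  obtains c W \<epsilon> k i0 where "normal_chart B c W \<epsilon> k i0" "p \<in> W"
proof -
  obtain c v where c: "c \<in> A" "p \<in> fst c" "dfun c (phi_jacobian B c) p v \<noteq> 0"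
    using p unfolding nondegenerate_def by blast
  let ?lam = "phi_jacobian B c"
  have o: "open (fst c)" by (rule open_dom[OF c(1)])
  have "smooth_section B (fst c) (\<lambda>x. phi x (coord_vec A c j x))" for j
  proof -
    have "smooth_vf A (fst c) (\<lambda>x. tvec_of A c x (axis j 1))"
      by (rule smooth_vf_tvec_of[OF c(1) o order_refl]) (rule smooth_fun_const)
    then show ?thesis
      unfolding coord_vec_tvec_of using bh[unfolded bundle_hom_def, THEN conjunct2, THEN conjunct2] o by blast
  qed
  then have sl: "smooth_fun A (fst c) ?lam"
    unfolding phi_jacobian_def[abs_def] by (rule coor_smooth[OF o])
  have "\<exists>k. chart_deriv c ?lam p (axis k 1) \<noteq> 0"
  proof (rule ccontr)
    assume "\<not> ?thesis"
    then have "chart_deriv c ?lam p (v c) = 0"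
      using linear_axis_expansion[OF linear_chart_deriv[OF o sl c(1,2,2)], of "v c"] by simp
    then show False using c(3) by (simp add: dfun_chart_deriv)
  qed
  then obtain k where k: "chart_deriv c ?lam p (axis k 1) \<noteq> 0" by blast
  define W1 where "W1 = {x \<in> fst c. chart_deriv c ?lam x (axis k 1) \<noteq> 0}"
  have W1: "open W1" "p \<in> W1" "W1 \<subseteq> fst c"
    using open_smooth_fun_nonzero[OF o smooth_fun_chart_deriv[OF o sl c(1) order_refl]] c(2) k
    by (auto simp: W1_def)
  show thesis
  proof (rule positive_orthonormal_frame[of p])
    fix W0 and \<epsilon> :: "'m \<Rightarrow> 'a \<Rightarrow> 'e"
    assume W0: "open W0" "p \<in> W0" "\<And>i. smooth_section B W0 (\<epsilon> i)"
      "\<And>x. x \<in> W0 \<Longrightarrow> orthonormal_frame B x (\<lambda>i. \<epsilon> i x)"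
      "\<And>x. x \<in> W0 \<Longrightarrow> ctb_coor B x (\<lambda>i. \<epsilon> i x) = 1"
    have fc: "framed_chart B c W \<epsilon> k" if "open W" "W \<subseteq> W0 \<inter> W1" for W
    proof (unfold_locales)
      show "smooth_section B W (\<epsilon> i)" for i
        by (rule smooth_section_subset[OF W0(3)]) (use that in auto)
    qed (use that W0 W1 c in \<open>auto simp: W1_def\<close>)
    interpret F: framed_chart B c "W0 \<inter> W1" \<epsilon> k
      by (rule fc) (use W0 W1 in auto)
    have pW: "p \<in> W0 \<inter> W1" using W0 W1 by auto
    have "F.lam p = 0"
      using p F.singular_iff[OF pW] unfolding nondegenerate_def by blast
    then obtain i0 u where "F.cof p i0 u \<noteq> 0" using F.cof_nonzero[OF pW] by blast
    then have "\<exists>a. F.cof p i0 (axis a 1) \<noteq> 0"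
      using linear_axis_expansion[OF F.linear_cof, of p i0 u] by (metis (no_types, lifting) scaleR_zero_right sum.neutral)
    then obtain a where a: "F.cof p i0 (axis a 1) \<noteq> 0" by blast
    define W2 where "W2 = {x \<in> W0 \<inter> W1. F.cof x i0 (axis a 1) \<noteq> 0}"
    have W2: "open W2" "p \<in> W2" "W2 \<subseteq> W0 \<inter> W1"
      using open_smooth_fun_nonzero[OF F.W(1) F.cof_smooth[OF smooth_fun_const]] a pW
      by (auto simp: W2_def)
    have "normal_chart B c W2 \<epsilon> k i0"
      unfolding normal_chart_def normal_chart_axioms_def using fc[OF W2(1,3)] by (auto simp: W2_def)
    then show thesis using that W2(2) by blast
  qed
qed

end

theorem theorem2p12:
  fixes B :: "('a::{t2_space,second_countable_topology}, 'm::{finite,linorder}, 'e::real_vector) ctb"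
    and p :: 'a and \<gamma> :: "real \<Rightarrow> 'a"
  assumes "coherent_tangent_bundle B"
    and "p \<in> singular_set B"
    and "nondegenerate B p"
    and "\<not> A2_point B p"
    and "regular_curve (ctb_atlas B) {0..1} \<gamma>"
    and "\<gamma> ` {0..1} \<subseteq> singular_set B"
    and "\<gamma> 0 = p"
    and "\<forall>t\<in>{0<..1}. A2_point B (\<gamma> t)"
  shows "\<exists>\<kappa>. (\<forall>t\<in>{0<..1}. singular_principal_curvature B (\<gamma> t) (\<kappa> t)) \<and>
             filterlim \<kappa> at_bot (at_right 0)"
proof -
  interpret coherent_bundle B by unfold_locales (rule assms(1))
  obtain c W \<epsilon> k i0 where N: "normal_chart B c W \<epsilon> k i0" and pW: "p \<in> W"
    by (rule normal_chart_exists[OF assms(3)])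
  interpret N: normal_chart B c W \<epsilon> k i0 by (rule N)
  have lp: "N.lam p = 0" using N.singular_iff[OF pW] assms(2) by blast
  obtain i1 where m: "i1 \<noteq> (last_index :: 'm)"
    using N.not_A2_imp_last_index[OF pW lp assms(4)] by blast
  \<comment> \<open>The curve may leave \<open>W\<close>, so at an A2-point elsewhere a curvature is
    produced in a normal chart around that point; the index \<open>i1\<close> depends only on the
    index type.\<close>
  have ex: "\<exists>\<kappa>. singular_principal_curvature B q \<kappa>" if q: "A2_point B q" for q
  proof -
    have nd: "nondegenerate B q" using q unfolding A2_point_def by blast
    obtain c' W' \<epsilon>' k' i0' where N': "normal_chart B c' W' \<epsilon>' k' i0'" and qW: "q \<in> W'"
      by (rule normal_chart_exists[OF nd])
    interpret N': normal_chart B c' W' \<epsilon>' k' i0' by (rule N')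
    have "N'.lam q = 0"
      using N'.singular_iff[OF qW] nd unfolding nondegenerate_def by blast
    from N'.principal_curvature_exists[OF m qW this q] show ?thesis by metis
  qed
  \<comment> \<open>Being a principal curvature does not single out the smallest one, so the
    Rayleigh bound is chosen along with it on \<open>W\<close>. Outside \<open>W\<close> any
    principal curvature will do, as only points near \<open>p\<close> matter for the limit.\<close>
  define good where "good q \<kappa> \<longleftrightarrow> singular_principal_curvature B q \<kappa> \<and> (q \<in> W \<longrightarrow>
    (\<forall>y. N.dlam q y = 0 \<longrightarrow> \<kappa> * ip q (N.ph q y) (N.ph q y) \<le> sgn (N.dlam q (N.etac q)) * N.bil q y y))"
    for q \<kappa>
  have lamW: "N.lam q = 0" if "q \<in> W" "A2_point B q" for q
    using N.singular_iff[OF that(1)] that(2) unfolding A2_point_def nondegenerate_def by blast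
  have "\<exists>\<kappa>. good q \<kappa>" if q: "A2_point B q" for q
  proof (cases "q \<in> W")
    case True
    from N.principal_curvature_exists[OF m True lamW[OF True q] q] show ?thesis
      unfolding good_def by metis
  next
    case False
    with ex[OF q] show ?thesis by (simp add: good_def)
  qed
  then obtain f where f: "\<And>q. A2_point B q \<Longrightarrow> good q (f q)" by metis
  show ?thesis
  proof (intro exI conjI ballI)
    show "singular_principal_curvature B (\<gamma> t) (f (\<gamma> t))" if "t \<in> {0<..1}" for t
      using f assms(8) that by (simp add: good_def)
    show "filterlim (\<lambda>t. f (\<gamma> t)) at_bot (at_right 0)"
      unfolding filterlim_at_bot
    proof
      fix C :: real
      obtain V where V: "open V" "p \<in> V" "V \<subseteq> W"
        "\<And>q. q \<in> V \<Longrightarrow> \<bar>N.dlam q (N.etac q)\<bar> * (\<bar>N.bb q k k\<bar> - C * ip q (N.\<Phi> k q) (N.\<Phi> k q))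
          < N.dlam q (axis k 1) * N.dlam q (axis k 1)"
        using N.eventually_bound[OF pW lp assms(4), of C] by metis
      \<comment> \<open>\<open>V\<close> depends on \<open>C\<close>; continuity of the curve at its
        endpoint brings all small parameters into it.\<close>
      have "\<forall>\<^sub>F t in nhds 0. t \<in> {0..1} \<longrightarrow> \<gamma> t \<in> V"
        using assms(5) V assms(7) unfolding regular_curve_def
        by (intro smooth_curve_eventually_within) auto
      then have "\<forall>\<^sub>F t in at_right 0. t \<in> {0..1} \<longrightarrow> \<gamma> t \<in> V"
        by (rule filter_leD[OF at_within_le_nhds])
      moreover have "\<forall>\<^sub>F t in at_right (0 :: real). t \<in> {0<..<1}"
        by (rule eventually_at_right_real) simp
      ultimately show "\<forall>\<^sub>F t in at_right 0. f (\<gamma> t) \<le> C"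
      proof eventually_elim
        case (elim t)
        then have q: "A2_point B (\<gamma> t)" "\<gamma> t \<in> V" "\<gamma> t \<in> W" using assms(8) V(3) by auto
        show ?case
        proof (rule N.curvature_bound[OF q(3) lamW[OF q(3,1)] q(1) _ V(4)[OF q(2)]])
          show "f (\<gamma> t) * ip (\<gamma> t) (N.ph (\<gamma> t) y) (N.ph (\<gamma> t) y)
              \<le> sgn (N.dlam (\<gamma> t) (N.etac (\<gamma> t))) * N.bil (\<gamma> t) y y" if "N.dlam (\<gamma> t) y = 0" for y
            using f[OF q(1)] q(3) that by (simp add: good_def)
        qed
      qed
    qed
  qed
qed

end
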